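(* Let $(A,\mathbf{R},\alpha)$ be a one-parameter C*-dynamical system. If $B\subset A$ is a norm-closed subalgebra containing $A^{\alpha}([0,\infty))$, then $B$ is $\alpha$-invariant, i.e. $\alpha_t(B)\subset B$ for every $t\in\mathbf{R}$.
   Context: A one-parameter C*-dynamical system $(A,\mathbf{R},\alpha)$ consists of a C*-algebra $A$ (not assumed unital) and a one-parameter group $\{\alpha_t\}_{t\in\mathbf{R}}$ of $*$-automorphisms of $A$ such that $t\mapsto\alpha_t(x)$ is norm-continuous for every $x\in A$. For $f\in L^1(\mathbf{R})$ put $\alpha_f(x)=\int_{\mathbf{R}} f(t)\alpha_t(x)\,dt$ and let $\widehat{f}(\gamma)=\int_{\mathbf{R}} f(t)e^{i\gamma t}\,dt$ be the Fourier transform, where $\widehat{\mathbf{R}}$ is identified with $\mathbf{R}$. For $x\in A$, the Arveson spectrum $sp_{\alpha}(x)$ is the set of all $\gamma\in\widehat{\mathbf{R}}$ such that for every neighborhood $V$ of $\gamma$ there is $f\in L^1(\mathbf{R})$ with $\mathrm{supp}(\widehat{f})$ compact and contained in $V$ and $\alpha_f(x)\neq 0$. For a closed set $E\subset\widehat{\mathbf{R}}$, the spectral subspace is $A^{\alpha}(E)=\{x\in A: sp_{\alpha}(x)\subset E\}$. In particular $A^{\alpha}([0,\infty))$ is the algebra of analytic elements of the system. Subalgebras are not assumed to be self-adjoint. *)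

theory Defs
  imports "HOL-Analysis.Analysis"
begin

text \<open>
  C*-algebras, not necessarily unital, separable or nonzero. The inherited class
  \<open>real_normed_algebra\<close> supplies the (non-unital) ring structure and the submultiplicative norm,
  \<open>banach\<close> completeness; the inherited real scaling is tied to the complex one by \<open>scaleC_of_real\<close>.
\<close>

class cstar_algebra = real_normed_algebra + banach +
  fixes scaleC :: "complex \<Rightarrow> 'a \<Rightarrow> 'a" (infixr \<open>*\<^sub>C\<close> 75)
    and adj :: "'a \<Rightarrow> 'a"
  assumes scaleC_add_right: "c *\<^sub>C (x + y) = c *\<^sub>C x + c *\<^sub>C y"
    and scaleC_add_left: "(c + d) *\<^sub>C x = c *\<^sub>C x + d *\<^sub>C x"
    and scaleC_scaleC: "c *\<^sub>C d *\<^sub>C x = (c * d) *\<^sub>C x"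
    and scaleC_of_real: "complex_of_real r *\<^sub>C x = r *\<^sub>R x"
    and mult_scaleC_left: "(c *\<^sub>C x) * y = c *\<^sub>C (x * y)"
    and mult_scaleC_right: "x * (c *\<^sub>C y) = c *\<^sub>C (x * y)"
    and norm_scaleC: "norm (c *\<^sub>C x) = cmod c * norm x"
    and adj_adj: "adj (adj x) = x"
    and adj_add: "adj (x + y) = adj x + adj y"
    and adj_scaleC: "adj (c *\<^sub>C x) = cnj c *\<^sub>C adj x"
    and adj_mult: "adj (x * y) = adj y * adj x"
    and cstar_identity: "norm (adj x * x) = (norm x)\<^sup>2"

definition star_automorphism :: "('a::cstar_algebra \<Rightarrow> 'a) \<Rightarrow> bool" where
  "star_automorphism \<phi> \<longleftrightarrow>
     bij \<phi> \<and>
     (\<forall>x y. \<phi> (x + y) = \<phi> x + \<phi> y) \<and>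
     (\<forall>c x. \<phi> (c *\<^sub>C x) = c *\<^sub>C \<phi> x) \<and>
     (\<forall>x y. \<phi> (x * y) = \<phi> x * \<phi> y) \<and>
     (\<forall>x. \<phi> (adj x) = adj (\<phi> x))"

locale cstar_dynamical_system =
  fixes \<alpha> :: "real \<Rightarrow> 'a::cstar_algebra \<Rightarrow> 'a"
  assumes star_automorphism: "star_automorphism (\<alpha> t)"
    and group_zero: "\<alpha> 0 = id"
    and group_add: "\<alpha> (s + t) = \<alpha> s \<circ> \<alpha> t"
    and norm_continuous: "continuous_on UNIV (\<lambda>t. \<alpha> t x)"

text \<open>
  The Bochner integral of the library is restricted to second countable codomains, which would
  exclude non-separable algebras, so the vector-valued integral below is the Henstock--Kurzweil
  one. For \<open>f\<close> in \<open>L\<^sup>1\<close> and a dynamical system \<open>\<alpha>\<close>, the integrand is Bochner integrable (the orbit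
  of \<open>x\<close> is bounded, norm-continuous and hence separable), so the Henstock--Kurzweil integral
  exists and equals the Bochner integral.
\<close>

definition smear :: "(real \<Rightarrow> 'a::cstar_algebra \<Rightarrow> 'a) \<Rightarrow> (real \<Rightarrow> complex) \<Rightarrow> 'a \<Rightarrow> 'a" where
  "smear \<alpha> f x = integral UNIV (\<lambda>t. f t *\<^sub>C \<alpha> t x)"

definition fourier :: "(real \<Rightarrow> complex) \<Rightarrow> real \<Rightarrow> complex" where
  "fourier f \<gamma> = (LINT t|lborel. f t * exp (\<i> * complex_of_real \<gamma> * complex_of_real t))"

definition arveson_spectrum :: "(real \<Rightarrow> 'a::cstar_algebra \<Rightarrow> 'a) \<Rightarrow> 'a \<Rightarrow> real set" where
  "arveson_spectrum \<alpha> x =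
     {\<gamma>. \<forall>V. \<gamma> \<in> interior V \<longrightarrow>
        (\<exists>f. integrable lborel f \<and>
             compact (closure {\<xi>. fourier f \<xi> \<noteq> 0}) \<and>
             closure {\<xi>. fourier f \<xi> \<noteq> 0} \<subseteq> V \<and>
             smear \<alpha> f x \<noteq> 0)}"

definition spectral_subspace :: "(real \<Rightarrow> 'a::cstar_algebra \<Rightarrow> 'a) \<Rightarrow> real set \<Rightarrow> 'a set" where
  "spectral_subspace \<alpha> E = {x. arveson_spectrum \<alpha> x \<subseteq> E}"

definition subalgebra :: "'a::cstar_algebra set \<Rightarrow> bool" where
  "subalgebra B \<longleftrightarrow>
     0 \<in> B \<and>
     (\<forall>x\<in>B. \<forall>y\<in>B. x + y \<in> B) \<and>
     (\<forall>c. \<forall>x\<in>B. c *\<^sub>C x \<in> B) \<and>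
     (\<forall>x\<in>B. \<forall>y\<in>B. x * y \<in> B)"

end

theory Submission
  imports Defs "HOL-Real_Asymp.Real_Asymp"
begin

text \<open>
  Let \<open>x \<in> B\<close>. Split \<open>x\<close> into pieces \<open>x\<^sub>n\<close> whose spectrum lies in \<open>[(n - 1) / J, (n + 1) / J]\<close>, obtained as
  the Fourier coefficients of a periodization of the orbit of \<open>x\<close>, so that
  \<open>\<Sum>n. adj x\<^sub>n * x\<^sub>n\<close> is bounded independently of the mesh \<open>1 / J\<close>. Elements of the unitization
  are sorted into layers: \<open>y\<close> is in layer \<open>p\<close> if \<open>x * y\<close> and all \<open>z * y\<close> with \<open>z\<close> of spectrum at least
  \<open>-p / J\<close> belong to \<open>B\<close>. Starting from the unit, in layer \<open>0\<close>, a sequence \<open>b\<^sub>p\<close> in layer \<open>p\<close> is constructed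
  in the spirit of Cohen's proof of Wermer's maximality theorem: \<open>b\<^bsub>p+1\<^esub>\<close> is obtained from \<open>b\<^sub>p\<close> through
  the resolvent of a nearly accretive element \<open>q\<close> that maps layer \<open>p\<close> into layer \<open>p + 1\<close>, and the
  operator inequality \<open>adj b\<^sub>p * b\<^sub>p - adj b\<^bsub>p+1\<^esub> * b\<^bsub>p+1\<^esub> \<ge> adj (v * Y\<^sub>p) * (v * Y\<^sub>p) / \<eta>\<close> shows that the
  difference \<open>Y\<^sub>p = b\<^sub>p - b\<^bsub>p+1\<^esub>\<close> is almost annihilated by the part \<open>v\<close> of \<open>x\<close> that would
  move layer \<open>p\<close> out of \<open>B\<close>. Hence a translate of \<open>x\<close> acts on \<open>Y\<^sub>p\<close> nearly as the multiple of
  \<open>x\<close> by the phase belonging to the frequency \<open>-p / J\<close>, and summation over \<open>p\<close> approximates \<open>\<alpha> t x\<close> by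
  elements of \<open>B\<close>. The errors of the roughly \<open>J\<close> layers add up to \<open>O(1 / sqrt J)\<close>, by the Cauchy-Schwarz
  inequality and the square function bound for the pieces.
\<close>

text \<open>The obstacle is that pieces of negative frequency of an element of \<open>B\<close> need
  not lie in \<open>B\<close>; at hand are only \<open>x\<close> itself and elements with spectrum
  in [0, infinity). Hence \<open>q\<close> contains the whole \<open>x\<close>, in
  \<open>adj u * x\<close>, and is corrected by products \<open>adj (X m) * X n\<close> of positive
  spectrum. The weights are squared in \<open>u\<close> but not in \<open>v\<close> because (k_m^2 +
  k_n^2) / 2 - k_m k_n = (k_m - k_n)^2 / 2, so the real part of \<open>q\<close> misses
  \<open>adj v * v\<close> only to second order. This is decisive: with Lipschitz constants of order
  1 / J the loss \<open>\<eta>\<close> per layer is of order 1 / J^2, and Cauchy-Schwarz over about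
  J layers gives sqrt (J / J^2); a first-order loss would give no decay. The squares and real parts
  ask for real weights, so cosine and sine combinations of \<open>\<alpha> t x\<close> and
  \<open>\<alpha> (- t) x\<close> are approximated separately. The mesh 1 / J is realized by
  speeding up the flow by the factor J: the frequency grid becomes the integers, and the time t
  becomes t / J. Positivity in the unital algebra is expressed through the norm, and square roots
  arise as fixed points of a contraction.\<close>

lemma bounded_linear_scaleC: "bounded_linear (\<lambda>x::'a::cstar_algebra. c *\<^sub>C x)"
proof (rule bounded_linear_intro[where K = "cmod c"])
  show "c *\<^sub>C (r *\<^sub>R x) = r *\<^sub>R (c *\<^sub>C x)" for r and x :: 'a
    by (metis mult.commute scaleC_of_real scaleC_scaleC)
qed (simp_all add: scaleC_add_right norm_scaleC mult.commute)

lemma bounded_bilinear_scaleC: "bounded_bilinear (\<lambda>c (x::'a::cstar_algebra). c *\<^sub>C x)"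
proof
  fix r :: real and c d :: complex and x y :: 'a
  show "(c + d) *\<^sub>C x = c *\<^sub>C x + d *\<^sub>C x" "c *\<^sub>C (x + y) = c *\<^sub>C x + c *\<^sub>C y"
    by (simp_all add: scaleC_add_left scaleC_add_right)
  show "(r *\<^sub>R c) *\<^sub>C x = r *\<^sub>R (c *\<^sub>C x)"
    by (metis scaleC_of_real scaleC_scaleC scaleR_conv_of_real)
  show "c *\<^sub>C (r *\<^sub>R x) = r *\<^sub>R (c *\<^sub>C x)"
    by (simp add: bounded_linear.linear linear_cmul bounded_linear_scaleC)
  show "\<exists>K. \<forall>a (b::'a). norm (a *\<^sub>C b) \<le> norm a * norm b * K"
    by (rule exI[of _ 1]) (simp add: norm_scaleC)
qed

interpretation scaleC: bounded_bilinear "\<lambda>c (x::'a::cstar_algebra). c *\<^sub>C x"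
  by (rule bounded_bilinear_scaleC)

lemma scaleC_one [simp]: "1 *\<^sub>C (x::'a::cstar_algebra) = x"
  by (metis of_real_1 scaleC_of_real scaleR_one)

lemma norm_adj [simp]: "norm (adj (x::'a::cstar_algebra)) = norm x"
proof -
  have le: "norm y \<le> norm (adj y)" for y :: 'a
  proof (cases "y = 0")
    case False
    have "norm y * norm y \<le> norm (adj y) * norm y"
      using norm_mult_ineq[of "adj y" y] by (simp add: cstar_identity power2_eq_square)
    then show ?thesis using False by simp
  qed auto
  show ?thesis using le[of x] le[of "adj x"] by (simp add: adj_adj)
qed

lemma bounded_linear_adj: "bounded_linear (adj :: 'a::cstar_algebra \<Rightarrow> 'a)"
proof (rule bounded_linear_intro[where K = 1])
  show "adj (r *\<^sub>R x) = r *\<^sub>R adj x" for r and x :: 'a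
    by (metis adj_scaleC complex_cnj_complex_of_real scaleC_of_real)
qed (simp_all add: adj_add)

lemmas linear_adj = bounded_linear.linear[OF bounded_linear_adj]

declare adj_adj [simp]

lemma adj_zero [simp]: "adj 0 = (0::'a::cstar_algebra)"
  by (rule linear_0[OF linear_adj])

lemmas adj_simps = adj_add linear_diff[OF linear_adj] linear_neg[OF linear_adj] adj_zero
  linear_cmul[OF linear_adj] adj_mult adj_adj

lemma adj_sum: "adj (sum f I) = (\<Sum>i\<in>I. adj (f i :: 'a::cstar_algebra))"
  by (rule linear_sum[OF linear_adj])

lemmas continuous_on_adj [continuous_intros] = bounded_linear.continuous_on[OF bounded_linear_adj]
lemmas tendsto_adj [tendsto_intros] = bounded_linear.tendsto[OF bounded_linear_adj]

text \<open>\<open>1 - r\<close> is a square root of \<open>1 - h\<close>, written without a unit so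
  that automorphisms of a non-unital algebra can be applied to it. It is the fixed point of r -> (h
  + r^2) / 2; self-adjointness and commutation with the commutant of \<open>h\<close> are closed
  conditions preserved by this map, so the fixed point inherits them.\<close>

lemma selfadjoint_sqrt_aux:
  fixes h :: "'a::cstar_algebra"
  assumes h: "adj h = h" and norm: "norm h < 1"
  shows "\<exists>r. adj r = r \<and> r + r - r * r = h \<and> (\<forall>z. z * h = h * z \<longrightarrow> z * r = r * z)"
proof -
  \<comment> \<open>The smaller root of norm h + \<rho>^2 = 2 \<rho>: the ball of this radius is
    invariant under \<open>f\<close>, and \<rho> < 1 is also the contraction constant.\<close>
  define \<rho> where "\<rho> = 1 - sqrt (1 - norm h)"
  have \<rho>: "0 \<le> \<rho>" "\<rho> < 1" "norm h + \<rho> * \<rho> = 2 * \<rho>"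
    using norm real_sqrt_mult_self[of "1 - norm h"] unfolding \<rho>_def by (auto simp: algebra_simps)
  define S where "S = {r. adj r = r \<and> norm r \<le> \<rho> \<and> (\<forall>z. z * h = h * z \<longrightarrow> z * r = r * z)}"
  define f where "f r = (1/2) *\<^sub>R (h + r * r)" for r
  have S: "S = {r. adj r = r} \<inter> cball 0 \<rho> \<inter> (\<Inter>z\<in>{z. z * h = h * z}. {r. z * r = r * z})"
    by (auto simp: S_def)
  have "closed {r. adj r = (r::'a)}"
    by (rule closed_Collect_eq) (rule continuous_on_adj continuous_on_id)+
  moreover have "closed {r. z * r = r * z}" for z :: 'a
    by (rule closed_Collect_eq) (rule continuous_on_mult continuous_on_const continuous_on_id)+
  ultimately have "closed S"
    unfolding S by (intro closed_Int closed_INT ballI closed_cball)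
  then have "complete S" by (simp add: complete_eq_closed)
  moreover have "S \<noteq> {}" using \<rho>(1) by (auto simp: S_def adj_zero intro!: exI[of _ 0])
  moreover have "f ` S \<subseteq> S"
  proof clarify
    fix r assume "r \<in> S"
    then have r: "adj r = r" "norm r \<le> \<rho>" and comm: "\<And>z. z * h = h * z \<Longrightarrow> z * r = r * z"
      unfolding S_def by blast+
    have "norm (r * r) \<le> \<rho> * \<rho>"
      using r(2) \<rho>(1) by (intro order.trans[OF norm_mult_ineq] mult_mono) auto
    then have "norm (h + r * r) \<le> 2 * \<rho>"
      using \<rho>(3) norm_triangle_ineq[of h "r * r"] by linarith
    moreover have "z * f r = f r * z" if "z * h = h * z" for z
    proof -
      have "z * (r * r) = (r * r) * z" using comm[OF that] by (metis mult.assoc)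
      then show ?thesis using that by (simp add: f_def distrib_left distrib_right)
    qed
    ultimately show "f r \<in> S" using r(1) h unfolding S_def
      by (auto simp: f_def adj_simps)
  qed
  moreover have "dist (f r) (f r') \<le> \<rho> * dist r r'" if "r \<in> S" "r' \<in> S" for r r'
  proof -
    have bounds: "norm r \<le> \<rho>" "norm r' \<le> \<rho>" using that unfolding S_def by blast+
    have "f r - f r' = (1/2) *\<^sub>R (r * (r - r') + (r - r') * r')"
      by (simp add: f_def algebra_simps)
    moreover have "norm (r * (r - r') + (r - r') * r') \<le> \<rho> * norm (r - r') + norm (r - r') * \<rho>"
      by (intro norm_triangle_le add_mono order.trans[OF norm_mult_ineq] mult_mono)
        (auto simp: \<rho>(1) bounds)
    ultimately show ?thesis by (simp add: dist_norm)
  qed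
  ultimately obtain r where "r \<in> S" "f r = r"
    using Banach_fix[of S \<rho> f] \<rho> by blast
  then have "2 *\<^sub>R f r = 2 *\<^sub>R r" by simp
  then have "h + r * r = r + r" by (simp add: f_def scaleR_2)
  then have "r + r - r * r = h" by (simp add: algebra_simps)
  with \<open>r \<in> S\<close> show ?thesis unfolding S_def by blast
qed

section \<open>Positive elements of unital C*-algebras\<close>

lemma adj_one: "adj 1 = (1::'a::{cstar_algebra, monoid_mult})"
  by (metis adj_adj adj_mult mult_1_left mult_1_right)

lemma norm_one_le: "norm (1::'a::{cstar_algebra, monoid_mult}) \<le> 1"
  using cstar_identity[of "1::'a"] by (auto simp: adj_one power2_eq_square)

lemma norm_power_le: "norm (x ^ n) \<le> norm (x::'a::{cstar_algebra, monoid_mult}) ^ n"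
proof (induction n)
  case (Suc n)
  show ?case using order.trans[OF norm_mult_ineq mult_left_mono[OF Suc, of "norm x"]] by simp
qed (simp add: norm_one_le)

lemma norm_scaled_one_le: "norm (c *\<^sub>R (1::'a::{cstar_algebra, monoid_mult})) \<le> \<bar>c\<bar>"
  using mult_left_mono[OF norm_one_le, of "\<bar>c\<bar>"] by simp

lemma norm_selfadjoint_square:
  fixes x :: "'a::cstar_algebra"
  assumes "adj x = x" shows "norm (x * x) = (norm x)\<^sup>2"
  using cstar_identity[of x] assms by simp

lemma adj_power: "adj (x ^ n) = (adj x :: 'a::{cstar_algebra, monoid_mult}) ^ n"
  by (induction n) (simp_all add: adj_one adj_mult power_commutes)

lemma norm_selfadjoint_power:
  fixes x :: "'a::{cstar_algebra, monoid_mult}"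
  assumes "adj x = x" shows "norm (x ^ (2 ^ j)) = norm x ^ (2 ^ j)"
proof (induction j)
  case (Suc j)
  have "norm (x ^ (2 ^ Suc j)) = norm (x ^ (2 ^ j) * x ^ (2 ^ j))"
    by (simp add: mult_2 power_add)
  also have "\<dots> = norm x ^ (2 ^ Suc j)"
    using norm_selfadjoint_square[of "x ^ (2 ^ j)"] assms
    by (simp add: Suc adj_power flip: power_mult) (simp add: mult.commute)
  finally show ?case .
qed simp

lemma selfadjoint_sqrt:
  fixes h :: "'a::{cstar_algebra, monoid_mult}"
  assumes "adj h = h" "norm h < 1"
  obtains s where "adj s = s" "s * s = 1 - h" "\<And>z. z * h = h * z \<Longrightarrow> z * s = s * z"
proof -
  obtain r where r: "adj r = r" "r + r - r * r = h" "\<forall>z. z * h = h * z \<longrightarrow> z * r = r * z"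
    using selfadjoint_sqrt_aux[OF assms] by blast
  show ?thesis
  proof (rule that)
    show "adj (1 - r) = 1 - r" by (simp add: adj_simps adj_one r)
    show "(1 - r) * (1 - r) = 1 - h" using r(2) by (auto simp: algebra_simps)
    show "z * h = h * z \<Longrightarrow> z * (1 - r) = (1 - r) * z" for z using r(3) by (simp add: algebra_simps)
  qed
qed

text \<open>For self-adjoint \<open>h\<close> the norm condition says that the spectrum lies in
  [0, 2 C]. In this form stability under sums is just the triangle inequality.\<close>

definition pos :: "'a::{cstar_algebra, monoid_mult} \<Rightarrow> bool" where
  "pos h \<longleftrightarrow> adj h = h \<and> (\<exists>C>0. norm (C *\<^sub>R 1 - h) \<le> C)"

lemma pos_selfadjoint: "pos h \<Longrightarrow> adj h = h"
  by (simp add: pos_def)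

lemma norm_scaled_one_minus_mono:
  fixes h :: "'a::{cstar_algebra, monoid_mult}"
  assumes "norm (C *\<^sub>R 1 - h) \<le> C" "C \<le> D" shows "norm (D *\<^sub>R 1 - h) \<le> D"
proof -
  have "D *\<^sub>R 1 - h = (D - C) *\<^sub>R 1 + (C *\<^sub>R 1 - h)" by (simp add: algebra_simps)
  also have "norm \<dots> \<le> (D - C) + C"
    using assms by (intro norm_triangle_le add_mono order.trans[OF norm_scaled_one_le]) auto
  finally show ?thesis by simp
qed

lemma pos_add: assumes "pos g" "pos h" shows "pos (g + h)"
proof -
  obtain C D where "C > 0" "norm (C *\<^sub>R 1 - g) \<le> C" "D > 0" "norm (D *\<^sub>R 1 - h) \<le> D"
    using assms by (auto simp: pos_def)
  then have "norm ((C *\<^sub>R 1 - g) + (D *\<^sub>R 1 - h)) \<le> C + D" "C + D > 0"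
    by (auto intro: norm_triangle_le add_mono)
  then show ?thesis using assms
    by (auto simp: pos_def adj_simps algebra_simps intro!: exI[of _ "C + D"])
qed

lemma pos_scaled_one_minus:
  assumes "adj h = h" "norm h \<le> c" shows "pos (c *\<^sub>R 1 - h)"
proof -
  have "norm ((c + 1) *\<^sub>R 1 - (c *\<^sub>R 1 - h)) \<le> 1 + c"
    using assms norm_one_le by (auto simp: algebra_simps intro!: norm_triangle_le add_mono)
  moreover have "c + 1 > 0" using assms(2) norm_ge_zero[of h] by linarith
  ultimately show ?thesis using assms
    by (auto simp: pos_def adj_simps adj_one add.commute intro!: exI[of _ "c + 1"])
qed

lemma pos_zero [simp]: "pos 0"
  by (auto simp: pos_def adj_zero intro!: exI[of _ 1] norm_one_le)

lemma pos_scaleR: assumes "pos h" "c \<ge> 0" shows "pos (c *\<^sub>R h)"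
proof (cases "c = 0")
  case False
  obtain C where C: "C > 0" "norm (C *\<^sub>R 1 - h) \<le> C" using assms by (auto simp: pos_def)
  have "norm ((c * C) *\<^sub>R 1 - c *\<^sub>R h) = c * norm (C *\<^sub>R 1 - h)"
    using assms(2) by (metis abs_of_nonneg norm_scaleR scaleR_diff_right scaleR_scaleR)
  then have "norm ((c * C) *\<^sub>R 1 - c *\<^sub>R h) \<le> c * C" "c * C > 0"
    using C False assms(2) by simp_all
  then show ?thesis using assms by (auto simp: pos_def adj_simps)
qed simp

lemma pos_sum: "(\<And>i. i \<in> I \<Longrightarrow> pos (f i)) \<Longrightarrow> pos (sum f I)"
  by (induction I rule: infinite_finite_induct) (auto intro: pos_add)

text \<open>The element u = r + i s satisfies \<open>adj u * u = c *\<^sub>R 1\<close> because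
  \<open>r\<close> and \<open>s\<close> commute; the C*-identity bounds u, and \<open>r\<close> is
  its real part.\<close>

lemma norm_le_of_sum_squares_one:
  fixes r s :: "'a::{cstar_algebra, monoid_mult}"
  assumes "adj r = r" "adj s = s" "r * s = s * r" "r * r + s * s = c *\<^sub>R 1" "c \<ge> 0"
  shows "norm (r * r) \<le> c"
proof -
  define u where "u = r + \<i> *\<^sub>C s"
  have adj_u: "adj u = r - \<i> *\<^sub>C s"
    by (simp add: u_def adj_simps adj_scaleC assms scaleC.minus_left)
  have "adj u * u = c *\<^sub>R 1"
    unfolding adj_u unfolding u_def using assms(3,4)
    by (simp add: algebra_simps mult_scaleC_left mult_scaleC_right scaleC_scaleC scaleC.minus_left scaleC.diff_right)
  then have u2: "(norm u)\<^sup>2 \<le> \<bar>c\<bar>" using cstar_identity[of u] norm_scaled_one_le[of c] by metis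
  have "2 *\<^sub>R r = u + adj u" unfolding adj_u unfolding u_def by (simp add: scaleR_2)
  then have "norm (2 *\<^sub>R r) \<le> norm u + norm (adj u)" by (metis norm_triangle_ineq)
  then have "norm r \<le> norm u" by simp
  then have "(norm r)\<^sup>2 \<le> c" using u2 power_mono[of "norm r" "norm u" 2] \<open>c \<ge> 0\<close>
    by (smt (verit) norm_ge_zero)
  then show ?thesis using norm_selfadjoint_square[OF assms(1)] by simp
qed

text \<open>With D = C + \<epsilon>, the element g + \<epsilon> is D (1 - h) for h = (C - g) / D.
  The shift by \<epsilon> makes norm h at most C / D < 1, so that the square root near the unit
  applies.\<close>

lemma pos_sqrt:
  fixes g :: "'a::{cstar_algebra, monoid_mult}"
  assumes "pos g" "\<epsilon> > 0"
  obtains r where "adj r = r" "r * r = g + \<epsilon> *\<^sub>R 1" "\<And>z. z * g = g * z \<Longrightarrow> z * r = r * z"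
proof -
  obtain C where C: "C > 0" "norm (C *\<^sub>R 1 - g) \<le> C" and g: "adj g = g"
    using assms by (auto simp: pos_def)
  define D where "D = C + \<epsilon>"
  have D: "D > 0" "C < D" using C assms by (auto simp: D_def)
  define h where "h = (1/D) *\<^sub>R (C *\<^sub>R 1 - g)"
  have h: "adj h = h" by (simp add: h_def adj_simps adj_one g)
  have "norm h \<le> C / D" using C D by (simp add: h_def divide_right_mono)
  also have "\<dots> < 1" using D C by simp
  finally obtain s where s: "adj s = s" "s * s = 1 - h" "\<And>z. z * h = h * z \<Longrightarrow> z * s = s * z"
    using selfadjoint_sqrt[OF h] by metis
  have "D *\<^sub>R (1 - h) = D *\<^sub>R 1 - (C *\<^sub>R 1 - g)"
    using D by (simp add: h_def scaleR_diff_right)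
  then have Dh: "D *\<^sub>R (1 - h) = g + \<epsilon> *\<^sub>R 1"
    by (simp add: D_def algebra_simps)
  show ?thesis
  proof
    show "adj (sqrt D *\<^sub>R s) = sqrt D *\<^sub>R s" by (simp add: adj_simps s)
    show "(sqrt D *\<^sub>R s) * (sqrt D *\<^sub>R s) = g + \<epsilon> *\<^sub>R 1"
      using D s(2) Dh by simp
    show "z * (sqrt D *\<^sub>R s) = (sqrt D *\<^sub>R s) * z" if "z * g = g * z" for z
      using s(3)[of z] that by (simp add: h_def algebra_simps)
  qed
qed

text \<open>The square roots of g + \<epsilon> and 1 - g + \<epsilon> commute, and their squares add
  up to a multiple of the unit.\<close>

lemma pos_norm_le_one:
  fixes g :: "'a::{cstar_algebra, monoid_mult}"
  assumes "pos g" "pos (1 - g)" shows "norm g \<le> 1"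
proof (rule field_le_epsilon)
  fix e :: real assume "e > 0"
  define \<epsilon> where "\<epsilon> = e / 3"
  have \<epsilon>: "\<epsilon> > 0" using \<open>e > 0\<close> by (simp add: \<epsilon>_def)
  obtain r where r: "adj r = r" "r * r = g + \<epsilon> *\<^sub>R 1" "\<And>z. z * g = g * z \<Longrightarrow> z * r = r * z"
    using pos_sqrt[OF assms(1) \<epsilon>] by metis
  obtain s where s: "adj s = s" "s * s = (1 - g) + \<epsilon> *\<^sub>R 1"
    "\<And>z. z * (1 - g) = (1 - g) * z \<Longrightarrow> z * s = s * z"
    using pos_sqrt[OF assms(2) \<epsilon>] by metis
  have "r * g = g * r" using r(3)[of g] by simp
  then have "r * s = s * r" by (intro s(3)) (simp add: algebra_simps)
  moreover have "r * r + s * s = (1 + 2 * \<epsilon>) *\<^sub>R 1"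
    by (simp add: r(2) s(2) algebra_simps flip: scaleR_2)
  ultimately have "norm (r * r) \<le> 1 + 2 * \<epsilon>"
    using norm_le_of_sum_squares_one[of r s] r(1) s(1) \<epsilon> by auto
  moreover have "norm g \<le> norm (r * r) + norm (\<epsilon> *\<^sub>R (1::'a))"
    by (metis r(2) add_diff_cancel_right' norm_triangle_ineq4)
  moreover have "norm (\<epsilon> *\<^sub>R (1::'a)) \<le> \<epsilon>"
    using norm_scaled_one_le[of \<epsilon>, where 'a = 'a] \<epsilon> by linarith
  ultimately show "norm g \<le> 1 + e"
    unfolding \<epsilon>_def by linarith
qed

lemma pos_norm_le:
  fixes g :: "'a::{cstar_algebra, monoid_mult}"
  assumes "pos g" "pos (t *\<^sub>R 1 - g)" "t > 0" shows "norm g \<le> t"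
proof -
  have "pos ((1/t) *\<^sub>R g)" "pos ((1/t) *\<^sub>R (t *\<^sub>R 1 - g))"
    using assms by (auto intro: pos_scaleR)
  then have "norm ((1/t) *\<^sub>R g) \<le> 1"
    using assms(3) by (intro pos_norm_le_one) (simp_all add: scaleR_diff_right)
  then show ?thesis using assms(3) by (simp add: field_simps)
qed

text \<open>The existential constant can be taken to be the norm of \<open>h\<close>, which turns
  positivity into a closed condition.\<close>

lemma pos_iff_norm:
  fixes h :: "'a::{cstar_algebra, monoid_mult}"
  shows "pos h \<longleftrightarrow> adj h = h \<and> norm (norm h *\<^sub>R 1 - h) \<le> norm h"
proof (cases "h = 0")
  case False
  have "norm (norm h *\<^sub>R 1 - h) \<le> norm h" if "pos h"
  proof -
    have "pos (norm h *\<^sub>R 1 - h)" using that by (intro pos_scaled_one_minus) (auto simp: pos_def)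
    then show ?thesis using that False by (intro pos_norm_le) auto
  qed
  moreover have "pos h" if "adj h = h" "norm (norm h *\<^sub>R 1 - h) \<le> norm h"
    using that False unfolding pos_def by (metis zero_less_norm_iff)
  ultimately show ?thesis using pos_selfadjoint by blast
qed auto

lemma closed_pos: "closed {h :: 'a::{cstar_algebra, monoid_mult}. pos h}"
proof -
  have "closed {h :: 'a. adj h = h}"
    by (intro closed_Collect_eq continuous_intros)
  moreover have "closed {h :: 'a. norm (norm h *\<^sub>R 1 - h) \<le> norm h}"
    by (intro closed_Collect_le continuous_intros)
  ultimately show ?thesis by (simp add: pos_iff_norm Collect_conj_eq closed_Int)
qed

text \<open>The odd denominators are those that the proof of \<open>pos_adj_mult\<close>
  produces.\<close>

lemma pos_of_pos_add_inverse:
  fixes h :: "'a::{cstar_algebra, monoid_mult}"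
  assumes "\<And>n::nat. pos (h + (1 / real (2 * n + 1)) *\<^sub>R g)"
  shows "pos h"
proof -
  have "(\<lambda>n. h + (1 / real (2 * n + 1)) *\<^sub>R g) \<longlonglongrightarrow> h + 0 *\<^sub>R g"
    by (intro tendsto_intros) real_asymp
  then show ?thesis using closed_sequentially[OF closed_pos] assms by fastforce
qed

text \<open>Let h = g^2 / C have norm below 1 and let s be a square root of 1 - h. It commutes with
  g, and s^2 + g^2 / C = 1 gives norm (s^2) \<le> 1, which is the defining inequality for g^2 with
  constant C.\<close>

lemma pos_square:
  fixes g :: "'a::{cstar_algebra, monoid_mult}"
  assumes "adj g = g" shows "pos (g * g)"
proof -
  define C where "C = (norm g)\<^sup>2 + 1"
  have C: "C > 0" unfolding C_def by (simp add: add_nonneg_pos)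
  define h where "h = (1/C) *\<^sub>R (g * g)"
  have "norm (g * g) < C" using norm_selfadjoint_square[OF assms] by (simp add: C_def)
  then have "norm h < 1" using C by (simp add: h_def)
  moreover have "adj h = h" by (simp add: h_def adj_simps assms)
  ultimately obtain s where s: "adj s = s" "s * s = 1 - h" "\<And>z. z * h = h * z \<Longrightarrow> z * s = s * z"
    using selfadjoint_sqrt by metis
  have "g * s = s * g" by (rule s(3)) (simp add: h_def mult.assoc)
  then have comm: "s * ((1 / sqrt C) *\<^sub>R g) = (1 / sqrt C) *\<^sub>R g * s" by simp
  have sum: "s * s + (1 / sqrt C) *\<^sub>R g * ((1 / sqrt C) *\<^sub>R g) = 1 *\<^sub>R 1"
    using C by (simp add: s(2) h_def)
  have "norm (s * s) \<le> 1"
    by (rule norm_le_of_sum_squares_one[OF s(1) _ comm sum]) (simp_all add: adj_simps assms)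
  then have "norm (C *\<^sub>R (1 - h)) \<le> C" using s(2) C by simp
  also have "C *\<^sub>R (1 - h) = C *\<^sub>R 1 - g * g" using C by (simp add: h_def scaleR_diff_right)
  finally show ?thesis using C by (auto simp: pos_def adj_simps assms)
qed

section \<open>Positivity of \<open>adj a * a\<close> and its consequences\<close>

text \<open>Plays the role of the equality of the nonzero spectra of y z and z y. The powers of G =
  1 + \<tau> y z are governed by those of H = 1 + \<tau> z y up to a factor linear in n, whereas the
  norm of the self-adjoint G is multiplicative along powers with exponent 2^j. A larger norm of G
  would therefore grow too fast.\<close>

lemma norm_one_plus_swap_le:
  fixes y z :: "'a::{cstar_algebra, monoid_mult}"
  assumes "adj y = z"
  shows "norm (1 + \<tau> *\<^sub>R (y * z)) \<le> max 1 (norm (1 + \<tau> *\<^sub>R (z * y)))" (is "_ \<le> ?\<rho>")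
proof (rule ccontr)
  define G where "G = 1 + \<tau> *\<^sub>R (y * z)"
  define H where "H = 1 + \<tau> *\<^sub>R (z * y)"
  define K where "K = \<bar>\<tau>\<bar> * norm y * norm z"
  have \<rho>: "?\<rho> \<ge> 1" by simp
  have Gy: "G ^ n * y = y * H ^ n" for n
  proof (induction n)
    case (Suc n)
    have "G * y = y * H" by (simp add: G_def H_def algebra_simps)
    then show ?case using Suc by (metis mult.assoc power_Suc)
  qed simp
  have pow: "G ^ n = 1 + \<tau> *\<^sub>R (y * (\<Sum>i<n. H ^ i) * z)" for n
  proof (induction n)
    case (Suc n)
    have "G ^ Suc n = G ^ n * G" by (rule power_Suc2)
    also have "\<dots> = G ^ n + \<tau> *\<^sub>R ((G ^ n * y) * z)"
      by (simp add: G_def algebra_simps)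
    also have "\<dots> = 1 + \<tau> *\<^sub>R (y * (\<Sum>i<Suc n. H ^ i) * z)"
      unfolding Gy by (simp add: Suc algebra_simps)
    finally show ?case .
  qed simp
  have bound: "norm (G ^ n) \<le> (1 + real n * K) * ?\<rho> ^ n" for n
  proof -
    have "norm (H ^ i) \<le> ?\<rho> ^ n" if "i < n" for i
    proof -
      have "norm (H ^ i) \<le> ?\<rho> ^ i"
        by (rule order.trans[OF norm_power_le power_mono]) (auto simp: H_def)
      also have "\<dots> \<le> ?\<rho> ^ n" using that by (intro power_increasing) auto
      finally show ?thesis .
    qed
    then have "norm (\<Sum>i<n. H ^ i) \<le> real n * ?\<rho> ^ n"
      using sum_norm_bound[of "{..<n}" "\<lambda>i. H ^ i" "?\<rho> ^ n"] by simp
    then have "norm (y * (\<Sum>i<n. H ^ i) * z) \<le> norm y * (real n * ?\<rho> ^ n) * norm z"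
      by (intro order.trans[OF norm_mult_ineq] mult_right_mono norm_ge_zero
          order.trans[OF norm_mult_ineq] mult_left_mono)
    then have "\<bar>\<tau>\<bar> * norm (y * (\<Sum>i<n. H ^ i) * z) \<le> \<bar>\<tau>\<bar> * (norm y * (real n * ?\<rho> ^ n) * norm z)"
      by (intro mult_left_mono) auto
    moreover have "norm (G ^ n) \<le> 1 + \<bar>\<tau>\<bar> * norm (y * (\<Sum>i<n. H ^ i) * z)"
      unfolding pow by (rule order.trans[OF norm_triangle_ineq]) (simp add: norm_one_le)
    moreover have "1 \<le> ?\<rho> ^ n" using \<rho> by (rule one_le_power)
    ultimately have "norm (G ^ n) \<le> ?\<rho> ^ n + \<bar>\<tau>\<bar> * (norm y * (real n * ?\<rho> ^ n) * norm z)"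
      by linarith
    also have "\<dots> = (1 + real n * K) * ?\<rho> ^ n" unfolding K_def by (simp only: algebra_simps mult_1_left)
    finally show ?thesis .
  qed
  have G: "adj G = G" using assms by (auto simp: G_def adj_simps adj_one)
  assume "\<not> ?thesis"
  then have gt: "norm G > ?\<rho>" unfolding G_def by linarith
  \<comment> \<open>Because of the square root, Bernoulli's linear lower bound for w^n becomes a
    quadratic one for the n-th power of the quotient, which beats the linear upper bound.\<close>
  define w where "w = sqrt (norm G / ?\<rho>)"
  have w: "w > 1" using gt \<rho> by (simp add: w_def)
  have w2: "w * w = norm G / ?\<rho>" using \<rho> by (simp add: w_def)
  have K: "K \<ge> 0" by (simp add: K_def)
  have "real (2 ^ j) * (w - 1)\<^sup>2 \<le> 1 + K" for j :: nat
  proof -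
    let ?n = "2 ^ j :: nat"
    have "norm G ^ ?n \<le> (1 + real ?n * K) * ?\<rho> ^ ?n"
      using bound[of ?n] norm_selfadjoint_power[OF G, of j] by simp
    then have "(norm G / ?\<rho>) ^ ?n \<le> 1 + real ?n * K"
      using \<rho> by (simp add: power_divide pos_divide_le_eq)
    moreover have "(norm G / ?\<rho>) ^ ?n = (w ^ ?n)\<^sup>2"
      unfolding w2[symmetric] by (simp add: power2_eq_square power_mult_distrib)
    moreover have "1 + real ?n * (w - 1) \<le> w ^ ?n"
      using Bernoulli_inequality[of "w - 1" ?n] w by simp
    then have "(real ?n * (w - 1))\<^sup>2 \<le> (w ^ ?n)\<^sup>2" using w by (intro power_mono) auto
    ultimately have "(real ?n * (w - 1))\<^sup>2 \<le> 1 + real ?n * K" by linarith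
    also have "\<dots> \<le> real ?n * (1 + K)" by (simp add: algebra_simps)
    finally have "real ?n * (real ?n * (w - 1)\<^sup>2) \<le> real ?n * (1 + K)"
      by (simp add: power2_eq_square algebra_simps)
    then show ?thesis by (subst (asm) mult_le_cancel_left_pos) auto
  qed
  moreover obtain j :: nat where "(1 + K) / (w - 1)\<^sup>2 < 2 ^ j"
    using real_arch_pow[of 2 "(1 + K) / (w - 1)\<^sup>2"] by auto
  then have "1 + K < real (2 ^ j) * (w - 1)\<^sup>2" using w by (simp add: divide_simps mult.commute)
  ultimately show False by (meson not_le)
qed

text \<open>Dividing by C rewrites the claim as a bound (d + C) / C for the norm of
  \<open>1 + (1 / C) *\<^sub>R (y * adj y)\<close>. This bound is at least 1, so the maximum in the
  swapping lemma does no harm.\<close>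

lemma pos_one_minus_swap:
  fixes y :: "'a::{cstar_algebra, monoid_mult}"
  assumes "pos (d *\<^sub>R 1 - adj y * y)" "d \<ge> 0" shows "pos (d *\<^sub>R 1 - y * adj y)"
proof -
  obtain C where "C > 0" and C': "norm (C *\<^sub>R 1 - (d *\<^sub>R 1 - adj y * y)) \<le> C"
    using assms(1) unfolding pos_def by blast
  have C: "norm ((d + C) *\<^sub>R 1 - (d *\<^sub>R 1 - adj y * y)) \<le> d + C"
    by (rule norm_scaled_one_minus_mono[OF C']) (simp add: assms(2))
  have eq: "(1 / C) *\<^sub>R ((d + C) *\<^sub>R 1 - (d *\<^sub>R 1 - g)) = 1 + (1 / C) *\<^sub>R g" for g :: 'a
    using \<open>C > 0\<close> by (simp add: algebra_simps)
  have "norm (1 + (1 / C) *\<^sub>R (adj y * y)) \<le> (d + C) / C"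
    using C \<open>C > 0\<close> by (simp add: divide_right_mono flip: eq)
  moreover have "1 \<le> (d + C) / C" using assms(2) \<open>C > 0\<close> by simp
  ultimately have "norm (1 + (1 / C) *\<^sub>R (y * adj y)) \<le> (d + C) / C"
    using norm_one_plus_swap_le[of y "adj y" "1 / C"] by simp
  then have "norm ((d + C) *\<^sub>R 1 - (d *\<^sub>R 1 - y * adj y)) \<le> d + C"
    using \<open>C > 0\<close> unfolding eq[symmetric] by (simp add: divide_le_cancel)
  then show ?thesis
    using assms(2) \<open>C > 0\<close> by (auto simp: pos_def adj_simps adj_one intro!: exI[of _ "d + C"])
qed

lemma pos_swap_sum:
  fixes y :: "'a::{cstar_algebra, monoid_mult}"
  shows "pos (adj y * y + y * adj y)"
proof -
  define b where "b = y + adj y"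
  define c where "c = \<i> *\<^sub>C (y - adj y)"
  have "adj b = b" by (simp add: b_def adj_simps add.commute)
  moreover have "adj c = c"
    by (simp add: c_def adj_simps adj_scaleC scaleC.minus_left scaleC.diff_right)
  ultimately have "pos ((1/2) *\<^sub>R (b * b + c * c))"
    by (intro pos_scaleR pos_add pos_square) auto
  also have "b * b + c * c = 2 *\<^sub>R (adj y * y + y * adj y)"
    by (simp add: b_def c_def mult_scaleC_left mult_scaleC_right scaleC_scaleC scaleC.minus_left scaleC.diff_right
        algebra_simps scaleR_2)
  finally show ?thesis by simp
qed

text \<open>Put h = \<open>adj a * a\<close> and e = 1 - h; multiplication by powers of e damps the
  positive part of h and enlarges the negative part. For y = a e^N, the element
  \<open>adj y * y\<close> = e^(2N) h is at most 1 / (2N + 1), hence so is \<open>y * adj y\<close>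
  by swapping. Since the sum of the two is positive, \<open>adj y * y\<close> is at least -1 / (2N +
  1). Finally h dominates e^(2N) h, so h + 1 / (2N + 1) is positive for all N.\<close>

lemma pos_adj_mult:
  fixes a :: "'a::{cstar_algebra, monoid_mult}"
  shows "pos (adj a * a)"
proof -
  have *: "pos (adj a * a)" if "norm a < 1" for a :: 'a
  proof (rule pos_of_pos_add_inverse)
    fix N :: nat
    let ?n = "2 * N + 1"
    define h where "h = adj a * a"
    have h: "adj h = h" by (simp add: h_def adj_simps)
    have "norm h < 1" using that by (simp add: h_def cstar_identity power_less_one_iff)
    then obtain s where s: "adj s = s" "s * s = 1 - h" and comm: "\<And>z. z * h = h * z \<Longrightarrow> z * s = s * z"
      using selfadjoint_sqrt[OF h] by metis
    define e where "e = 1 - h"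
    have hs: "h * s = s * h" using comm[of h] by simp
    have he: "h * e = e * h" by (simp add: e_def algebra_simps)
    have hep: "h * e ^ m = e ^ m * h" for m 
      by (rule power_commuting_commutes[OF he[symmetric], symmetric])
    have ep: "e ^ m = s ^ m * s ^ m" for m
      by (simp add: e_def flip: s(2) power2_eq_square power_add power_mult mult_2)
        (simp add: mult.commute)
    have adj_e: "adj (e ^ m) = e ^ m" for m by (simp add: adj_power e_def adj_simps adj_one h)
    have pos_e: "pos (e ^ m)" for m
      unfolding ep by (rule pos_square) (simp add: adj_power s)
    have pos_ehh: "pos (e ^ m * h * h)" for m
    proof -
      have sh: "s ^ m * h = h * s ^ m"
        by (rule power_commuting_commutes[OF hs[symmetric]])
      have "pos ((s ^ m * h) * (s ^ m * h))"
        by (rule pos_square) (simp add: adj_power adj_simps s h sh)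
      also have "(s ^ m * h) * (s ^ m * h) = e ^ m * h * h"
        unfolding ep by (metis sh mult.assoc)
      finally show ?thesis .
    qed
    \<comment> \<open>Bernoulli's inequality: 1 - e^(n+1) is the sum of e^i h over i \<le> n, and
      these terms decrease in i because consecutive ones differ by e^i h^2.\<close>
    have le: "pos (1 - e ^ Suc n - real (Suc n) *\<^sub>R (e ^ n * h))" for n
    proof (induction n)
      case 0 show ?case by (simp add: e_def)
    next
      case (Suc n)
      have eh: "e ^ Suc m = e ^ m - e ^ m * h" for m
        unfolding power_Suc2 by (simp add: e_def right_diff_distrib)
      have "1 - e ^ Suc (Suc n) - real (Suc (Suc n)) *\<^sub>R (e ^ Suc n * h)
          = (1 - e ^ Suc n - real (Suc n) *\<^sub>R (e ^ n * h)) + real (Suc n) *\<^sub>R (e ^ n * h * h)"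
        unfolding eh[of "Suc n"] unfolding eh[of n]
        by (simp add: algebra_simps scaleR_2)
      then show ?case using Suc pos_ehh[of n] by (simp only:) (intro pos_add pos_scaleR, auto)
    qed
    define y where "y = a * e ^ N"
    have yy: "adj y * y = e ^ (2 * N) * h"
    proof -
      have "adj y * y = e ^ N * (h * e ^ N)" by (simp add: y_def adj_simps adj_e h_def mult.assoc)
      then show ?thesis by (simp add: hep mult_2 power_add mult.assoc)
    qed
    have "pos ((1 / real ?n) *\<^sub>R ((1 - e ^ ?n - real ?n *\<^sub>R (e ^ (2*N) * h)) + e ^ ?n))"
      using le[of "2 * N"] pos_e[of ?n] by (intro pos_scaleR pos_add) simp_all
    then have "pos ((1 / real ?n) *\<^sub>R 1 - adj y * y)"
      by (simp add: yy scaleR_diff_right del: of_nat_add of_nat_mult)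
    then have 1: "pos ((1 / real ?n) *\<^sub>R 1 - y * adj y)"
      by (rule pos_one_minus_swap) simp
    have 2: "pos (h - e ^ m * h)" for m
    proof (induction m)
      case (Suc m)
      have "h - e ^ Suc m * h = (h - e ^ m * h) + e ^ m * h * h"
        unfolding power_Suc2 by (simp add: e_def algebra_simps)
      then show ?case using Suc pos_ehh[of m] by (simp only:) (rule pos_add)
    qed simp
    have "h + (1 / real ?n) *\<^sub>R 1 = (h - e ^ (2 * N) * h) + (adj y * y + y * adj y) + ((1 / real ?n) *\<^sub>R 1 - y * adj y)"
      by (simp add: yy)
    then show "pos (adj a * a + (1 / real ?n) *\<^sub>R 1)"
      using pos_add[OF pos_add[OF 2[of "2 * N"] pos_swap_sum[of y]] 1] by (simp add: h_def)
  qed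
  define c where "c = norm a + 1"
  have c: "c > 0" "norm a < c" by (auto simp: c_def add_nonneg_pos)
  have "pos (c\<^sup>2 *\<^sub>R (adj ((1/c) *\<^sub>R a) * ((1/c) *\<^sub>R a)))"
    using c by (intro pos_scaleR *) auto
  then show ?thesis using c by (simp add: adj_simps power2_eq_square)
qed

lemma pos_conjugate:
  fixes h :: "'a::{cstar_algebra, monoid_mult}"
  assumes "pos h" shows "pos (adj y * h * y)"
proof (rule pos_of_pos_add_inverse)
  fix n :: nat
  obtain r where r: "adj r = r" "r * r = h + (1 / real (2 * n + 1)) *\<^sub>R 1"
    using pos_sqrt[OF assms, of "1 / real (2 * n + 1)"] by (metis of_nat_0_less_iff zero_less_divide_1_iff add_is_0 gr0I zero_neq_one)
  have "pos (adj (r * y) * (r * y))" by (rule pos_adj_mult)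
  also have "adj (r * y) * (r * y) = adj y * (r * r) * y" by (simp add: adj_simps r(1) mult.assoc)
  also have "\<dots> = adj y * h * y + (1 / real (2 * n + 1)) *\<^sub>R (adj y * y)"
    unfolding r(2) by (simp add: algebra_simps)
  finally show "pos \<dots>" .
qed

lemma pos_minus_adj_mult_iff:
  fixes a :: "'a::{cstar_algebra, monoid_mult}"
  assumes "c > 0" shows "pos (c\<^sup>2 *\<^sub>R 1 - adj a * a) \<longleftrightarrow> norm a \<le> c"
proof
  assume "pos (c\<^sup>2 *\<^sub>R 1 - adj a * a)"
  then have "norm (adj a * a) \<le> c\<^sup>2"
    using assms by (intro pos_norm_le pos_adj_mult) auto
  then show "norm a \<le> c" using assms by (auto simp: cstar_identity power2_le_iff_abs_le)
next
  assume "norm a \<le> c"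
  then have "norm (adj a * a) \<le> c\<^sup>2" by (simp add: cstar_identity power_mono)
  then show "pos (c\<^sup>2 *\<^sub>R 1 - adj a * a)" by (intro pos_scaled_one_minus) (auto simp: adj_simps)
qed

text \<open>Completing the square: with y' = y / A^2, the positive sum of the squares of b_i - a_i
  y', estimated by A^2 and B^2, leaves \<open>adj y * y\<close> at most A^2 B^2.\<close>

lemma Cauchy_Schwarz_pos:
  fixes a b :: "'i \<Rightarrow> 'a::{cstar_algebra, monoid_mult}"
  assumes "pos (A\<^sup>2 *\<^sub>R 1 - (\<Sum>i\<in>I. adj (a i) * a i))" "pos (B\<^sup>2 *\<^sub>R 1 - (\<Sum>i\<in>I. adj (b i) * b i))"
    and "A > 0" "B > 0"
  shows "norm (\<Sum>i\<in>I. adj (a i) * b i) \<le> A * B"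
proof -
  define y where "y = (\<Sum>i\<in>I. adj (a i) * b i)"
  define y' where "y' = (1 / A\<^sup>2) *\<^sub>R y"
  let ?a = "\<Sum>i\<in>I. adj (a i) * a i" and ?b = "\<Sum>i\<in>I. adj (b i) * b i"
  have adj_y: "adj y = (\<Sum>i\<in>I. adj (b i) * a i)" by (simp add: y_def adj_sum adj_simps)
  have "(\<Sum>i\<in>I. adj (b i - a i * y') * (b i - a i * y'))
      = ?b - (\<Sum>i\<in>I. adj (b i) * a i) * y' - adj y' * (\<Sum>i\<in>I. adj (a i) * b i) + adj y' * ?a * y'"
    by (simp add: adj_simps algebra_simps sum.distrib sum_subtractf sum_distrib_left sum_distrib_right)
  also have "\<dots> = ?b - adj y * y' - adj y' * y + adj y' * ?a * y'"
    unfolding adj_y unfolding y_def by (rule refl)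
  finally have sum: "(\<Sum>i\<in>I. adj (b i - a i * y') * (b i - a i * y')) = \<dots>" .
  have "pos ((\<Sum>i\<in>I. adj (b i - a i * y') * (b i - a i * y')) + adj y' * (A\<^sup>2 *\<^sub>R 1 - ?a) * y'
      + (B\<^sup>2 *\<^sub>R 1 - ?b))"
    using assms by (intro pos_add pos_sum pos_adj_mult pos_conjugate)
  also have "(\<Sum>i\<in>I. adj (b i - a i * y') * (b i - a i * y')) + adj y' * (A\<^sup>2 *\<^sub>R 1 - ?a) * y'
      + (B\<^sup>2 *\<^sub>R 1 - ?b) = B\<^sup>2 *\<^sub>R 1 - (1 / A\<^sup>2) *\<^sub>R (adj y * y)"
    unfolding sum using \<open>A > 0\<close> by (simp add: y'_def adj_simps algebra_simps power2_eq_square)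
  finally have "norm ((1 / A\<^sup>2) *\<^sub>R (adj y * y)) \<le> B\<^sup>2"
    using assms(3,4) by (intro pos_norm_le pos_scaleR pos_adj_mult) auto
  then have "(norm y)\<^sup>2 \<le> (A * B)\<^sup>2"
    using assms(3) by (simp add: cstar_identity field_simps)
  then show ?thesis using assms(3,4) unfolding y_def by (simp add: power2_le_iff_abs_le)
qed

section \<open>The multiplier algebra\<close>

lemma adj_mult_eqI:
  fixes u v :: "'a::cstar_algebra"
  assumes "\<And>x. adj x * u = adj x * v" shows "u = v"
proof -
  have "adj (u - v) * (u - v) = 0" using assms by (simp add: right_diff_distrib)
  then have "norm (u - v) = 0" using cstar_identity[of "u - v"] by simp
  then show ?thesis by simp
qed

text \<open>Adjointability for the inner product \<open>adj x * y\<close> on the algebra viewed as a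
  Hilbert module over itself.\<close>

definition adjointable :: "('a::cstar_algebra \<Rightarrow>\<^sub>L 'a) \<Rightarrow> bool" where
  "adjointable T \<longleftrightarrow> (\<exists>S :: 'a \<Rightarrow>\<^sub>L 'a. \<forall>x y. adj (T x) * y = adj x * S y)"

definition adjoint_op :: "('a::cstar_algebra \<Rightarrow>\<^sub>L 'a) \<Rightarrow> ('a \<Rightarrow>\<^sub>L 'a)" where
  "adjoint_op T = (SOME S. \<forall>x y. adj (blinfun_apply T x) * y = adj x * blinfun_apply S y)"

lemma adjointableI:
  "(\<And>x y. adj (blinfun_apply T x) * y = adj x * blinfun_apply S y) \<Longrightarrow> adjointable T"
  unfolding adjointable_def by blast

lemma adjoint_op: "adjointable T \<Longrightarrow> adj (T x) * y = adj x * adjoint_op T y"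
  unfolding adjointable_def adjoint_op_def by (rule someI2_ex) blast+

lemma adjoint_opI:
  assumes "\<And>x y. adj (blinfun_apply T x) * y = adj x * blinfun_apply S y"
  shows "adjoint_op T = S"
proof (rule blinfun_eqI, rule adj_mult_eqI)
  show "adj x * adjoint_op T y = adj x * S y" for x y
    using adjoint_op[OF adjointableI[OF assms], of x y] assms[of x y] by simp
qed

lemma adjoint_op': "adjointable T \<Longrightarrow> adj (adjoint_op T x) * y = adj x * T y"
  using arg_cong[OF adjoint_op[of T y x], of adj] by (simp add: adj_simps)

text \<open>The multiplier algebra plays the role of the unitization: it is unital and contains the
  given algebra as its left multiplications.\<close>

typedef (overloaded) 'a multiplier = "{T :: 'a::cstar_algebra \<Rightarrow>\<^sub>L 'a. adjointable T}"
  by (rule exI[of _ 0]) (auto intro!: adjointableI[of _ 0])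

setup_lifting type_definition_multiplier

lemma adjointable_adjoint_op: "adjointable T \<Longrightarrow> adjointable (adjoint_op T)"
  by (rule adjointableI[of _ T]) (simp add: adjoint_op')

lemma adjoint_op_adjoint_op: "adjointable T \<Longrightarrow> adjoint_op (adjoint_op T) = T"
  by (rule adjoint_opI) (simp add: adjoint_op')

lemma norm_adjointable_square_le:
  assumes "adjointable T" shows "(norm T)\<^sup>2 \<le> norm (adjoint_op T o\<^sub>L T)"
proof -
  have "norm (T x) \<le> sqrt (norm (adjoint_op T o\<^sub>L T)) * norm x" for x
  proof -
    have "(norm (T x))\<^sup>2 = norm (adj x * (adjoint_op T o\<^sub>L T) x)"
      using assms by (simp add: adjoint_op flip: cstar_identity)
    also have "\<dots> \<le> norm x * (norm (adjoint_op T o\<^sub>L T) * norm x)"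
      using norm_blinfun[of "adjoint_op T o\<^sub>L T" x]
      by (intro order.trans[OF norm_mult_ineq] mult_mono) auto
    also have "\<dots> = (sqrt (norm (adjoint_op T o\<^sub>L T)) * norm x)\<^sup>2"
      by (simp add: power_mult_distrib power2_eq_square)
    finally show ?thesis by (simp add: power2_le_iff_abs_le)
  qed
  then have "norm T \<le> sqrt (norm (adjoint_op T o\<^sub>L T))"
    by (intro norm_blinfun_bound) auto
  then have "(norm T)\<^sup>2 \<le> (sqrt (norm (adjoint_op T o\<^sub>L T)))\<^sup>2" by (intro power_mono) auto
  then show ?thesis by simp
qed

lemma norm_adjoint_op: assumes "adjointable T" shows "norm (adjoint_op T) = norm T"
proof -
  have le: "norm T \<le> norm (adjoint_op T)" if "adjointable T" for T :: "'a \<Rightarrow>\<^sub>L 'a"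
  proof (cases "T = 0")
    case False
    have "norm T * norm T \<le> norm (adjoint_op T) * norm T"
      using norm_adjointable_square_le[OF that] norm_blinfun_compose[of "adjoint_op T" T]
      by (simp add: power2_eq_square)
    then show ?thesis using False by simp
  qed auto
  show ?thesis
    using le[OF assms] le[OF adjointable_adjoint_op[OF assms]] adjoint_op_adjoint_op[OF assms] by simp
qed

instantiation multiplier :: (cstar_algebra) real_normed_vector
begin

lift_definition zero_multiplier :: "'a multiplier" is 0
  by (auto intro!: adjointableI[of _ 0])

lift_definition plus_multiplier :: "'a multiplier \<Rightarrow> 'a multiplier \<Rightarrow> 'a multiplier" is "(+)"
  by (rule adjointableI[of _ "adjoint_op _ + adjoint_op _"])
    (simp add: blinfun.bilinear_simps adj_simps algebra_simps adjoint_op)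

lift_definition minus_multiplier :: "'a multiplier \<Rightarrow> 'a multiplier \<Rightarrow> 'a multiplier" is "(-)"
  subgoal for S T
    by (rule adjointableI[of _ "adjoint_op S - adjoint_op T"])
      (simp add: blinfun.bilinear_simps adj_simps algebra_simps adjoint_op)
  done

lift_definition uminus_multiplier :: "'a multiplier \<Rightarrow> 'a multiplier" is uminus
  by (rule adjointableI[of _ "- adjoint_op _"])
    (simp add: blinfun.bilinear_simps adj_simps algebra_simps adjoint_op)

lift_definition scaleR_multiplier :: "real \<Rightarrow> 'a multiplier \<Rightarrow> 'a multiplier" is scaleR
  by (rule adjointableI[of _ "_ *\<^sub>R adjoint_op _"])
    (simp add: blinfun.bilinear_simps adj_simps algebra_simps adjoint_op)

lift_definition norm_multiplier :: "'a multiplier \<Rightarrow> real" is norm .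

definition dist_multiplier :: "'a multiplier \<Rightarrow> 'a multiplier \<Rightarrow> real" where
  "dist_multiplier S T = norm (S - T)"

definition sgn_multiplier :: "'a multiplier \<Rightarrow> 'a multiplier" where
  "sgn_multiplier T = inverse (norm T) *\<^sub>R T"

definition uniformity_multiplier :: "('a multiplier \<times> 'a multiplier) filter" where
  "uniformity_multiplier = (INF e\<in>{0<..}. principal {(S, T). dist S T < e})"

definition open_multiplier :: "'a multiplier set \<Rightarrow> bool" where
  "open_multiplier U = (\<forall>S\<in>U. \<forall>\<^sub>F (S', T) in uniformity. S' = S \<longrightarrow> T \<in> U)"

instance
  by (standard; (simp only: dist_multiplier_def sgn_multiplier_def uniformity_multiplier_def
      open_multiplier_def)?; (transfer; simp add: algebra_simps norm_triangle_ineq)?)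

end

instantiation multiplier :: (cstar_algebra) real_normed_algebra
begin

lift_definition times_multiplier :: "'a multiplier \<Rightarrow> 'a multiplier \<Rightarrow> 'a multiplier" is "(o\<^sub>L)"
  by (rule adjointableI[of _ "adjoint_op _ o\<^sub>L adjoint_op _"]) (simp add: adjoint_op)

instance
  by (standard; transfer) (auto intro!: blinfun_eqI norm_blinfun_compose simp: blinfun.bilinear_simps)

end

instantiation multiplier :: (cstar_algebra) monoid_mult
begin

lift_definition one_multiplier :: "'a multiplier" is id_blinfun
  by (auto intro!: adjointableI[of _ id_blinfun])

instance
  by (standard; transfer) (auto intro!: blinfun_eqI)

end

lemma adjointable_Rep: "adjointable (Rep_multiplier T)"
  using Rep_multiplier[of T] by simp

instantiation multiplier :: (cstar_algebra) cstar_algebra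
begin

lift_definition adj_multiplier :: "'a multiplier \<Rightarrow> 'a multiplier" is adjoint_op
  by (rule adjointable_adjoint_op)

lift_definition scaleC_multiplier :: "complex \<Rightarrow> 'a multiplier \<Rightarrow> 'a multiplier" is
  "\<lambda>c T. Blinfun (scaleC c) o\<^sub>L T"
  by (rule adjointableI[of _ "Blinfun (scaleC (cnj _)) o\<^sub>L adjoint_op _"])
    (simp add: bounded_linear_Blinfun_apply scaleC.bounded_linear_right adj_scaleC mult_scaleC_left
      mult_scaleC_right adjoint_op)

instance
proof
  fix X :: "nat \<Rightarrow> 'a multiplier"
  assume X: "Cauchy X"
  have dist1: "dist (Rep_multiplier S) (Rep_multiplier T) = dist S T" for S T :: "'a multiplier"
    unfolding dist_norm by transfer rule
  have diff: "adjoint_op S - adjoint_op T = adjoint_op (S - T)" "adjointable (S - T)"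
    if "adjointable S" "adjointable T" for S T :: "'a \<Rightarrow>\<^sub>L 'a"
    by (rule sym[OF adjoint_opI], simp add: blinfun.bilinear_simps adj_simps algebra_simps adjoint_op that)
      (rule adjointableI[of _ "adjoint_op S - adjoint_op T"],
        simp add: blinfun.bilinear_simps adj_simps algebra_simps adjoint_op that)
  have dist2: "dist (adjoint_op (Rep_multiplier S)) (adjoint_op (Rep_multiplier T)) = dist S T"
    for S T :: "'a multiplier"
    unfolding dist_norm diff[OF adjointable_Rep adjointable_Rep] norm_adjoint_op[OF diff(2)[OF adjointable_Rep adjointable_Rep]]
    by (metis dist1 dist_norm)
  obtain T where T: "(\<lambda>n. Rep_multiplier (X n)) \<longlonglongrightarrow> T"
    using X dist1 by (metis (no_types, lifting) Cauchy_def Cauchy_convergent_iff convergentD)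
  obtain S where S: "(\<lambda>n. adjoint_op (Rep_multiplier (X n))) \<longlonglongrightarrow> S"
    using X dist2 by (metis (no_types, lifting) Cauchy_def Cauchy_convergent_iff convergentD)
  have "adj (T x) * y = adj x * S y" for x y
  proof (rule LIMSEQ_unique)
    show "(\<lambda>n. adj (Rep_multiplier (X n) x) * y) \<longlonglongrightarrow> adj (T x) * y"
      by (intro tendsto_intros T)
    show "(\<lambda>n. adj (Rep_multiplier (X n) x) * y) \<longlonglongrightarrow> adj x * S y"
      unfolding adjoint_op[OF adjointable_Rep] by (intro tendsto_intros S)
  qed
  then have "Rep_multiplier (Abs_multiplier T) = T" by (intro Abs_multiplier_inverse) (auto intro: adjointableI)
  then have "X \<longlonglongrightarrow> Abs_multiplier T"
    using T by (simp add: tendsto_iff flip: dist1)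
  then show "convergent X" by (auto simp: convergent_def)
next
  note simps = bounded_linear_Blinfun_apply[OF scaleC.bounded_linear_right] adj_scaleC mult_scaleC_left mult_scaleC_right
    scaleC_scaleC blinfun.bilinear_simps scaleC.add_left scaleC.add_right
  fix c d :: complex and r :: real and x y :: "'a multiplier"
  have right: "T (c *\<^sub>C z) = c *\<^sub>C T z" if "adjointable T"
    for T :: "'a \<Rightarrow>\<^sub>L 'a" and z and c
    by (rule adj_mult_eqI) (simp add: mult_scaleC_right that flip: adjoint_op'[OF that])
  show "c *\<^sub>C (x + y) = c *\<^sub>C x + c *\<^sub>C y" "(c + d) *\<^sub>C x = c *\<^sub>C x + d *\<^sub>C x" "c *\<^sub>C d *\<^sub>C x = (c * d) *\<^sub>C x"
    by (transfer, rule blinfun_eqI, simp add: simps)+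
  show "complex_of_real r *\<^sub>C x = r *\<^sub>R x"
    by (transfer, rule blinfun_eqI, simp add: simps scaleC_of_real)
  show "(c *\<^sub>C x) * y = c *\<^sub>C (x * y)"
    by (transfer, rule blinfun_eqI, simp add: simps)
  show "x * (c *\<^sub>C y) = c *\<^sub>C (x * y)"
    by (transfer, rule blinfun_eqI, simp add: simps right)
  show "norm (c *\<^sub>C x) = cmod c * norm x"
  proof (transfer, rule antisym)
    have le: "norm (Blinfun (scaleC c) o\<^sub>L T) \<le> cmod c * norm T" for c and T :: "'a \<Rightarrow>\<^sub>L 'a"
      by (rule norm_blinfun_bound) (auto simp: simps norm_scaleC mult.assoc intro!: mult_left_mono norm_blinfun)
    fix c :: complex and T :: "'a \<Rightarrow>\<^sub>L 'a"
    show "norm (Blinfun (scaleC c) o\<^sub>L T) \<le> cmod c * norm T" by (rule le)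
    show "cmod c * norm T \<le> norm (Blinfun (scaleC c) o\<^sub>L T)"
    proof (cases "c = 0")
      case False
      have "Blinfun (scaleC (inverse c)) o\<^sub>L (Blinfun (scaleC c) o\<^sub>L T) = T"
        using False by (intro blinfun_eqI) (simp add: simps)
      then have "norm T \<le> cmod (inverse c) * norm (Blinfun (scaleC c) o\<^sub>L T)" by (metis le)
      then show ?thesis using False by (simp add: norm_divide field_simps)
    qed simp
  qed
  show "adj (adj x) = x"
    by (transfer) (rule adjoint_op_adjoint_op)
  show "adj (x + y) = adj x + adj y"
    by (transfer, rule adjoint_opI)
      (simp add: blinfun.bilinear_simps adj_simps algebra_simps adjoint_op)
  show "adj (c *\<^sub>C x) = cnj c *\<^sub>C adj x"
    by (transfer, rule adjoint_opI) (simp add: simps adjoint_op)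
  show "adj (x * y) = adj y * adj x"
    by (transfer, rule adjoint_opI) (simp add: adjoint_op)
  show "norm (adj x * x) = (norm x)\<^sup>2"
  proof (transfer, rule antisym)
    fix T :: "'a \<Rightarrow>\<^sub>L 'a" assume "adjointable T"
    then show "norm (adjoint_op T o\<^sub>L T) \<le> (norm T)\<^sup>2" "(norm T)\<^sup>2 \<le> norm (adjoint_op T o\<^sub>L T)"
      using norm_blinfun_compose[of "adjoint_op T" T] norm_adjointable_square_le[of T]
      by (simp_all add: norm_adjoint_op power2_eq_square)
  qed
qed

end

lift_definition left_mult :: "'a::cstar_algebra \<Rightarrow> 'a multiplier" is blinfun_mult_right
  by (rule adjointableI[of _ "blinfun_mult_right (adj _)"])
    (simp add: blinfun_mult_right.rep_eq adj_simps mult.assoc)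

lemma left_mult_simps:
  "left_mult (a + b) = left_mult a + left_mult b"
  "left_mult (a - b) = left_mult a - left_mult b"
  "left_mult (a * b) = left_mult a * left_mult b"
  "left_mult (c *\<^sub>C a) = c *\<^sub>C left_mult a"
  "left_mult (r *\<^sub>R a) = r *\<^sub>R left_mult a"
  by (transfer, rule blinfun_eqI, simp add: blinfun_mult_right.rep_eq blinfun.bilinear_simps
      algebra_simps bounded_linear_Blinfun_apply[OF scaleC.bounded_linear_right] mult_scaleC_left)+

lemma left_mult_adj: "left_mult (adj a) = adj (left_mult a)"
  by (transfer, rule sym, rule adjoint_opI) (simp add: blinfun_mult_right.rep_eq adj_simps mult.assoc)

lemma norm_left_mult [simp]: "norm (left_mult a) = norm a"
proof transfer
  fix a :: 'a
  show "norm (blinfun_mult_right a) = norm a"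
  proof (rule antisym)
    show "norm (blinfun_mult_right a) \<le> norm a"
      by (rule norm_blinfun_bound) (auto simp: blinfun_mult_right.rep_eq norm_mult_ineq)
    show "norm a \<le> norm (blinfun_mult_right a)"
    proof (cases "a = 0")
      case False
      have "norm a * norm a = norm (blinfun_mult_right a (adj a))"
        using cstar_identity[of "adj a"] by (simp add: blinfun_mult_right.rep_eq power2_eq_square)
      also have "\<dots> \<le> norm (blinfun_mult_right a) * norm a"
        using norm_blinfun[of "blinfun_mult_right a" "adj a"] by simp
      finally show ?thesis using False by simp
    qed simp
  qed
qed

lemma bounded_linear_left_mult: "bounded_linear left_mult"
  by (rule bounded_linear_intro[where K = 1]) (simp_all add: left_mult_simps)

lemma left_mult_eq_iff [simp]: "left_mult a = left_mult b \<longleftrightarrow> a = b"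
  by (metis left_mult_simps(2) norm_left_mult norm_eq_zero right_minus_eq)

lemma left_mult_sum: "left_mult (sum f I) = (\<Sum>i\<in>I. left_mult (f i))"
  by (rule linear_sum[OF bounded_linear.linear[OF bounded_linear_left_mult]])

lemma closed_left_mult_image:
  fixes B :: "'a::cstar_algebra set"
  assumes "closed B" shows "closed (left_mult ` B)"
proof -
  have dist: "dist (left_mult a) (left_mult b) = dist a b" for a b :: 'a
    by (simp add: dist_norm flip: left_mult_simps)
  show ?thesis
    unfolding closed_sequential_limits
  proof (intro allI impI)
    fix y l assume y: "(\<forall>n. y n \<in> left_mult ` B) \<and> y \<longlonglongrightarrow> l"
    then have "\<forall>n. \<exists>b. b \<in> B \<and> y n = left_mult b" by blast
    then obtain b where b: "\<And>n. b n \<in> B" "\<And>n. y n = left_mult (b n)" by (auto simp: choice_iff)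
    have "Cauchy y" using y LIMSEQ_imp_Cauchy by blast
    then have "Cauchy b" by (simp add: Cauchy_def b(2) dist)
    then obtain b0 where b0: "b \<longlonglongrightarrow> b0" by (auto simp: Cauchy_convergent_iff convergent_def)
    then have "b0 \<in> B" using assms b(1) closed_sequentially by blast
    moreover have "y \<longlonglongrightarrow> left_mult b0"
      using bounded_linear.tendsto[OF bounded_linear_left_mult b0] unfolding b(2)[symmetric] .
    ultimately show "l \<in> left_mult ` B" using y LIMSEQ_unique by blast
  qed
qed

section \<open>Automorphisms are isometric\<close>

text \<open>For norm a < 1, the element r with 2 r - r^2 = \<open>adj a * a\<close> is carried by
  \<phi> to one with the same relation to \<phi> a. So 1 minus the square of \<phi> a is a square in
  the multiplier algebra, hence positive.\<close>

lemma star_automorphism_contractive: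
  fixes \<phi> :: "'a::cstar_algebra \<Rightarrow> 'a"
  assumes \<phi>: "star_automorphism \<phi>"
  shows "norm (\<phi> a) \<le> norm a"
proof -
  have add: "\<phi> (x + y) = \<phi> x + \<phi> y" and mult: "\<phi> (x * y) = \<phi> x * \<phi> y"
    and adj: "\<phi> (adj x) = adj (\<phi> x)" and scale: "\<phi> (c *\<^sub>C x) = c *\<^sub>C \<phi> x" for x y c
    using \<phi> unfolding star_automorphism_def by blast+
  have diff: "\<phi> (x - y) = \<phi> x - \<phi> y" for x y
    by (metis add add_diff_cancel diff_add_cancel)
  have *: "norm (\<phi> a) \<le> 1" if "norm a < 1" for a
  proof -
    have "norm (adj a * a) < 1" using that by (simp add: cstar_identity power_less_one_iff)
    then obtain r where r: "adj r = r" "r + r - r * r = adj a * a"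
      using selfadjoint_sqrt_aux[of "adj a * a"] by (auto simp: adj_simps)
    define s where "s = 1 - left_mult (\<phi> r)"
    have "adj s = s" by (simp add: s_def adj_simps adj_one r flip: left_mult_adj adj)
    moreover have "\<phi> r + \<phi> r - \<phi> r * \<phi> r = adj (\<phi> a) * \<phi> a"
      using arg_cong[OF r(2), of \<phi>] by (simp add: add diff mult adj)
    then have "left_mult (adj (\<phi> a) * \<phi> a) = left_mult (\<phi> r + \<phi> r - \<phi> r * \<phi> r)" by simp
    then have "1 - adj (left_mult (\<phi> a)) * left_mult (\<phi> a) = s * s"
      by (simp add: s_def left_mult_simps left_mult_adj algebra_simps)
    ultimately have "pos (1\<^sup>2 *\<^sub>R 1 - adj (left_mult (\<phi> a)) * left_mult (\<phi> a))"
      using pos_square[of s] by simp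
    then show ?thesis by (subst (asm) pos_minus_adj_mult_iff) auto
  qed
  show ?thesis
  proof (rule dense_ge)
    fix t assume t: "norm a < t"
    then have "t > 0" using norm_ge_zero[of a] by linarith
    have "norm (\<phi> (of_real (1 / t) *\<^sub>C a)) \<le> 1"
      using t \<open>t > 0\<close> by (intro *) (simp add: norm_scaleC norm_divide)
    then show "norm (\<phi> a) \<le> t"
      using \<open>t > 0\<close> by (simp add: scale norm_scaleC norm_divide field_simps)
  qed
qed

lemma star_automorphism_isometric:
  fixes \<phi> :: "'a::cstar_algebra \<Rightarrow> 'a"
  assumes \<phi>: "star_automorphism \<phi>" and \<psi>: "star_automorphism \<psi>" "\<psi> \<circ> \<phi> = id"
  shows "norm (\<phi> a) = norm a"
  using star_automorphism_contractive[OF \<phi>, of a] star_automorphism_contractive[OF \<psi>(1), of "\<phi> a"] \<psi>(2)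
  by (metis antisym comp_apply id_apply)

section \<open>Layers of a graded algebra\<close>

text \<open>In units of the mesh, \<open>D p\<close> stands for the elements with spectrum in [p,
  infinity) and \<open>X n\<close> for a piece of \<open>x\<close> with spectrum in [n - 1, n + 1].
  The approximations of \<open>x\<close> have coefficient 1 on any prescribed block, so that a given
  finite set of weights never meets their cut-off.\<close>

locale graded_pieces =
  fixes B :: "'m::{cstar_algebra, monoid_mult} set" and D :: "int \<Rightarrow> 'm set"
    and X :: "int \<Rightarrow> 'm" and x :: 'm and L :: real
  assumes closed_B: "closed B"
    and B_zero: "0 \<in> B" and B_add: "a \<in> B \<Longrightarrow> b \<in> B \<Longrightarrow> a + b \<in> B"
    and B_scaleR: "a \<in> B \<Longrightarrow> r *\<^sub>R a \<in> B" and B_mult: "a \<in> B \<Longrightarrow> b \<in> B \<Longrightarrow> a * b \<in> B"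
    and D_zero: "0 \<in> D p" and D_add: "a \<in> D p \<Longrightarrow> b \<in> D p \<Longrightarrow> a + b \<in> D p"
    and D_scaleR: "a \<in> D p \<Longrightarrow> r *\<^sub>R a \<in> D p"
    and D_mult: "a \<in> D p \<Longrightarrow> b \<in> D q \<Longrightarrow> a * b \<in> D (p + q)"
    and D_antimono: "p \<le> q \<Longrightarrow> D q \<subseteq> D p"
    and D_subset_B: "0 \<le> p \<Longrightarrow> D p \<subseteq> B"
    and X_in_D: "X n \<in> D (n - 1)" and adj_X_in_D: "adj (X n) \<in> D (- n - 1)"
    and L_pos: "L > 0"
    and bessel: "finite F \<Longrightarrow> pos (L\<^sup>2 *\<^sub>R 1 - (\<Sum>n\<in>F. adj (X n) * X n))"
    and bessel': "finite F \<Longrightarrow> pos (L\<^sup>2 *\<^sub>R 1 - (\<Sum>n\<in>F. X n * adj (X n)))"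
    and x_in_B: "x \<in> B"
    and approx: "\<epsilon> > 0 \<Longrightarrow> \<exists>F c. finite F \<and> {-N..N} \<subseteq> F \<and> (\<forall>n\<in>{-N..N}. c n = 1) \<and>
      norm (x - (\<Sum>n\<in>F. c n *\<^sub>R X n)) < \<epsilon>"
begin

lemma B_diff: "a \<in> B \<Longrightarrow> b \<in> B \<Longrightarrow> a - b \<in> B"
  using B_add[of a "(-1) *\<^sub>R b"] B_scaleR[of b "-1"] by simp

lemma B_sum: "(\<And>i. i \<in> I \<Longrightarrow> f i \<in> B) \<Longrightarrow> sum f I \<in> B"
  by (induction I rule: infinite_finite_induct) (auto intro: B_zero B_add)

lemma D_sum: "(\<And>i. i \<in> I \<Longrightarrow> f i \<in> D p) \<Longrightarrow> sum f I \<in> D p"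
  by (induction I rule: infinite_finite_induct) (auto intro: D_zero D_add)

text \<open>Membership in \<open>B\<close> is asked only after a multiplication from the left, which
  lets the descent start from the unit of the multiplier algebra. Only \<open>x\<close> as a whole
  and no piece of it below the level -p is required to act.\<close>

definition layer :: "int \<Rightarrow> 'm set" where
  "layer p = {y. x * y \<in> B \<and> (\<forall>z\<in>D (- p). z * y \<in> B)}"

lemma layer_antimono: "p \<le> q \<Longrightarrow> layer q \<subseteq> layer p"
  using D_antimono[of "- q" "- p"] by (auto simp: layer_def)

lemma one_in_layer: "1 \<in> layer 0"
  using x_in_B D_subset_B[of 0] by (auto simp: layer_def)

lemma layer_diff: "a \<in> layer p \<Longrightarrow> b \<in> layer p \<Longrightarrow> a - b \<in> layer p"
  by (auto simp: layer_def right_diff_distrib intro: B_diff)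

lemma layer_add: "a \<in> layer p \<Longrightarrow> b \<in> layer p \<Longrightarrow> a + b \<in> layer p"
  by (auto simp: layer_def distrib_left intro: B_add)

lemma layer_scaleR: "a \<in> layer p \<Longrightarrow> r *\<^sub>R a \<in> layer p"
  by (auto simp: layer_def intro: B_scaleR)

lemma closed_layer: "closed (layer p)"
proof -
  have closed: "closed {y. z * y \<in> B}" for z
    using closed_vimage[OF closed_B, of "(*) z"] by (simp add: vimage_def continuous_on_mult_left)
  have "layer p = {y. x * y \<in> B} \<inter> (\<Inter>z\<in>D (- p). {y. z * y \<in> B})"
    by (auto simp: layer_def)
  then show ?thesis using closed by (simp add: closed_Int closed_INT)
qed

text \<open>Squared weights are at most \<tau>^2, and the difference is a positive combination of
  positive elements. The injection \<open>f\<close> serves for index shifts along a diagonal and for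
  the reflection n -> -n.\<close>

lemma weighted_bessel:
  assumes "finite F" "inj_on f F" "\<And>n. n \<in> F \<Longrightarrow> \<bar>t n\<bar> \<le> \<tau>"
  shows "pos ((\<tau> * L)\<^sup>2 *\<^sub>R 1 - (\<Sum>n\<in>F. adj (t n *\<^sub>R X (f n)) * (t n *\<^sub>R X (f n))))"
    and "pos ((\<tau> * L)\<^sup>2 *\<^sub>R 1 - (\<Sum>n\<in>F. (t n *\<^sub>R X (f n)) * adj (t n *\<^sub>R X (f n))))"
proof -
  have t: "0 \<le> \<tau>\<^sup>2 - t n * t n" if "n \<in> F" for n
    using power_mono[OF assms(3)[OF that], of 2] by (simp add: power2_eq_square)
  have *: "pos ((\<tau> * L)\<^sup>2 *\<^sub>R 1 - (\<Sum>n\<in>F. (t n * t n) *\<^sub>R g (f n)))"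
    if "pos (L\<^sup>2 *\<^sub>R 1 - (\<Sum>n\<in>f ` F. g n))" and "\<And>n. pos (g n)" for g :: "int \<Rightarrow> 'm"
  proof -
    have "pos (\<tau>\<^sup>2 *\<^sub>R (L\<^sup>2 *\<^sub>R 1 - (\<Sum>n\<in>f ` F. g n)) + (\<Sum>n\<in>F. (\<tau>\<^sup>2 - t n * t n) *\<^sub>R g (f n)))"
      using that t by (intro pos_add pos_sum pos_scaleR) auto
    then show ?thesis using assms(2)
      by (simp add: sum.reindex algebra_simps sum_subtractf scaleR_sum_right power_mult_distrib)
  qed
  show "pos ((\<tau> * L)\<^sup>2 *\<^sub>R 1 - (\<Sum>n\<in>F. adj (t n *\<^sub>R X (f n)) * (t n *\<^sub>R X (f n))))"
    using *[of "\<lambda>n. adj (X n) * X n"] bessel[of "f ` F"] assms(1)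
    by (simp add: adj_simps pos_adj_mult)
  show "pos ((\<tau> * L)\<^sup>2 *\<^sub>R 1 - (\<Sum>n\<in>F. (t n *\<^sub>R X (f n)) * adj (t n *\<^sub>R X (f n))))"
    using *[of "\<lambda>n. X n * adj (X n)"] bessel'[of "f ` F"] assms(1) pos_adj_mult[of "adj (X _)"]
    by (simp add: adj_simps)
qed

text \<open>The sum splits into the four diagonals n = m + r with r in {-2, -1, 1, 2}.
  Cauchy-Schwarz and the square function bound give \<delta> L^2 for each of them, whatever the size
  of \<open>F\<close>.\<close>

lemma norm_near_diagonal_le:
  assumes F: "finite F" and "\<delta> > 0"
    and s: "\<And>m n. m \<in> F \<Longrightarrow> n \<in> F \<Longrightarrow> \<bar>m - n\<bar> \<le> 2 \<Longrightarrow> \<bar>s m n\<bar> \<le> \<delta>"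
    and diag: "\<And>n. s n n = 0"
  shows "norm (\<Sum>m\<in>F. \<Sum>n\<in>F. (if \<bar>m - n\<bar> \<le> 2 then s m n else 0) *\<^sub>R (adj (X m) * X n)) \<le> 4 * \<delta> * L\<^sup>2"
proof -
  define R where "R = {-2, -1, 1, 2 :: int}"
  define t where "t r m = (if m + r \<in> F then s m (m + r) else 0)" for r m
  have inner: "(\<Sum>n\<in>F. (if \<bar>m - n\<bar> \<le> 2 then s m n else 0) *\<^sub>R (adj (X m) * X n))
      = (\<Sum>r\<in>R. adj (X m) * (t r m *\<^sub>R X (m + r)))" (is "sum ?f F = _") for m
  proof -
    have "sum ?f F = sum ?f (F \<inter> (+) m ` R)"
    proof (rule sum.mono_neutral_right[OF F])
      show "\<forall>n\<in>F - F \<inter> (+) m ` R. ?f n = 0"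
      proof
        fix n assume n: "n \<in> F - F \<inter> (+) m ` R"
        show "?f n = 0"
        proof (cases "\<bar>m - n\<bar> \<le> 2")
          case True
          have "n - m \<notin> R" using n by (auto simp: image_iff)
          then have "n = m" using True by (auto simp: R_def)
          then show ?thesis by (simp add: diag)
        qed simp
      qed
    qed auto
    also have "\<dots> = (\<Sum>n\<in>(+) m ` R. if n \<in> F then ?f n else 0)"
      by (simp add: sum.inter_restrict[symmetric] R_def Int_commute)
    also have "\<dots> = (\<Sum>r\<in>R. if m + r \<in> F then ?f (m + r) else 0)"
      by (subst sum.reindex) auto
    also have "\<dots> = (\<Sum>r\<in>R. adj (X m) * (t r m *\<^sub>R X (m + r)))"
      by (rule sum.cong) (auto simp: t_def R_def)
    finally show ?thesis .
  qed
  have "norm (\<Sum>m\<in>F. adj (X m) * (t r m *\<^sub>R X (m + r))) \<le> L * (\<delta> * L)" if "r \<in> R" for r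
  proof (rule Cauchy_Schwarz_pos)
    show "pos (L\<^sup>2 *\<^sub>R 1 - (\<Sum>i\<in>F. adj (X i) * X i))" by (rule bessel[OF F])
    show "pos ((\<delta> * L)\<^sup>2 *\<^sub>R 1 - (\<Sum>i\<in>F. adj (t r i *\<^sub>R X (i + r)) * (t r i *\<^sub>R X (i + r))))"
      using F s \<open>\<delta> > 0\<close> that by (intro weighted_bessel(1)) (auto simp: inj_on_def t_def R_def)
  qed (use \<open>\<delta> > 0\<close> L_pos in auto)
  then have "norm (\<Sum>r\<in>R. \<Sum>m\<in>F. adj (X m) * (t r m *\<^sub>R X (m + r))) \<le> of_nat (card R) * (L * (\<delta> * L))"
    by (rule sum_norm_bound)
  then show ?thesis
    unfolding inner by (subst sum.swap) (simp add: R_def power2_eq_square mult_ac)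
qed

text \<open>One step of the descent: removing from \<open>b\<close> the part \<open>b - c\<close> costs energy in proportion to what
  \<open>v\<close> does to it. The element \<open>q\<close> maps each layer into the next one, and since \<open>u\<close> carries the squared
  coefficients of \<open>v\<close>, its real part agrees with that of \<open>adj v * v\<close> up to terms near the diagonal, of second order
  in the Lipschitz constant \<open>\<delta>\<close>.\<close>

lemma layer_step:
  fixes k :: "int \<Rightarrow> real"
  assumes p: "0 \<le> p" and b: "b \<in> layer p"
    and supp: "\<And>n. k n \<noteq> 0 \<Longrightarrow> n \<in> {-N..N}" and k0: "\<And>n. n > - p - 2 \<Longrightarrow> k n = 0"
    and lip: "\<And>m n. \<bar>k m - k n\<bar> \<le> \<delta> * \<bar>real_of_int (m - n)\<bar>" and "\<delta> > 0"
    and \<eta>: "\<eta> > 8 * \<delta>\<^sup>2 * L\<^sup>2"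
  defines "v \<equiv> \<Sum>n\<in>{-N..N}. k n *\<^sub>R X n"
  shows "\<exists>c\<in>layer (p + 1). pos (adj b * b - adj c * c - (1 / \<eta>) *\<^sub>R (adj (v * (b - c)) * (v * (b - c))))"
proof -
  define u where "u = (\<Sum>n\<in>{-N..N}. (k n)\<^sup>2 *\<^sub>R X n)"
  \<comment> \<open>Makes the cost of replacing \<open>x\<close> by a finite sum of pieces at most
    the slack between \<eta> and the near-diagonal error.\<close>
  define \<epsilon> where "\<epsilon> = (\<eta> - 8 * \<delta>\<^sup>2 * L\<^sup>2) / (norm u + 1)"
  have "norm u + 1 > 0" by (simp add: add_nonneg_pos)
  then have \<epsilon>: "\<epsilon> > 0" "norm u * \<epsilon> \<le> \<eta> - 8 * \<delta>\<^sup>2 * L\<^sup>2"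
    using \<eta> by (auto simp: \<epsilon>_def field_simps)
  have "0 \<le> 8 * \<delta>\<^sup>2 * L\<^sup>2" by simp
  then have "\<eta> > 0" using \<eta> by linarith
  \<comment> \<open>Two indices beyond the support of \<open>k\<close> on either side, so that near
    the diagonal only coefficients equal to 1 meet nonzero weights.\<close>
  obtain F c where F: "finite F" "{-(N+2)..N+2} \<subseteq> F" and c: "\<And>n. n \<in> {-(N+2)..N+2} \<Longrightarrow> c n = 1"
    and e: "norm (x - (\<Sum>n\<in>F. c n *\<^sub>R X n)) < \<epsilon>"
    using approx[OF \<epsilon>(1), of "N + 2"] by blast
  define x' where "x' = (\<Sum>n\<in>F. c n *\<^sub>R X n)"
  define e where "e = x - x'"
  \<comment> \<open>The coefficient of \<open>adj (X m) * X n\<close> in the real part of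
    \<open>adj u * x'\<close> minus \<open>adj v * v\<close>.\<close>
  define s where "s m n = ((k m)\<^sup>2 * c n + (k n)\<^sup>2 * c m) / 2 - k m * k n" for m n
  define Q where "Q t = (\<Sum>m\<in>F. \<Sum>n\<in>F. t m n *\<^sub>R (adj (X m) * X n))" for t :: "int \<Rightarrow> int \<Rightarrow> real"
  have Q_add: "Q t + Q t' = Q (\<lambda>m n. t m n + t' m n)" and Q_scale: "r *\<^sub>R Q t = Q (\<lambda>m n. r * t m n)"
    and Q_diff: "Q t - Q t' = Q (\<lambda>m n. t m n - t' m n)" for t t' r
    by (simp_all add: Q_def scaleR_left_distrib scaleR_left_diff_distrib sum.distrib sum_subtractf scaleR_sum_right)
  have adj_Q: "adj (Q t) = Q (\<lambda>m n. t n m)" for t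
    unfolding Q_def by (simp add: adj_sum adj_simps) (rule sum.swap)
  have Q_prod: "adj (\<Sum>n\<in>F. f n *\<^sub>R X n) * (\<Sum>n\<in>F. g n *\<^sub>R X n) = Q (\<lambda>m n. f m * g n)" for f g
    by (simp add: Q_def adj_sum adj_simps sum_product mult.commute)
  have Q_cong: "Q t = Q t'" if "\<And>m n. m \<in> F \<Longrightarrow> n \<in> F \<Longrightarrow> t m n = t' m n" for t t'
    unfolding Q_def using that by (intro sum.cong) auto
  have sub: "{-N..N} \<subseteq> F" using F(2) by auto
  have u_F: "u = (\<Sum>n\<in>F. (k n)\<^sup>2 *\<^sub>R X n)" unfolding u_def
    by (rule sum.mono_neutral_left[OF F(1) sub]) (use supp in force)
  have v_F: "v = (\<Sum>n\<in>F. k n *\<^sub>R X n)" unfolding v_def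
    by (rule sum.mono_neutral_left[OF F(1) sub]) (use supp in force)
  \<comment> \<open>For n - m at least 3 the product \<open>adj (X m) * X n\<close> lies in
    \<open>D 1\<close>, since each factor spreads by 1. The terms with m - n at least 3 are
    cancelled by \<open>adj a\<close>; each side is thus met once in \<open>q + adj q\<close>, which
    explains the factor 2.\<close>
  define a where "a = Q (\<lambda>m n. if n - m \<ge> 3 then 2 * s m n else 0)"
  define R where "R = Q (\<lambda>m n. if \<bar>m - n\<bar> \<le> 2 then s m n else 0)"
  define q where "q = adj u * x - a"
  define E where "E = R + (1/2) *\<^sub>R (adj u * e + adj e * u)"
  have s_near: "s m n = (k m - k n)\<^sup>2 / 2" if "\<bar>m - n\<bar> \<le> 2" for m n
  proof (cases "k m = 0 \<and> k n = 0")
    case False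
    then have "m \<in> {-(N+2)..N+2}" "n \<in> {-(N+2)..N+2}" using supp[of m] supp[of n] that by auto
    then show ?thesis by (simp add: s_def c power2_eq_square algebra_simps)
  qed (simp add: s_def)
  have norm_R: "norm R \<le> 4 * (2 * \<delta>\<^sup>2) * L\<^sup>2"
    unfolding R_def Q_def
  proof (rule norm_near_diagonal_le[OF F(1)])
    show "0 < 2 * \<delta>\<^sup>2" using \<open>\<delta> > 0\<close> by simp
    show "s n n = 0" for n by (simp add: s_near)
    show "\<bar>s m n\<bar> \<le> 2 * \<delta>\<^sup>2" if "\<bar>m - n\<bar> \<le> 2" for m n
    proof -
      have "\<delta> * \<bar>real_of_int (m - n)\<bar> \<le> \<delta> * 2" using that \<open>\<delta> > 0\<close> by (intro mult_left_mono) linarith+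
      then have "\<bar>k m - k n\<bar>\<^sup>2 \<le> (\<delta> * 2)\<^sup>2" using lip[of m n] by (intro power_mono) auto
      then show ?thesis by (simp add: s_near[OF that] power_mult_distrib)
    qed
  qed
  have norm_E: "norm E \<le> \<eta>"
  proof -
    have "norm (adj u * e + adj e * u) \<le> norm u * norm e + norm e * norm u"
      using norm_mult_ineq[of "adj u" e] norm_mult_ineq[of "adj e" u]
      by (intro norm_triangle_le add_mono) simp_all
    then have "norm ((1/2) *\<^sub>R (adj u * e + adj e * u)) \<le> norm u * norm e" by (simp add: mult_ac)
    also have "\<dots> \<le> norm u * \<epsilon>" using \<open>norm (x - _) < \<epsilon>\<close> by (intro mult_left_mono) (auto simp: e_def x'_def)
    finally show ?thesis using norm_R \<epsilon>(2) unfolding E_def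
      by (intro norm_triangle_le) linarith
  qed
  have adj_E: "adj E = E"
  proof -
    have "adj R = R" unfolding R_def adj_Q by (rule Q_cong) (auto simp: s_def mult.commute)
    then show ?thesis by (simp add: E_def adj_simps add.commute)
  qed
  have re_q: "q + adj q = 2 *\<^sub>R (adj v * v + E)"
  proof -
    have "adj u * x' + adj x' * u - a - adj a = 2 *\<^sub>R (adj v * v + R)"
      unfolding u_F v_F x'_def a_def R_def Q_prod adj_Q Q_add Q_diff Q_scale
      by (rule Q_cong) (auto simp: s_def field_simps)
    moreover have "adj u * x = adj u * x' + adj u * e" "adj x * u = adj x' * u + adj e * u"
      by (simp_all add: e_def algebra_simps adj_simps)
    ultimately show ?thesis by (simp add: q_def E_def adj_simps algebra_simps)
  qed
  have pos_E: "pos (E + \<eta> *\<^sub>R 1)"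
    using pos_scaled_one_minus[of "- E" \<eta>] norm_E adj_E by (simp add: adj_simps add.commute)
  have a_D: "a \<in> D 1"
  proof -
    have "adj (X m) * X n \<in> D 1" if "n - m \<ge> 3" for m n
    proof -
      have "adj (X m) * X n \<in> D ((- m - 1) + (n - 1))" by (intro D_mult adj_X_in_D X_in_D)
      then show ?thesis using D_antimono[of 1 "(- m - 1) + (n - 1)"] that by auto
    qed
    then show ?thesis unfolding a_def Q_def
      by (intro D_sum) (auto intro!: D_scaleR simp: D_zero)
  qed
  have u_D: "adj u \<in> D (p + 1)"
    unfolding u_def adj_sum
  proof (rule D_sum)
    fix n
    show "adj ((k n)\<^sup>2 *\<^sub>R X n) \<in> D (p + 1)"
    proof (cases "k n = 0")
      case False
      then have "p + 1 \<le> - n - 1" using k0[of n] by linarith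
      then show ?thesis using D_antimono[of "p + 1" "- n - 1"] adj_X_in_D[of n]
        by (auto simp: adj_simps intro!: D_scaleR)
    qed (simp add: D_zero)
  qed
  \<comment> \<open>In \<open>z * (q * y)\<close> the factor \<open>z * adj u\<close> is in
    \<open>D 0\<close> and \<open>z * a\<close> in \<open>D (- p)\<close>, so both are covered;
    \<open>x\<close> only ever occurs directly in front of \<open>y\<close>.\<close>
  have q_layer: "q * y \<in> layer (p + 1)" if y: "y \<in> layer p" for y
  proof -
    have xy: "x * y \<in> B" and zy: "\<And>z. z \<in> D (- p) \<Longrightarrow> z * y \<in> B" using y by (auto simp: layer_def)
    have "a * y \<in> B" using a_D D_antimono[of "- p" 1] p by (intro zy) auto
    moreover have "adj u * (x * y) \<in> B" using u_D D_subset_B[of "p + 1"] p by (intro B_mult[OF _ xy]) auto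
    ultimately have "q * y \<in> B" by (simp add: q_def algebra_simps B_diff)
    moreover have "z * (q * y) \<in> B" if z: "z \<in> D (- (p + 1))" for z
    proof -
      have "z * adj u \<in> B" using D_mult[OF z u_D] D_subset_B[of 0] by auto
      then have "(z * adj u) * (x * y) \<in> B" using xy by (rule B_mult)
      moreover have "z * a \<in> D (- p)" using D_mult[OF z a_D] by simp
      then have "(z * a) * y \<in> B" by (rule zy)
      ultimately show ?thesis by (simp add: q_def algebra_simps B_diff)
    qed
    ultimately show ?thesis using x_in_B B_mult by (auto simp: layer_def)
  qed
  \<comment> \<open>\<open>E\<close> is at least -\<eta>, so the real part of Z is at least \<eta>.
    The element sought is c = Z^(-1) q b, equivalently b - c = 2 \<eta> Z^(-1) b.\<close>
  define Z where "Z = (2 * \<eta>) *\<^sub>R 1 + q"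
  \<comment> \<open>The denominator gives both \<tau> * (norm Z)^2 \<le> \<eta>, whence (norm W)^2
    \<le> 1 - \<tau> \<eta>, and \<tau> \<eta> < 1, under the root.\<close>
  define \<tau> where "\<tau> = \<eta> / ((norm Z)\<^sup>2 + 1 + \<eta>\<^sup>2)"
  define W where "W = 1 - \<tau> *\<^sub>R Z"
  have denom: "(norm Z)\<^sup>2 + 1 + \<eta>\<^sup>2 > 0" by (simp add: add_pos_nonneg add_nonneg_pos)
  have \<tau>1: "\<tau> > 0" using \<open>\<eta> > 0\<close> denom by (simp add: \<tau>_def)
  have "\<eta> * (norm Z)\<^sup>2 \<le> \<eta> * ((norm Z)\<^sup>2 + 1 + \<eta>\<^sup>2)" using \<open>\<eta> > 0\<close> by (intro mult_left_mono) auto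
  then have \<tau>2: "\<tau> * (norm Z)\<^sup>2 \<le> \<eta>" using denom by (simp add: \<tau>_def pos_divide_le_eq)
  have "\<eta> * \<eta> < (norm Z)\<^sup>2 + 1 + \<eta>\<^sup>2" by (simp add: power2_eq_square add_nonneg_pos)
  then have \<tau>3: "\<tau> * \<eta> < 1" using denom by (simp add: \<tau>_def pos_divide_less_eq)
  note \<tau> = \<tau>1 \<tau>2 \<tau>3
  have norm_W: "norm W \<le> sqrt (1 - \<tau> * \<eta>)"
  proof -
    have "q + adj q + (2 * \<eta>) *\<^sub>R 1 = 2 *\<^sub>R (adj v * v + (E + \<eta> *\<^sub>R 1))"
      unfolding re_q by (simp add: algebra_simps)
    also have "pos \<dots>" by (intro pos_scaleR pos_add[OF pos_adj_mult pos_E]) auto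
    finally have 1: "pos (q + adj q + (2 * \<eta>) *\<^sub>R 1)" .
    have 2: "pos ((norm Z)\<^sup>2 *\<^sub>R 1 - adj Z * Z)"
      by (intro pos_scaled_one_minus) (auto simp: adj_simps cstar_identity)
    have "\<tau> * \<eta> - \<tau> * \<tau> * (norm Z)\<^sup>2 \<ge> 0"
      using mult_left_mono[OF \<tau>(2), of \<tau>] \<tau>(1) by (simp add: mult_ac)
    then have 3: "pos ((\<tau> * \<eta> - \<tau> * \<tau> * (norm Z)\<^sup>2) *\<^sub>R (1::'m))"
      using pos_adj_mult[of "1::'m"] by (intro pos_scaleR) (auto simp: adj_one)
    have two: "(2 * \<eta>) *\<^sub>R (1::'m) = \<eta> *\<^sub>R 1 + \<eta> *\<^sub>R 1"
      by (simp flip: scaleR_left_distrib)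
    have "pos (\<tau> *\<^sub>R (q + adj q + (2 * \<eta>) *\<^sub>R 1) + (\<tau> * \<tau>) *\<^sub>R ((norm Z)\<^sup>2 *\<^sub>R 1 - adj Z * Z)
        + (\<tau> * \<eta> - \<tau> * \<tau> * (norm Z)\<^sup>2) *\<^sub>R 1)"
      using \<tau>(1) by (intro pos_add[OF pos_add[OF pos_scaleR[OF 1] pos_scaleR[OF 2]] 3]) auto
    also have "\<dots> = (sqrt (1 - \<tau> * \<eta>))\<^sup>2 *\<^sub>R 1 - adj W * W"
      unfolding W_def Z_def two using \<tau>(3) by (simp add: adj_simps adj_one algebra_simps)
    finally show ?thesis using \<tau>(3) by (subst (asm) pos_minus_adj_mult_iff) auto
  qed
  have "sqrt (1 - \<tau> * \<eta>) < 1" using \<tau>(1) \<open>\<eta> > 0\<close> by simp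
  then have norm_W1: "norm W < 1" using norm_W by linarith
  \<comment> \<open>An iteration for Z y = q b inside the closed set \<open>layer (p + 1)\<close>:
    \<open>q\<close> maps both the iterate and \<open>b\<close> into it. In this way the solution
    itself is seen to lie in that layer.\<close>
  define f where "f y = y - \<tau> *\<^sub>R (Z * y - q * b)" for y
  have "\<exists>!c. c \<in> layer (p + 1) \<and> f c = c"
  proof (rule Banach_fix)
    show "complete (layer (p + 1))" using closed_layer by (simp add: complete_eq_closed)
    have "0 \<in> layer (p + 1)" by (simp add: layer_def B_zero)
    then show "layer (p + 1) \<noteq> {}" by auto
    show "0 \<le> norm W" "norm W < 1" using norm_W1 by auto
    show "f ` layer (p + 1) \<subseteq> layer (p + 1)"
    proof clarify
      fix y assume y: "y \<in> layer (p + 1)"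
      then have "y \<in> layer p" using layer_antimono[of p "p + 1"] by auto
      then show "f y \<in> layer (p + 1)" unfolding f_def Z_def
        using y b q_layer by (auto simp: algebra_simps intro!: layer_diff layer_scaleR layer_add)
    qed
    show "dist (f y) (f z) \<le> norm W * dist y z" for y z
    proof -
      have "f y - f z = W * (y - z)" by (simp add: f_def W_def algebra_simps)
      then show ?thesis using norm_mult_ineq[of W "y - z"] by (simp add: dist_norm)
    qed
  qed
  then obtain c where c: "c \<in> layer (p + 1)" "f c = c" by blast
  define Y where "Y = b - c"
  have "Z * c = q * b" using c(2) \<tau>(1) by (simp add: f_def)
  then have qY: "q * Y = (2 * \<eta>) *\<^sub>R c" by (simp add: Z_def Y_def algebra_simps)
  have cY: "c = (1 / (2 * \<eta>)) *\<^sub>R (q * Y)" using \<open>\<eta> > 0\<close> by (simp add: qY)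
  \<comment> \<open>Since 2 \<eta> c = q Y, the cross terms between Y and c become the quadratic
    form of \<open>q + adj q\<close> at Y, and \<open>adj Y * Y\<close> absorbs the error
    \<open>E\<close>.\<close>
  have "adj b * b - adj c * c = adj Y * Y + (adj Y * c + adj c * Y)"
    by (simp add: Y_def algebra_simps adj_simps)
  also have "adj Y * c + adj c * Y = (1 / (2 * \<eta>)) *\<^sub>R (adj Y * (q + adj q) * Y)"
    by (subst (1 2) cY) (simp add: adj_simps algebra_simps)
  also have "\<dots> = (1 / \<eta>) *\<^sub>R (adj Y * (adj v * v + E) * Y)" unfolding re_q by simp
  finally have "adj b * b - adj c * c - (1 / \<eta>) *\<^sub>R (adj (v * Y) * (v * Y)) = (1 / \<eta>) *\<^sub>R (adj Y * (E + \<eta> *\<^sub>R 1) * Y)"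
    using \<open>\<eta> > 0\<close> by (simp add: adj_simps algebra_simps)
  moreover have "pos \<dots>" using pos_E \<open>\<eta> > 0\<close> by (intro pos_scaleR pos_conjugate) auto
  ultimately have "pos (adj b * b - adj c * c - (1 / \<eta>) *\<^sub>R (adj (v * Y) * (v * Y)))" by (simp only:)
  then show ?thesis using c(1) unfolding Y_def by blast
qed

text \<open>A slowly varying multiplier \<theta> of the pieces almost keeps \<open>x\<close> in
  \<open>B\<close>. In 1 = b_M + (sum of Y_p over p < M), the frequencies above -p act on Y_p within
  \<open>B\<close>; below, \<theta> is compared with the constant \<theta>(-p-1), that is, with a
  multiple of \<open>x\<close>. The cut-off \<kappa> makes the comparison finite.\<close>

theorem dist_multiplier_sum_le:
  fixes \<kappa> \<theta> :: "int \<Rightarrow> real" and M :: nat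
  assumes supp: "\<And>n. \<kappa> n \<noteq> 0 \<Longrightarrow> n \<in> {-N..N}" and flat: "\<And>n. \<kappa> n * \<theta> n = \<theta> n"
    and \<theta>_M: "\<And>n. n \<le> - int M \<Longrightarrow> \<theta> n = 0"
    and \<kappa>_le: "\<And>n. \<bar>\<kappa> n\<bar> \<le> 1" and \<theta>_le: "\<And>n. \<bar>\<theta> n\<bar> \<le> 1"
    and \<kappa>_lip: "\<And>m n. \<bar>\<kappa> m - \<kappa> n\<bar> \<le> \<delta> * \<bar>real_of_int (m - n)\<bar>"
    and \<theta>_lip: "\<And>m n. \<bar>\<theta> m - \<theta> n\<bar> \<le> \<delta> * \<bar>real_of_int (m - n)\<bar>" and "\<delta> > 0"
    and far: "norm (x - (\<Sum>n\<in>{-N..N}. \<kappa> n *\<^sub>R X n)) \<le> \<epsilon>"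
  shows "\<exists>y\<in>B. norm ((\<Sum>n\<in>{-N..N}. \<theta> n *\<^sub>R X n) - y) \<le> \<epsilon> * (2 + real M * \<delta>) + 11 * \<delta> * L * sqrt (real M)"
proof -
  \<comment> \<open>The weight vanishes at n = -p-1 as well, so its support lies in n \<le> -p-2, as
    \<open>layer_step\<close> demands.\<close>
  define k where "k p n = (if n \<le> - p - 1 then \<kappa> n * (\<theta> n - \<theta> (- p - 1)) else 0)" for p n :: int
  define v where "v p = (\<Sum>n\<in>{-N..N}. k p n *\<^sub>R X n)" for p
  \<comment> \<open>\<open>k\<close> has Lipschitz constant 3 \<delta>, so \<eta> must exceed 72
    \<delta>^2 L^2; 81 is the next perfect square, with sqrt \<eta> = 9 \<delta> L.\<close>
  define \<eta> where "\<eta> = 81 * \<delta>\<^sup>2 * L\<^sup>2"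
  have \<eta>: "\<eta> > 8 * (3 * \<delta>)\<^sup>2 * L\<^sup>2" "\<eta> > 0"
    using L_pos \<open>\<delta> > 0\<close> by (simp_all add: \<eta>_def power_mult_distrib)
  have k_lip: "\<bar>k p m - k p n\<bar> \<le> (3 * \<delta>) * \<bar>real_of_int (m - n)\<bar>" for p m n
  proof -
    \<comment> \<open>Cutting off at a zero of \<theta> n - \<theta>(-p-1) keeps the Lipschitz
      constant \<delta>. As |w| \<le> 2, the product with \<kappa> has constant 1 + 2 times
      \<delta>.\<close>
    define w where "w n = (if n \<le> - p - 1 then \<theta> n - \<theta> (- p - 1) else 0)" for n
    have w_lip: "\<bar>w m - w n\<bar> \<le> \<delta> * \<bar>real_of_int (m - n)\<bar>" for m n
    proof -
      have "\<bar>\<theta> j - \<theta> (- p - 1)\<bar> \<le> \<delta> * \<bar>real_of_int (j - i)\<bar>" if "j \<le> - p - 1" "\<not> i \<le> - p - 1" for i j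
        using that \<open>\<delta> > 0\<close> by (intro order.trans[OF \<theta>_lip] mult_left_mono) auto
      from this[of m n] this[of n m] show ?thesis
        using \<theta>_lip[of m n] \<open>\<delta> > 0\<close> by (auto simp: w_def abs_minus_commute)
    qed
    have "\<bar>w n\<bar> \<le> 2" using \<theta>_le[of n] \<theta>_le[of "- p - 1"] by (auto simp: w_def)
    have "k p m - k p n = \<kappa> m * (w m - w n) + w n * (\<kappa> m - \<kappa> n)"
      by (simp add: k_def w_def algebra_simps)
    also have "\<bar>\<dots>\<bar> \<le> \<bar>\<kappa> m\<bar> * \<bar>w m - w n\<bar> + \<bar>w n\<bar> * \<bar>\<kappa> m - \<kappa> n\<bar>"
      by (metis abs_mult abs_triangle_ineq)
    also have "\<dots> \<le> 1 * (\<delta> * \<bar>real_of_int (m - n)\<bar>) + 2 * (\<delta> * \<bar>real_of_int (m - n)\<bar>)"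
      using \<kappa>_le \<open>\<bar>w n\<bar> \<le> 2\<close> w_lip \<kappa>_lip \<open>\<delta> > 0\<close> by (intro add_mono mult_mono) auto
    finally show ?thesis by simp
  qed
  have step: "\<exists>c. c \<in> layer (int (Suc n)) \<and>
      pos (adj b * b - adj c * c - (1 / \<eta>) *\<^sub>R (adj (v (int n) * (b - c)) * (v (int n) * (b - c))))"
    if "b \<in> layer (int n)" for b and n :: nat
  proof -
    have "\<exists>c\<in>layer (int n + 1).
      pos (adj b * b - adj c * c - (1 / \<eta>) *\<^sub>R (adj (v (int n) * (b - c)) * (v (int n) * (b - c))))"
      unfolding v_def
    proof (rule layer_step[OF _ that, where \<delta> = "3 * \<delta>"])
      show "k (int n) m \<noteq> 0 \<Longrightarrow> m \<in> {-N..N}" for m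
        using supp[of m] by (auto simp: k_def split: if_splits)
      show "m > - int n - 2 \<Longrightarrow> k (int n) m = 0" for m
        by (cases "m = - int n - 1") (auto simp: k_def)
    qed (use k_lip \<open>\<delta> > 0\<close> \<eta>(1) in simp_all)
    then show ?thesis by (auto simp: add.commute)
  qed
  have "\<exists>b. \<forall>n. (b n \<in> layer (int n) \<and> (n = 0 \<longrightarrow> b n = 1)) \<and>
      pos (adj (b n) * b n - adj (b (Suc n)) * b (Suc n)
        - (1 / \<eta>) *\<^sub>R (adj (v (int n) * (b n - b (Suc n))) * (v (int n) * (b n - b (Suc n)))))"
    by (rule dependent_nat_choice) (use one_in_layer step in auto)
  then obtain b where b0: "b 0 = 1" and b_layer: "\<And>n. b n \<in> layer (int n)"
    and b_pos: "\<And>n. pos (adj (b n) * b n - adj (b (Suc n)) * b (Suc n)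
        - (1 / \<eta>) *\<^sub>R (adj (v (int n) * (b n - b (Suc n))) * (v (int n) * (b n - b (Suc n)))))"
    by blast
  define Y where "Y n = b n - b (Suc n)" for n
  define g where "g n = adj (v (int n) * Y n) * (v (int n) * Y n)" for n
  have energy: "pos (1 - adj (b n) * b n - (1 / \<eta>) *\<^sub>R (\<Sum>i<n. g i))" for n
  proof (induction n)
    case 0 show ?case by (simp add: b0 adj_one)
  next
    case (Suc n)
    from pos_add[OF Suc b_pos[of n]] show ?case by (simp add: g_def Y_def algebra_simps)
  qed
  have g_pos: "pos (g n)" for n unfolding g_def by (rule pos_adj_mult)
  have norm_b: "norm (b n) \<le> 1" for n
  proof -
    have "pos ((1 - adj (b n) * b n - (1 / \<eta>) *\<^sub>R (\<Sum>i<n. g i)) + (1 / \<eta>) *\<^sub>R (\<Sum>i<n. g i))"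
      using \<open>\<eta> > 0\<close> by (intro pos_add energy pos_scaleR pos_sum g_pos) auto
    then have "pos (1\<^sup>2 *\<^sub>R 1 - adj (b n) * b n)" by simp
    then show ?thesis by (subst (asm) pos_minus_adj_mult_iff) auto
  qed
  have Y_layer: "Y n \<in> layer (int n)" for n
    unfolding Y_def using b_layer[of n] b_layer[of "Suc n"] layer_antimono[of "int n" "int (Suc n)"]
    by (intro layer_diff) auto
  have norm_Y: "norm (Y n) \<le> 2" for n
    unfolding Y_def using norm_triangle_ineq4[of "b n" "b (Suc n)"] norm_b[of n] norm_b[of "Suc n"] by linarith
  have sum_g: "pos (\<eta> *\<^sub>R 1 - (\<Sum>i<M. g i))"
  proof -
    have "pos (\<eta> *\<^sub>R ((1 - adj (b M) * b M - (1 / \<eta>) *\<^sub>R (\<Sum>i<M. g i)) + adj (b M) * b M))"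
      using \<open>\<eta> > 0\<close> by (intro pos_scaleR pos_add energy pos_adj_mult) auto
    then show ?thesis using \<open>\<eta> > 0\<close> by (simp add: algebra_simps)
  qed

  define c where "c n = \<theta> (- int n - 1)" for n
  define e where "e = x - (\<Sum>n\<in>{-N..N}. \<kappa> n *\<^sub>R X n)"
  \<comment> \<open>The boundary frequency -p: \<open>X (- p)\<close> is only known to be in
    \<open>D (- p - 1)\<close>, too low for \<open>r\<close>, while it is too high for
    \<open>v\<close>. Its coefficient is at most \<delta>.\<close>
  define E where "E n = (\<kappa> (- int n) * (\<theta> (- int n) - c n)) *\<^sub>R X (- int n)" for n :: nat
  define r where "r p = (\<Sum>n\<in>{-N..N}. (if n > - int p then \<kappa> n * (\<theta> n - c p) else 0) *\<^sub>R X n)" for p :: nat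
  define y where "y = (\<Sum>n\<in>{-N..N}. \<theta> n *\<^sub>R X n)"
  \<comment> \<open>Each factor meets a layer that admits it: \<open>y\<close> is in
    \<open>D (- M)\<close> because \<theta> vanishes up to -M, and \<open>r p\<close> is in
    \<open>D (- p)\<close>.\<close>
  define z where "z = y * b M + (\<Sum>p<M. c p *\<^sub>R (x * Y p) + r p * Y p)"
  have split: "y - c p *\<^sub>R x + c p *\<^sub>R e = v (int p) + E p + r p" for p
  proof -
    have delta: "E p = (\<Sum>n\<in>{-N..N}. (if n = - int p then \<kappa> n * (\<theta> n - c p) else 0) *\<^sub>R X n)"
    proof -
      have "(\<Sum>n\<in>{-N..N}. (if n = - int p then \<kappa> n * (\<theta> n - c p) else 0) *\<^sub>R X n)
        = (\<Sum>n\<in>{-N..N}. if n = - int p then (\<kappa> n * (\<theta> n - c p)) *\<^sub>R X n else 0)"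
        by (rule sum.cong) auto
      also have "\<dots> = (if - int p \<in> {-N..N} then E p else 0)"
        by (subst sum.delta) (auto simp: E_def)
      also have "\<dots> = E p" using supp[of "- int p"] by (cases "\<kappa> (- int p) = 0") (auto simp: E_def)
      finally show ?thesis ..
    qed
    have "y - c p *\<^sub>R x + c p *\<^sub>R e = (\<Sum>n\<in>{-N..N}. (\<kappa> n * (\<theta> n - c p)) *\<^sub>R X n)"
      by (simp add: y_def e_def algebra_simps flat sum_subtractf scaleR_sum_right)
    also have "\<dots> = v (int p) + E p + r p"
      unfolding delta v_def r_def sum.distrib[symmetric] scaleR_left_distrib[symmetric]
      by (intro sum.cong refl arg_cong2[where f = scaleR]) (auto simp: k_def c_def)
    finally show ?thesis .
  qed
  have "z \<in> B"
  proof -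
    have "y \<in> D (- int M)"
      unfolding y_def
    proof (rule D_sum)
      fix n
      show "\<theta> n *\<^sub>R X n \<in> D (- int M)"
        using \<theta>_M[of n] X_in_D[of n] D_antimono[of "- int M" "n - 1"]
        by (cases "n \<le> - int M") (auto intro!: D_scaleR simp: D_zero)
    qed
    then have "y * b M \<in> B" using b_layer[of M] by (auto simp: layer_def)
    moreover have "r p \<in> D (- int p)" for p
      unfolding r_def
    proof (rule D_sum)
      fix n
      show "(if n > - int p then \<kappa> n * (\<theta> n - c p) else 0) *\<^sub>R X n \<in> D (- int p)"
        using X_in_D[of n] D_antimono[of "- int p" "n - 1"]
        by (cases "n > - int p") (auto intro!: D_scaleR simp: D_zero)
    qed
    then have "r p * Y p \<in> B" "x * Y p \<in> B" for p using Y_layer[of p] by (auto simp: layer_def)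
    ultimately show ?thesis unfolding z_def by (intro B_add B_sum B_scaleR)
  qed
  moreover have "norm (y - z) \<le> \<epsilon> * (2 + real M * \<delta>) + 11 * \<delta> * L * sqrt (real M)"
  proof (cases "M = 0")
    case True
    have "\<epsilon> \<ge> 0" using far norm_ge_zero order.trans by blast
    then show ?thesis using True by (simp add: z_def b0)
  next
    case False
    have Y_sum: "(\<Sum>p<M. Y p) = 1 - b M" using sum_lessThan_telescope'[of b M] by (simp add: Y_def b0)
    have "y - z = (\<Sum>p<M. y * Y p) - (\<Sum>p<M. c p *\<^sub>R (x * Y p) + r p * Y p)"
      unfolding z_def by (simp add: Y_sum right_diff_distrib flip: sum_distrib_left)
    also have "\<dots> = (\<Sum>p<M. (y - c p *\<^sub>R x - r p) * Y p)"
      by (simp add: sum_subtractf[symmetric] algebra_simps)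
    also have "\<dots> = (\<Sum>p<M. (v (int p) + E p - c p *\<^sub>R e) * Y p)"
      using split by (intro sum.cong refl arg_cong2[where f = "(*)"]) (simp add: algebra_simps)
    also have "\<dots> = (\<Sum>p<M. v (int p) * Y p) + (\<Sum>p<M. E p * Y p) - e * (\<Sum>p<M. c p *\<^sub>R Y p)"
      by (simp add: algebra_simps sum.distrib sum_subtractf sum_distrib_left)
    finally have yz: "y - z = \<dots>" .
    \<comment> \<open>Cauchy-Schwarz against the constant family 1. The energy telescopes, so the
      sum of all \<open>g\<close> is at most \<eta> and not M times that.\<close>
    have 1: "norm (\<Sum>p<M. v (int p) * Y p) \<le> sqrt (real M) * (9 * \<delta> * L)"
    proof -
      have "norm (\<Sum>p<M. adj 1 * (v (int p) * Y p)) \<le> sqrt (real M) * sqrt \<eta>"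
        using False \<open>\<eta> > 0\<close> sum_g by (intro Cauchy_Schwarz_pos) (simp_all add: adj_one g_def sum_constant_scaleR)
      moreover have "sqrt \<eta> = 9 * \<delta> * L"
        using \<open>\<delta> > 0\<close> L_pos by (simp add: \<eta>_def real_sqrt_mult)
      ultimately show ?thesis by (simp add: adj_one)
    qed
    have 2: "norm (\<Sum>p<M. E p * Y p) \<le> (\<delta> * L) * (2 * sqrt (real M))"
    proof -
      have "norm (\<Sum>p<M. adj (adj (E p)) * Y p) \<le> (\<delta> * L) * (2 * sqrt (real M))"
      proof (rule Cauchy_Schwarz_pos)
        have "\<bar>\<kappa> (- int p) * (\<theta> (- int p) - c p)\<bar> \<le> \<delta>" for p
          using mult_mono[OF \<kappa>_le[of "- int p"] \<theta>_lip[of "- int p" "- int p - 1"]] by (simp add: abs_mult c_def)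
        then show "pos ((\<delta> * L)\<^sup>2 *\<^sub>R 1 - (\<Sum>p<M. adj (adj (E p)) * adj (E p)))"
          unfolding E_def adj_adj by (intro weighted_bessel(2)) (auto simp: inj_on_def)
        have "pos (\<Sum>p<M. 2\<^sup>2 *\<^sub>R 1 - adj (Y p) * Y p)"
          using norm_Y by (intro pos_sum) (subst pos_minus_adj_mult_iff, auto)
        then show "pos ((2 * sqrt (real M))\<^sup>2 *\<^sub>R 1 - (\<Sum>p<M. adj (Y p) * Y p))"
          by (simp add: sum_subtractf power_mult_distrib sum_constant_scaleR mult.commute)
      qed (use \<open>\<delta> > 0\<close> L_pos False in auto)
      then show ?thesis by simp
    qed
    have 3: "norm (e * (\<Sum>p<M. c p *\<^sub>R Y p)) \<le> \<epsilon> * (2 + real M * \<delta>)"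
    proof -
      \<comment> \<open>Summation by parts moves the differences to the slowly varying c, while the
        b_p are contractions.\<close>
      have abel: "(\<Sum>p<n. c p *\<^sub>R Y p) = c 0 *\<^sub>R b 0 - c n *\<^sub>R b n + (\<Sum>p<n. (c (Suc p) - c p) *\<^sub>R b (Suc p))" for n
        by (induction n) (simp_all add: Y_def algebra_simps)
      have "norm ((c (Suc p) - c p) *\<^sub>R b (Suc p)) \<le> \<delta>" for p
        using mult_mono[OF \<theta>_lip[of "- int (Suc p) - 1" "- int p - 1"] norm_b[of "Suc p"]] \<open>\<delta> > 0\<close>
        by (simp add: c_def)
      then have "norm (\<Sum>p<M. (c (Suc p) - c p) *\<^sub>R b (Suc p)) \<le> real M * \<delta>"
        using sum_norm_bound[of "{..<M}" "\<lambda>p. (c (Suc p) - c p) *\<^sub>R b (Suc p)" \<delta>] by simp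
      moreover have "norm (c n *\<^sub>R b n) \<le> 1" for n
        using mult_mono[OF \<theta>_le norm_b[of n]] by (simp add: c_def)
      from this[of 0] this[of M] have "norm (c 0 *\<^sub>R b 0 - c M *\<^sub>R b M) \<le> 2"
        using norm_triangle_ineq4[of "c 0 *\<^sub>R b 0" "c M *\<^sub>R b M"] by linarith
      ultimately have "norm (\<Sum>p<M. c p *\<^sub>R Y p) \<le> 2 + real M * \<delta>"
        unfolding abel by (intro norm_triangle_le add_mono)
      moreover have "norm e \<le> \<epsilon>" using far by (simp add: e_def)
      moreover have "\<epsilon> \<ge> 0" using far norm_ge_zero order.trans by blast
      ultimately show ?thesis by (intro order.trans[OF norm_mult_ineq] mult_mono) auto
    qed
    have "norm (y - z) \<le> norm (\<Sum>p<M. v (int p) * Y p) + norm (\<Sum>p<M. E p * Y p) + norm (e * (\<Sum>p<M. c p *\<^sub>R Y p))"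
      unfolding yz using norm_triangle_ineq4 norm_triangle_ineq by (smt (verit))
    then show ?thesis using 1 2 3 by (simp add: algebra_simps)
  qed
  ultimately show ?thesis unfolding y_def by blast
qed

end

section \<open>Fejer kernels\<close>

text \<open>The range |v| \<le> 2 fits half-distances (r - a) / 2 with |r| \<le> pi and |a| \<le> 4
  - pi, the condition on evaluation points below.\<close>

lemma abs_sin_ge: fixes v :: real assumes "\<bar>v\<bar> \<le> 2" shows "\<bar>v\<bar> / 3 \<le> \<bar>sin v\<bar>"
proof -
  have "\<bar>sin v - (\<Sum>m<3. sin_coeff m * v ^ m)\<bar> \<le> inverse (fact 3) * \<bar>v\<bar> ^ 3"
    by (rule Maclaurin_sin_bound)
  then have "\<bar>sin v - v\<bar> \<le> \<bar>v\<bar> ^ 3 / 6"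
    by (simp add: numeral_eq_Suc sin_coeff_def fact_numeral)
  moreover have "\<bar>v\<bar> * \<bar>v\<bar>\<^sup>2 \<le> \<bar>v\<bar> * 2\<^sup>2" using assms by (intro mult_left_mono power_mono) auto
  then have "\<bar>v\<bar> ^ 3 / 6 \<le> 2 / 3 * \<bar>v\<bar>" by (simp add: power3_eq_cube power2_eq_square)
  ultimately show ?thesis by linarith
qed

lemma sin_squared_ge: fixes v :: real assumes "\<bar>v\<bar> \<le> 2" shows "v\<^sup>2 / 9 \<le> (sin v)\<^sup>2"
  using power_mono[OF abs_sin_ge[OF assms], of 2] by (simp add: power_divide)

lemma sin_nonzero: fixes v :: real assumes "\<bar>v\<bar> \<le> 2" "v \<noteq> 0" shows "sin v \<noteq> 0"
  using abs_sin_ge[OF assms(1)] assms(2) by auto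

lemma square_minus_sin_squared_le: fixes v :: real assumes "\<bar>v\<bar> \<le> 2" shows "v\<^sup>2 - (sin v)\<^sup>2 \<le> v ^ 4 / 3"
proof -
  have "\<bar>sin v - (\<Sum>m<3. sin_coeff m * v ^ m)\<bar> \<le> inverse (fact 3) * \<bar>v\<bar> ^ 3"
    by (rule Maclaurin_sin_bound)
  then have *: "\<bar>sin v - v\<bar> \<le> \<bar>v\<bar> ^ 3 / 6"
    by (simp add: numeral_eq_Suc sin_coeff_def fact_numeral)
  have "v\<^sup>2 - (sin v)\<^sup>2 = (v - sin v) * (v + sin v)" by (simp add: power2_eq_square algebra_simps)
  also have "\<dots> \<le> \<bar>v - sin v\<bar> * \<bar>v + sin v\<bar>" by (metis abs_ge_self abs_mult)
  also have "\<dots> \<le> (\<bar>v\<bar> ^ 3 / 6) * (2 * \<bar>v\<bar>)"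
    using * abs_sin_x_le_abs_x[of v] by (intro mult_mono) (auto simp: abs_minus_commute)
  also have "\<dots> = v ^ 4 / 3" by (simp add: power_abs[symmetric] power3_eq_cube power4_eq_xxxx abs_mult)
  finally show ?thesis .
qed

section \<open>The squared sinc kernel on the line and its translates\<close>

lemma integrable_inverse_one_plus_square: "(\<lambda>r::real. 1 / (1 + r\<^sup>2)) integrable_on UNIV"
proof -
  have pos: "1 + r\<^sup>2 > 0" for r :: real by (simp add: add_pos_nonneg)
  have int: "((\<lambda>r. 1 / (1 + r\<^sup>2)) has_integral (arctan (real k) - arctan (- real k))) {- real k..real k}" for k
    by (rule fundamental_theorem_of_calculus)
      (auto intro!: derivative_eq_intros simp: has_real_derivative_iff_has_vector_derivative[symmetric] inverse_eq_divide)
  define f where "f k r = (if r \<in> {- real k..real k} then 1 / (1 + r\<^sup>2) else 0)" for k r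
  have f_int: "(f k has_integral (arctan (real k) - arctan (- real k))) UNIV" for k
    using int[of k] unfolding f_def by (simp only: has_integral_restrict_UNIV)
  have "(\<lambda>r::real. 1 / (1 + r\<^sup>2)) integrable_on UNIV \<and>
      (\<lambda>k. integral UNIV (f k)) \<longlonglongrightarrow> integral UNIV (\<lambda>r. 1 / (1 + r\<^sup>2))"
  proof (rule monotone_convergence_increasing)
    show "f k integrable_on UNIV" for k using f_int by blast
    show "f k r \<le> f (Suc k) r" for k r using pos[of r] by (auto simp: f_def)
    show "(\<lambda>k. f k r) \<longlonglongrightarrow> 1 / (1 + r\<^sup>2)" for r
    proof (rule tendsto_eventually)
      obtain m :: nat where "\<bar>r\<bar> \<le> real m" using real_arch_simple by blast
      then show "\<forall>\<^sub>F k in sequentially. f k r = 1 / (1 + r\<^sup>2)"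
        unfolding eventually_sequentially by (intro exI[of _ m]) (auto simp: f_def)
    qed
    have "\<bar>arctan (real k) - arctan (- real k)\<bar> \<le> pi" for k
      using arctan_lbound[of "real k"] arctan_ubound[of "real k"] by (simp add: arctan_minus)
    then show "bounded (range (\<lambda>k. integral UNIV (f k)))"
      by (intro boundedI[of _ pi]) (auto simp: integral_unique[OF f_int])
  qed
  then show ?thesis by blast
qed

text \<open>The Fourier transform is 2 pi times the triangle on [-1, 1], and the translates by
  multiples of 2 pi add up to 1. The first property localizes the pieces, the second makes them sum
  back to the orbit near time 0.\<close>

definition sinc2 :: "real \<Rightarrow> real" where
  "sinc2 r = (if r = 0 then 1 else (sin (r / 2) / (r / 2))\<^sup>2)"

lemma sinc2_mult: "sinc2 r * (r / 2)\<^sup>2 = (sin (r / 2))\<^sup>2"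
  by (simp add: sinc2_def power_divide)

lemma sinc2_nonneg: "0 \<le> sinc2 r"
  by (simp add: sinc2_def)

lemma sinc2_le_one: "sinc2 r \<le> 1"
proof -
  have "\<bar>sin (r / 2) / (r / 2)\<bar> \<le> 1"
    using abs_sin_x_le_abs_x[of "r / 2"] by (simp add: abs_divide abs_mult divide_le_eq)
  then have "(sin (r / 2) / (r / 2))\<^sup>2 \<le> 1" by (simp add: abs_square_le_1)
  then show ?thesis by (auto simp: sinc2_def)
qed

lemma sinc2_le: "sinc2 r \<le> 5 / (1 + r\<^sup>2)"
proof -
  have "sinc2 r * r\<^sup>2 = 4 * (sin (r / 2))\<^sup>2" using sinc2_mult[of r] by (simp add: power_divide)
  also have "\<dots> \<le> 4" by (simp add: abs_square_le_1)
  finally have "sinc2 r * (1 + r\<^sup>2) \<le> 5" using sinc2_le_one[of r] by (simp add: algebra_simps)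
  then show ?thesis by (simp add: pos_le_divide_eq add_pos_nonneg)
qed

lemma continuous_on_sinc2: "continuous_on A sinc2"
proof -
  have "isCont sinc2 r" for r
  proof (cases "r = 0")
    case True
    have "((\<lambda>h. (sin (0 + h) - sin 0) / h) \<longlongrightarrow> cos 0) (at (0::real))"
      using DERIV_sin[of "0::real"] by (simp only: DERIV_def)
    then have "((\<lambda>h. sin h / h) \<longlongrightarrow> 1) (at (0::real))" by simp
    moreover have "filterlim (\<lambda>r::real. r / 2) (at 0) (at 0)"
      by (auto intro!: filterlim_atI tendsto_eq_intros eventually_at_ball'[THEN eventually_mono, of 1] simp: eventually_at_filter)
    ultimately have "((\<lambda>r. sin (r / 2) / (r / 2)) \<longlongrightarrow> 1) (at (0::real))"
      by (rule filterlim_compose)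
    then have "((\<lambda>r. (sin (r / 2) / (r / 2))\<^sup>2) \<longlongrightarrow> 1\<^sup>2) (at (0::real))"
      by (intro tendsto_intros)
    then have "(sinc2 \<longlongrightarrow> 1\<^sup>2) (at 0)"
      by (rule Lim_transform_eventually) (auto simp: sinc2_def eventually_at_filter)
    then show ?thesis using True by (simp add: isCont_def sinc2_def)
  next
    case False
    have "isCont (\<lambda>r. (sin (r / 2) / (r / 2))\<^sup>2) r"
      using False by (intro continuous_intros) auto
    moreover have "\<forall>\<^sub>F s in nhds r. sinc2 s = (sin (s / 2) / (s / 2))\<^sup>2"
      using t1_space_nhds[OF False] by (auto elim!: eventually_mono simp: sinc2_def)
    ultimately show ?thesis by (simp add: isCont_cong)
  qed
  then show ?thesis by (simp add: continuous_at_imp_continuous_on)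
qed

text \<open>With v = r / 2, the difference v^2 - sin^2 v is at most v^4 / 3, so 1 -
  \<open>sinc2 r\<close> is at most v^2 / 3; then v^2 \<le> 9 sin^2 v.\<close>

lemma one_minus_sinc2_le: assumes "\<bar>r\<bar> \<le> 4" shows "1 - sinc2 r \<le> 3 * (sin (r / 2))\<^sup>2"
proof (cases "r = 0")
  case False
  define v where "v = r / 2"
  have v: "\<bar>v\<bar> \<le> 2" "v \<noteq> 0" using assms False by (auto simp: v_def)
  have "(1 - sinc2 r) * v\<^sup>2 = v\<^sup>2 - (sin v)\<^sup>2" using sinc2_mult[of r] by (simp add: v_def algebra_simps)
  also have "\<dots> \<le> v\<^sup>2 / 3 * v\<^sup>2"
    using square_minus_sin_squared_le[OF v(1)] by (simp add: power4_eq_xxxx power2_eq_square)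
  finally have "1 - sinc2 r \<le> v\<^sup>2 / 3" using v(2)
    by (subst (asm) mult_le_cancel_right_pos) auto
  also have "\<dots> \<le> 3 * (sin v)\<^sup>2" using sin_squared_ge[OF v(1)] by simp
  finally show ?thesis by (simp add: v_def)
qed (simp add: sinc2_def)

lemma sum_inverse_squares_le: "(\<Sum>l\<in>{- int S..int S} - {0}. 1 / (real_of_int l)\<^sup>2) \<le> 4"
proof -
  \<comment> \<open>Strengthened so that the induction telescopes: 2 / (k + 1)^2 is at most 2 / k -
    2 / (k + 1).\<close>
  have "(\<Sum>l\<in>{- int (Suc S)..int (Suc S)} - {0}. 1 / (real_of_int l)\<^sup>2) \<le> 4 - 2 / real (Suc S)" for S
  proof (induction S)
    case 0
    have "{- int (Suc 0)..int (Suc 0)} - {0} = {-1, 1}" by auto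
    then show ?case by simp
  next
    case (Suc S)
    let ?k = "real (Suc S)"
    have "{- int (Suc (Suc S))..int (Suc (Suc S))} - {0}
        = insert (- int (Suc (Suc S))) (insert (int (Suc (Suc S))) ({- int (Suc S)..int (Suc S)} - {0}))" by auto
    then have "(\<Sum>l\<in>{- int (Suc (Suc S))..int (Suc (Suc S))} - {0}. 1 / (real_of_int l)\<^sup>2)
        = 2 / (?k + 1)\<^sup>2 + (\<Sum>l\<in>{- int (Suc S)..int (Suc S)} - {0}. 1 / (real_of_int l)\<^sup>2)"
      by (simp add: power2_minus algebra_simps) (simp add: power2_eq_square algebra_simps)
    also have "\<dots> \<le> 2 / (?k + 1)\<^sup>2 + (4 - 2 / ?k)" using Suc by simp
    also have "2 / (?k + 1)\<^sup>2 \<le> 2 / (?k * (?k + 1))"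
      by (intro divide_left_mono) (auto simp: power2_eq_square)
    also have "\<dots> = 2 / ?k - 2 / (?k + 1)" by (simp add: field_simps)
    finally show ?case by simp
  qed
  from this[of "S - 1"] show ?thesis by (cases S) (auto intro: order.trans)
qed

text \<open>All translates share the numerator sin^2 (r / 2), and |r / 2 + pi l| is at least |l|.
  Keeping the numerator shows that the sum vanishes at r = 0.\<close>

lemma sum_sinc2_translates_le:
  assumes "\<bar>r\<bar> \<le> pi"
  shows "(\<Sum>l\<in>{- int S..int S} - {0}. sinc2 (r + 2 * pi * of_int l)) \<le> 4 * (sin (r / 2))\<^sup>2"
proof -
  have "sinc2 (r + 2 * pi * of_int l) \<le> (sin (r / 2))\<^sup>2 * (1 / (real_of_int l)\<^sup>2)" if "l \<noteq> 0" for l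
  proof -
    let ?v = "r / 2 + pi * of_int l"
    have "sinc2 (r + 2 * pi * of_int l) * ?v\<^sup>2 = (sin ?v)\<^sup>2"
      using sinc2_mult[of "r + 2 * pi * of_int l"] by (simp add: add_divide_distrib)
    also have "\<dots> = (sin (r / 2))\<^sup>2"
      by (simp add: sin_add power_mult_distrib cos_npi_int sin_npi_int)
    finally have *: "sinc2 (r + 2 * pi * of_int l) * ?v\<^sup>2 = (sin (r / 2))\<^sup>2" .
    have "1 \<le> \<bar>real_of_int l\<bar>" using that by linarith
    then have "(pi - 1) * 1 \<le> (pi - 1) * \<bar>real_of_int l\<bar>" using pi_ge_two by (intro mult_left_mono) auto
    moreover have "\<bar>pi * real_of_int l\<bar> = pi * \<bar>real_of_int l\<bar>" by (simp add: abs_mult)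
    ultimately have "\<bar>real_of_int l\<bar> \<le> \<bar>?v\<bar>" using assms pi_ge_two by (simp add: algebra_simps)
    then have "(real_of_int l)\<^sup>2 \<le> ?v\<^sup>2" by (simp add: abs_le_square_iff)
    then have "sinc2 (r + 2 * pi * of_int l) * (real_of_int l)\<^sup>2 \<le> (sin (r / 2))\<^sup>2"
      using sinc2_nonneg by (subst *[symmetric]) (rule mult_left_mono)
    then show ?thesis using that by (simp add: field_simps)
  qed
  then have "(\<Sum>l\<in>{- int S..int S} - {0}. sinc2 (r + 2 * pi * of_int l))
      \<le> (sin (r / 2))\<^sup>2 * (\<Sum>l\<in>{- int S..int S} - {0}. 1 / (real_of_int l)\<^sup>2)"
    unfolding sum_distrib_left by (intro sum_mono) auto
  also have "\<dots> \<le> (sin (r / 2))\<^sup>2 * 4" by (intro mult_left_mono sum_inverse_squares_le) auto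
  finally show ?thesis by simp
qed

section \<open>Fejer kernels on the circle and their rescaled limit\<close>

definition triangle :: "nat \<Rightarrow> int \<Rightarrow> real" where
  "triangle N n = max 0 (1 - \<bar>of_int n\<bar> / real N)"

definition fejer :: "nat \<Rightarrow> real \<Rightarrow> real" where
  "fejer N r = (cmod (\<Sum>n<N. cis (real n * r)))\<^sup>2 / real N"

lemma fejer_nonneg: "0 \<le> fejer N r"
  by (simp add: fejer_def)

lemma continuous_on_fejer [continuous_intros]:
  "continuous_on A f \<Longrightarrow> continuous_on A (\<lambda>r. fejer N (f r))"
  unfolding fejer_def divide_inverse by (intro continuous_intros)

lemma fejer_le: "fejer N r \<le> real N"
proof (cases "N = 0")
  case False
  have "cmod (\<Sum>n<N. cis (real n * r)) \<le> real N"
    using sum_norm_bound[of "{..<N}" "\<lambda>n. cis (real n * r)" 1] by simp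
  then have "(cmod (\<Sum>n<N. cis (real n * r)))\<^sup>2 \<le> real N * real N"
    unfolding power2_eq_square by (intro mult_mono) auto
  then show ?thesis using False by (simp add: fejer_def divide_le_eq)
qed (simp add: fejer_def)

lemma fejer_mult_sin: "fejer N r * (sin (r / 2))\<^sup>2 = (sin (real N * r / 2))\<^sup>2 / real N"
proof -
  have norm: "(cmod (cis t - 1))\<^sup>2 = 4 * (sin (t / 2))\<^sup>2" for t
  proof -
    have "(cmod (cis t - 1))\<^sup>2 = (cos t)\<^sup>2 + (sin t)\<^sup>2 + 1 - 2 * cos t"
      by (simp add: cmod_power2 power2_diff)
    also have "\<dots> = 2 - 2 * cos (2 * (t / 2))" by simp
    also have "\<dots> = 4 * (sin (t / 2))\<^sup>2" by (subst cos_double_sin) simp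
    finally show ?thesis .
  qed
  have "(cis r - 1) * (\<Sum>n<N. cis (real n * r)) = cis (real N * r) - 1"
    using power_diff_1_eq[of "cis r" N] by (simp add: Complex.DeMoivre[of r])
  then have "(cmod (cis r - 1))\<^sup>2 * (cmod (\<Sum>n<N. cis (real n * r)))\<^sup>2 = (cmod (cis (real N * r) - 1))\<^sup>2"
    by (metis norm_mult power_mult_distrib)
  then show ?thesis unfolding norm fejer_def by (simp add: mult.commute)
qed

lemma sum_differences:
  fixes f :: "int \<Rightarrow> complex"
  shows "(\<Sum>m<N. \<Sum>n<N. f (int m - int n)) = (\<Sum>d\<in>{- int N..int N}. of_real (real N - \<bar>of_int d\<bar>) * f d)"
proof (induction N)
  case (Suc N)
  have "(\<Sum>m<Suc N. \<Sum>n<Suc N. f (int m - int n))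
      = (\<Sum>m<N. \<Sum>n<N. f (int m - int n)) + (\<Sum>m<N. f (int m - int N)) + (\<Sum>n<N. f (int N - int n)) + f 0"
    by (simp add: sum.distrib)
  also have "(\<Sum>m<N. f (int m - int N)) = (\<Sum>d\<in>{- int N..-1}. f d)"
    by (rule sum.reindex_bij_witness[of _ "\<lambda>d. nat (d + int N)" "\<lambda>m. int m - int N"]) auto
  also have "(\<Sum>n<N. f (int N - int n)) = (\<Sum>d\<in>{1..int N}. f d)"
    by (rule sum.reindex_bij_witness[of _ "\<lambda>d. nat (int N - d)" "\<lambda>m. int N - int m"]) auto
  finally have 1: "(\<Sum>m<Suc N. \<Sum>n<Suc N. f (int m - int n)) = (\<Sum>m<N. \<Sum>n<N. f (int m - int n))
      + ((\<Sum>d\<in>{- int N..-1}. f d) + f 0 + (\<Sum>d\<in>{1..int N}. f d))" by simp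
  have "{- int N..int N} = {- int N..-1} \<union> ({0} \<union> {1..int N})" by auto
  then have 2: "(\<Sum>d\<in>{- int N..int N}. f d) = (\<Sum>d\<in>{- int N..-1}. f d) + f 0 + (\<Sum>d\<in>{1..int N}. f d)"
    by (simp only:) (subst sum.union_disjoint, auto)+
  have "(\<Sum>d\<in>{- int (Suc N)..int (Suc N)}. of_real (real (Suc N) - \<bar>of_int d\<bar>) * f d)
      = (\<Sum>d\<in>{- int N..int N}. of_real (real (Suc N) - \<bar>of_int d\<bar>) * f d)"
  proof (rule sum.mono_neutral_right)
    show "\<forall>d\<in>{- int (Suc N)..int (Suc N)} - {- int N..int N}. complex_of_real (real (Suc N) - \<bar>of_int d\<bar>) * f d = 0"
    proof
      fix d assume "d \<in> {- int (Suc N)..int (Suc N)} - {- int N..int N}"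
      then have "d = - int (Suc N) \<or> d = int (Suc N)" by auto
      then show "complex_of_real (real (Suc N) - \<bar>of_int d\<bar>) * f d = 0" by auto
    qed
  qed auto
  also have "\<dots> = (\<Sum>d\<in>{- int N..int N}. of_real (real N - \<bar>of_int d\<bar>) * f d + f d)"
    by (intro sum.cong) (auto simp: algebra_simps)
  finally show ?case using 1 2 Suc by (simp add: sum.distrib)
qed simp

lemma fejer_eq_sum:
  assumes "N > 0"
  shows "complex_of_real (fejer N r) = (\<Sum>n\<in>{- int N..int N}. of_real (triangle N n) * cis (of_int n * r))"
proof -
  have "complex_of_real ((cmod (\<Sum>n<N. cis (real n * r)))\<^sup>2)
      = (\<Sum>n<N. cis (real n * r)) * cnj (\<Sum>n<N. cis (real n * r))"
    by (rule complex_norm_square)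
  also have "\<dots> = (\<Sum>m<N. \<Sum>n<N. cis (of_int (int m - int n) * r))"
    by (simp add: sum_product cis_cnj cis_mult algebra_simps)
  also have "\<dots> = (\<Sum>d\<in>{- int N..int N}. of_real (real N - \<bar>of_int d\<bar>) * cis (of_int d * r))"
    by (rule sum_differences)
  finally have "complex_of_real (fejer N r) = (\<Sum>d\<in>{- int N..int N}. of_real (real N - \<bar>of_int d\<bar>) * cis (of_int d * r)) / of_nat N"
    by (simp add: fejer_def)
  also have "\<dots> = (\<Sum>n\<in>{- int N..int N}. of_real (triangle N n) * cis (of_int n * r))"
    unfolding sum_divide_distrib
  proof (rule sum.cong)
    fix d assume "d \<in> {- int N..int N}"
    then have "\<bar>real_of_int d\<bar> \<le> real N" by auto
    then have "triangle N d = (real N - \<bar>of_int d\<bar>) / real N"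
      using assms by (simp add: triangle_def field_simps)
    then show "complex_of_real (real N - \<bar>of_int d\<bar>) * cis (of_int d * r) / of_nat N = of_real (triangle N d) * cis (of_int d * r)"
      by simp
  qed simp
  finally show ?thesis .
qed

lemma has_integral_cis_period:
  assumes "P > 0"
  shows "((\<lambda>r. cis (of_int n * ((r - \<tau>) / P))) has_integral (if n = 0 then of_real (2 * pi * P) else 0)) {- (pi * P)..pi * P}"
proof (cases "n = 0")
  case True
  then show ?thesis using has_integral_const_real[of "1::complex" "- (pi * P)" "pi * P"] assms
    by (simp add: scaleR_conv_of_real mult_ac)
next
  case False
  define c where "c = \<i> * of_int n / complex_of_real P"
  have c: "c \<noteq> 0" using False assms by (simp add: c_def)
  have cis: "cis (of_int n * ((r - \<tau>) / P)) = exp (c * of_real (r - \<tau>))" for r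
    by (simp add: cis_conv_exp c_def mult_ac)
  define F where "F r = exp (c * (of_real r - of_real \<tau>)) / c" for r :: real
  have "((\<lambda>r. cis (of_int n * ((r - \<tau>) / P))) has_integral (F (pi * P) - F (- (pi * P)))) {- (pi * P)..pi * P}"
  proof (rule fundamental_theorem_of_calculus)
    show "- (pi * P) \<le> pi * P" using assms by simp
    fix r
    have "((\<lambda>z. exp (c * (z - of_real \<tau>)) / c) has_field_derivative exp (c * of_real (r - \<tau>))) (at (of_real r))"
      using c by (auto intro!: derivative_eq_intros)
    then show "(F has_vector_derivative cis (of_int n * ((r - \<tau>) / P))) (at r within {- (pi * P)..pi * P})"
      unfolding F_def cis by (rule has_vector_derivative_real_field)
  qed
  moreover have "F (pi * P) - F (- (pi * P)) = 0"
  proof -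
    have "c * (of_real (pi * P) - of_real \<tau>) = c * (of_real (- (pi * P)) - of_real \<tau>) + \<i> * (of_int n * (of_real pi * 2))"
      using assms by (simp add: c_def field_simps)
    then have "exp (c * (of_real (pi * P) - of_real \<tau>)) = exp (c * (of_real (- (pi * P)) - of_real \<tau>))"
      by (simp only: exp_plus_2pin)
    then show ?thesis by (simp add: F_def)
  qed
  ultimately show ?thesis using False by simp
qed

lemma has_integral_fejer:
  assumes "N > 0" "P > 0"
  shows "((\<lambda>r. fejer N ((r - \<tau>) / P)) has_integral (2 * pi * P)) {- (pi * P)..pi * P}"
proof -
  have "((\<lambda>r. \<Sum>n\<in>{- int N..int N}. of_real (triangle N n) * cis (of_int n * ((r - \<tau>) / P))) has_integral
      (\<Sum>n\<in>{- int N..int N}. of_real (triangle N n) * (if n = 0 then of_real (2 * pi * P) else 0))) {- (pi * P)..pi * P}"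
    using assms by (intro has_integral_sum has_integral_mult_right has_integral_cis_period) auto
  also have "(\<Sum>n\<in>{- int N..int N}. of_real (triangle N n) * (if n = 0 then of_real (2 * pi * P) else 0)) = complex_of_real (2 * pi * P)"
    by (simp add: if_distrib[of "(*) _"] sum.delta triangle_def cong: if_cong)
  finally have "((\<lambda>r. complex_of_real (fejer N ((r - \<tau>) / P))) has_integral complex_of_real (2 * pi * P)) {- (pi * P)..pi * P}"
    using assms by (simp only: fejer_eq_sum)
  from has_integral_linear[OF this bounded_linear_Re] show ?thesis by (simp add: o_def)
qed

text \<open>Decay from the sine bound, w r^2 \<le> 4 * 9, together with w \<le> 1 gives 37; this
  serves as a majorant uniform in Q.\<close>

lemma scaled_fejer_le:
  assumes "Q > 0" "\<bar>r\<bar> \<le> 4 * real Q"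
  shows "fejer Q (r / real Q) / real Q \<le> 37 / (1 + r\<^sup>2)"
proof -
  let ?w = "fejer Q (r / real Q) / real Q"
  have w0: "0 \<le> ?w" by (simp add: fejer_nonneg)
  have "\<bar>r / (2 * real Q)\<bar> \<le> 2" using assms by (simp add: abs_divide field_simps)
  then have "(r / (2 * real Q))\<^sup>2 / 9 \<le> (sin (r / (2 * real Q)))\<^sup>2" by (rule sin_squared_ge)
  then have "?w * ((r / (2 * real Q))\<^sup>2 / 9) \<le> ?w * (sin (r / (2 * real Q)))\<^sup>2"
    using w0 by (rule mult_left_mono)
  also have "\<dots> = (sin (r / 2))\<^sup>2 / (real Q)\<^sup>2"
    using fejer_mult_sin[of Q "r / real Q"] assms(1) by (simp add: power2_eq_square mult.commute)
  also have "\<dots> \<le> 1 / (real Q)\<^sup>2" by (intro divide_right_mono) (auto simp: abs_square_le_1)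
  finally have "?w * r\<^sup>2 \<le> 36" using assms(1) by (simp add: power_divide power_mult_distrib field_simps)
  moreover have "?w \<le> 1" using fejer_le[of Q] assms(1) by (simp add: divide_le_eq)
  ultimately have "?w * (1 + r\<^sup>2) \<le> 37" unfolding distrib_left by linarith
  then show ?thesis by (simp only: pos_le_divide_eq add_pos_nonneg zero_less_one zero_le_power2)
qed

text \<open>The approximating kernels are trigonometric polynomials with frequencies j / Q in
  [-1, 1]; through them the band limitation of \<open>sinc2\<close> becomes visible without Fourier
  inversion.\<close>

lemma scaled_fejer_tendsto: "(\<lambda>Q. fejer (Suc Q) (r / real (Suc Q)) / real (Suc Q)) \<longlonglongrightarrow> sinc2 r"
proof (cases "r = 0")
  case True
  have "fejer (Suc Q) (0 / real (Suc Q)) / real (Suc Q) = 1" for Q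
    by (simp add: fejer_def power2_eq_square del: of_nat_Suc)
  then show ?thesis unfolding True by (simp only: sinc2_def simp_thms if_True tendsto_const)
next
  case False
  have "(\<lambda>Q. real (Suc Q) * sin (r / 2 / real (Suc Q))) \<longlonglongrightarrow> r / 2"
    by real_asymp
  then have lim: "(\<lambda>Q. (sin (r / 2))\<^sup>2 / (real (Suc Q) * sin (r / 2 / real (Suc Q)))\<^sup>2) \<longlonglongrightarrow> (sin (r / 2))\<^sup>2 / (r / 2)\<^sup>2"
    using False by (intro tendsto_intros) auto
  have eq: "(sin (r / 2))\<^sup>2 / (r / 2)\<^sup>2 = sinc2 r" using False by (simp add: sinc2_def power_divide)
  have ev: "\<forall>\<^sub>F Q in sequentially. (sin (r / 2))\<^sup>2 / (real (Suc Q) * sin (r / 2 / real (Suc Q)))\<^sup>2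
      = fejer (Suc Q) (r / real (Suc Q)) / real (Suc Q)"
  proof -
    obtain m :: nat where m: "\<bar>r\<bar> \<le> real m" using real_arch_simple by blast
    show ?thesis unfolding eventually_sequentially
    proof (intro exI[of _ m] allI impI)
      fix Q assume "m \<le> Q"
      let ?Q = "real (Suc Q)" and ?s = "sin (r / 2 / real (Suc Q))"
      have "\<bar>r / 2 / ?Q\<bar> \<le> 2" using m \<open>m \<le> Q\<close> by (simp add: abs_divide divide_le_eq)
      moreover have "r / 2 / ?Q \<noteq> 0" using False by (simp del: of_nat_Suc)
      ultimately have s: "?s \<noteq> 0" by (rule sin_nonzero)
      have "fejer (Suc Q) (r / ?Q) * ?s\<^sup>2 = (sin (r / 2))\<^sup>2 / ?Q"
        using fejer_mult_sin[of "Suc Q" "r / ?Q"] by (simp add: mult.commute del: of_nat_Suc)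
      then have "fejer (Suc Q) (r / ?Q) = (sin (r / 2))\<^sup>2 / ?Q / ?s\<^sup>2" using s by (simp add: field_simps del: of_nat_Suc)
      then show "(sin (r / 2))\<^sup>2 / (?Q * ?s)\<^sup>2 = fejer (Suc Q) (r / ?Q) / ?Q"
        by (simp add: power_mult_distrib power2_eq_square del: of_nat_Suc)
    qed
  qed
  show ?thesis by (rule Lim_transform_eventually[OF lim[unfolded eq] ev])
qed

section \<open>Analytic elements\<close>

text \<open>Finite sums of exponentials with frequencies at least p. Building them up one term at a
  time reduces the closure under products to two short inductions.\<close>

inductive trig :: "real \<Rightarrow> (real \<Rightarrow> 'a::cstar_algebra) \<Rightarrow> bool" for p where
  zero: "trig p (\<lambda>t. 0)"
| add: "p \<le> g \<Longrightarrow> trig p f \<Longrightarrow> trig p (\<lambda>t. f t + cis (g * t) *\<^sub>C z)"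

lemma trig_add: "trig p f \<Longrightarrow> trig p f' \<Longrightarrow> trig p (\<lambda>t. f' t + f t)"
proof (induction rule: trig.induct)
  case (add g f z)
  then show ?case using trig.add[OF \<open>p \<le> g\<close> add.IH[OF add.prems], of z] by (simp add: add.assoc)
qed simp

lemma trig_single: "p \<le> g \<Longrightarrow> trig p (\<lambda>t. cis (g * t) *\<^sub>C z)"
  using trig.add[OF _ trig.zero, of p g z] by simp

lemma trig_sum: "(\<And>j. j \<in> I \<Longrightarrow> trig p (f j)) \<Longrightarrow> trig p (\<lambda>t. \<Sum>j\<in>I. f j t)"
  by (induction I rule: infinite_finite_induct) (auto intro: trig.zero trig_add)

lemma trig_scaleC: "trig p f \<Longrightarrow> trig p (\<lambda>t. c *\<^sub>C f t)"
proof (induction rule: trig.induct)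
  case (add g f z)
  then show ?case using trig.add[OF \<open>p \<le> g\<close> add.IH, of "c *\<^sub>C z"]
    by (simp add: scaleC_add_right scaleC_scaleC mult.commute)
qed (simp add: trig.zero scaleC.zero_right)

lemma trig_single_mult: "trig q f \<Longrightarrow> p \<le> g \<Longrightarrow> trig (p + q) (\<lambda>t. (cis (g * t) *\<^sub>C z) * f t)"
proof (induction rule: trig.induct)
  case (add h f w)
  have "trig (p + q) (\<lambda>t. (cis (g * t) *\<^sub>C z) * f t + cis ((g + h) * t) *\<^sub>C (z * w))"
    using add by (intro trig.add) auto
  then show ?case
    by (simp add: distrib_left distrib_right mult_scaleC_left mult_scaleC_right scaleC_scaleC
        mult.commute[of "cis _" "cis _"] flip: cis_mult)
qed (simp add: trig.zero)

lemma trig_mult: "trig p f \<Longrightarrow> trig q h \<Longrightarrow> trig (p + q) (\<lambda>t. f t * h t)"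
proof (induction rule: trig.induct)
  case (add g f z)
  have "trig (p + q) (\<lambda>t. f t * h t + (cis (g * t) *\<^sub>C z) * h t)"
    using add by (intro trig_add trig_single_mult) auto
  then show ?case by (simp add: distrib_right)
qed (simp add: trig.zero)

lemma trig_antimono: "trig q f \<Longrightarrow> p \<le> q \<Longrightarrow> trig p f"
  by (induction rule: trig.induct) (auto intro: trig.intros)

lemma trig_rescale: "trig p f \<Longrightarrow> J > 0 \<Longrightarrow> trig (p / J) (\<lambda>t. f (t / J))"
proof (induction rule: trig.induct)
  case (add g f z)
  have "trig (p / J) (\<lambda>t. f (t / J) + cis ((g / J) * t) *\<^sub>C z)"
    using add by (intro trig.add) (auto simp: divide_right_mono)
  then show ?case by simp
qed (simp add: trig.zero)

lemma continuous_on_trig: "trig p f \<Longrightarrow> continuous_on A f"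
proof (induction rule: trig.induct)
  case (add g f z)
  have "continuous_on A (\<lambda>t. cis (g * t))" by (intro continuous_intros)
  then show ?case using add by (intro continuous_on_add scaleC.continuous_on continuous_on_const) auto
qed simp

text \<open>Integrating h against cis (g t) gives \<open>fourier h g\<close>, so with this sign
  convention the exponential carries the frequency +g.\<close>

lemma trig_has_integral_zero:
  assumes "trig p f" "integrable lborel h" "\<And>\<xi>. p \<le> \<xi> \<Longrightarrow> fourier h \<xi> = 0"
  shows "((\<lambda>t. h t *\<^sub>C f t) has_integral 0) UNIV"
  using assms(1)
proof (induction rule: trig.induct)
  case zero then show ?case by (simp add: scaleC.zero_right)
next
  case (add g f z)
  have cis: "cis (g * t) = exp (\<i> * complex_of_real g * complex_of_real t)" for t
    by (simp add: cis_conv_exp mult.assoc)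
  have "integrable lborel (\<lambda>t. h t * cis (g * t))"
  proof (rule Bochner_Integration.integrable_bound[OF assms(2)])
    have "(\<lambda>t. cis (g * t)) \<in> borel_measurable lborel"
      using borel_measurable_continuous_onI[of "\<lambda>t. cis (g * t)"]
      by (simp add: continuous_on_cis continuous_on_mult_left)
    then show "(\<lambda>t. h t * cis (g * t)) \<in> borel_measurable lborel" using assms(2) by auto
  qed (simp add: norm_mult)
  then have "((\<lambda>t. h t * cis (g * t)) has_integral fourier h g) UNIV"
    using has_integral_integral_lborel[of "\<lambda>t. h t * cis (g * t)"] by (simp add: fourier_def cis)
  then have "((\<lambda>t. h t * cis (g * t)) has_integral 0) UNIV" using assms(3) add(1) by simp
  from has_integral_linear[OF this scaleC.bounded_linear_left[of z]]
  have "((\<lambda>t. (h t * cis (g * t)) *\<^sub>C z) has_integral 0) UNIV" by (simp add: o_def scaleC.zero_left)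
  from has_integral_add[OF add.IH this] show ?case
    by (simp add: scaleC_add_right scaleC_scaleC)
qed

text \<open>The orbit of \<open>y\<close> is a boundedly pointwise limit of trigonometric sums with frequencies \<open>\<ge> p\<close>. This is easily
  seen to be multiplicative, and puts the Arveson spectrum of \<open>y\<close> into \<open>[p, \<infinity>)\<close>.\<close>

definition analytic :: "(real \<Rightarrow> 'a::cstar_algebra \<Rightarrow> 'a) \<Rightarrow> real \<Rightarrow> 'a \<Rightarrow> bool" where
  "analytic \<alpha> p y \<longleftrightarrow> (\<exists>A C. (\<forall>m::nat. trig p (A m)) \<and> (\<forall>m t. norm (A m t) \<le> C) \<and>
     (\<forall>t. (\<lambda>m. A m t) \<longlonglongrightarrow> \<alpha> t y))"

lemma analyticI:
  assumes "\<And>m::nat. trig p (A m)" "\<And>m t. norm (A m t) \<le> C" "\<And>t. (\<lambda>m. A m t) \<longlonglongrightarrow> \<alpha> t y"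
  shows "analytic \<alpha> p y"
  unfolding analytic_def using assms by blast

lemma analyticE:
  assumes "analytic \<alpha> p y"
  obtains A :: "nat \<Rightarrow> real \<Rightarrow> 'a::cstar_algebra" and C where "C \<ge> 0"
    "\<And>m. trig p (A m)" "\<And>m t. norm (A m t) \<le> C" "\<And>t. (\<lambda>m. A m t) \<longlonglongrightarrow> \<alpha> t y"
proof -
  obtain A :: "nat \<Rightarrow> real \<Rightarrow> 'a" and C where A: "\<And>m. trig p (A m)" "\<And>m t. norm (A m t) \<le> C" "\<And>t. (\<lambda>m. A m t) \<longlonglongrightarrow> \<alpha> t y"
    using assms unfolding analytic_def by blast
  have "C \<ge> 0" using A(2) norm_ge_zero order.trans by blast
  then show ?thesis using A that by blast
qed

lemma analytic_antimono: "analytic \<alpha> q y \<Longrightarrow> p \<le> q \<Longrightarrow> analytic \<alpha> p y"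
  unfolding analytic_def using trig_antimono by blast

lemma analytic_rescale:
  assumes "analytic (\<lambda>r. \<alpha> (J * r)) p y" "J > 0" shows "analytic \<alpha> (p / J) y"
proof -
  obtain A C where A: "\<And>m. trig p (A m)" "\<And>m t. norm (A m t) \<le> C" "\<And>t. (\<lambda>m. A m t) \<longlonglongrightarrow> \<alpha> (J * t) y"
    using assms(1) by (rule analyticE) blast
  show ?thesis
  proof (rule analyticI)
    show "trig (p / J) (\<lambda>t. A m (t / J))" for m by (rule trig_rescale[OF A(1) assms(2)])
    show "norm (A m (t / J)) \<le> C" for m t by (rule A(2))
    show "(\<lambda>m. A m (t / J)) \<longlonglongrightarrow> \<alpha> t y" for t using A(3)[of "t / J"] assms(2) by simp
  qed
qed

context cstar_dynamical_system
begin

lemma flow_add: "\<alpha> t (x + y) = \<alpha> t x + \<alpha> t y" and flow_mult: "\<alpha> t (x * y) = \<alpha> t x * \<alpha> t y"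
  and flow_adj: "\<alpha> t (adj x) = adj (\<alpha> t x)" and flow_scaleC: "\<alpha> t (c *\<^sub>C x) = c *\<^sub>C \<alpha> t x"
  using star_automorphism[of t] unfolding star_automorphism_def by blast+

lemma flow_flow: "\<alpha> s (\<alpha> t y) = \<alpha> (s + t) y"
  by (simp add: group_add)

lemma norm_flow [simp]: "norm (\<alpha> t y) = norm y"
proof (rule star_automorphism_isometric[OF star_automorphism star_automorphism])
  show "\<alpha> (- t) \<circ> \<alpha> t = id" using group_add[of "- t" t] group_zero by simp
qed

lemma bounded_linear_flow: "bounded_linear (\<alpha> t)"
proof (rule bounded_linear_intro[where K = 1])
  show "\<alpha> t (r *\<^sub>R x) = r *\<^sub>R \<alpha> t x" for r x by (metis flow_scaleC scaleC_of_real)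
qed (simp_all add: flow_add)

lemma continuous_on_flow [continuous_intros]:
  "continuous_on A f \<Longrightarrow> continuous_on A (\<lambda>r. \<alpha> (f r) y)"
  using continuous_on_compose2[OF norm_continuous] by blast

lemma flow_zero: "\<alpha> t 0 = 0"
  by (rule linear_0[OF bounded_linear.linear[OF bounded_linear_flow]])

lemma analytic_zero: "analytic \<alpha> p 0"
  by (rule analyticI[of p "\<lambda>m t. 0" 0]) (auto simp: flow_zero intro: trig.zero)

lemma analytic_add: assumes "analytic \<alpha> p y" "analytic \<alpha> p z" shows "analytic \<alpha> p (y + z)"
proof -
  obtain A C where A: "\<And>m. trig p (A m)" "\<And>m t. norm (A m t) \<le> C" "\<And>t. (\<lambda>m. A m t) \<longlonglongrightarrow> \<alpha> t y"
    using assms(1) by (rule analyticE) blast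
  obtain A' C' where A': "\<And>m. trig p (A' m)" "\<And>m t. norm (A' m t) \<le> C'" "\<And>t. (\<lambda>m. A' m t) \<longlonglongrightarrow> \<alpha> t z"
    using assms(2) by (rule analyticE) blast
  show ?thesis
  proof (rule analyticI)
    show "trig p (\<lambda>t. A m t + A' m t)" for m by (rule trig_add[OF A'(1) A(1)])
    show "norm (A m t + A' m t) \<le> C + C'" for m t by (rule norm_triangle_mono[OF A(2) A'(2)])
    show "(\<lambda>m. A m t + A' m t) \<longlonglongrightarrow> \<alpha> t (y + z)" for t
      unfolding flow_add by (rule tendsto_add[OF A(3) A'(3)])
  qed
qed

lemma analytic_mult: assumes "analytic \<alpha> p y" "analytic \<alpha> q z" shows "analytic \<alpha> (p + q) (y * z)"
proof -
  obtain A C where A: "C \<ge> 0" "\<And>m. trig p (A m)" "\<And>m t. norm (A m t) \<le> C" "\<And>t. (\<lambda>m. A m t) \<longlonglongrightarrow> \<alpha> t y"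
    using assms(1) by (rule analyticE) blast
  obtain A' C' where A': "C' \<ge> 0" "\<And>m. trig q (A' m)" "\<And>m t. norm (A' m t) \<le> C'" "\<And>t. (\<lambda>m. A' m t) \<longlonglongrightarrow> \<alpha> t z"
    using assms(2) by (rule analyticE) blast
  show ?thesis
  proof (rule analyticI)
    show "trig (p + q) (\<lambda>t. A m t * A' m t)" for m by (rule trig_mult[OF A(2) A'(2)])
    show "norm (A m t * A' m t) \<le> C * C'" for m t
      using A A' by (intro order.trans[OF norm_mult_ineq] mult_mono) auto
    show "(\<lambda>m. A m t * A' m t) \<longlonglongrightarrow> \<alpha> t (y * z)" for t
      unfolding flow_mult by (rule tendsto_mult[OF A(4) A'(4)])
  qed
qed

lemma analytic_scaleC: assumes "analytic \<alpha> p y" shows "analytic \<alpha> p (c *\<^sub>C y)"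
proof -
  obtain A C where A: "\<And>m. trig p (A m)" "\<And>m t. norm (A m t) \<le> C" "\<And>t. (\<lambda>m. A m t) \<longlonglongrightarrow> \<alpha> t y"
    using assms(1) by (rule analyticE) blast
  show ?thesis
  proof (rule analyticI)
    show "trig p (\<lambda>t. c *\<^sub>C A m t)" for m by (rule trig_scaleC[OF A(1)])
    show "norm (c *\<^sub>C A m t) \<le> cmod c * C" for m t by (simp add: norm_scaleC mult_left_mono A(2))
    show "(\<lambda>m. c *\<^sub>C A m t) \<longlonglongrightarrow> \<alpha> t (c *\<^sub>C y)" for t
      unfolding flow_scaleC by (rule scaleC.tendsto[OF tendsto_const A(3)])
  qed
qed

lemma smear_analytic_eq_zero:
  assumes "analytic \<alpha> p y" "integrable lborel h" "\<And>\<xi>. p \<le> \<xi> \<Longrightarrow> fourier h \<xi> = 0"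
  shows "smear \<alpha> h y = 0"
\<comment> \<open>If the integrand is not integrable, \<open>integral\<close> has the default value
  0, which is the claim.\<close>
proof (cases "(\<lambda>t. h t *\<^sub>C \<alpha> t y) integrable_on UNIV")
  case True
  obtain A C where A: "\<And>m. trig p (A m)" "\<And>m t. norm (A m t) \<le> C" "\<And>t. (\<lambda>m. A m t) \<longlonglongrightarrow> \<alpha> t y"
    using assms(1) by (rule analyticE) blast
  \<comment> \<open>A scalar majorant of the error, so that real-valued dominated convergence
    settles the limit.\<close>
  define u where "u m t = cmod (h t) * norm (\<alpha> t y - A m t)" for m t
  have [measurable]: "h \<in> borel_measurable borel" using assms(2) by auto
  have [measurable]: "(\<lambda>t. norm (\<alpha> t y - A m t)) \<in> borel_measurable borel" for m
    by (intro borel_measurable_continuous_onI continuous_intros continuous_on_trig[OF A(1)])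
  have bound: "norm (\<alpha> t y - A m t) \<le> norm y + C" for m t
    using norm_triangle_ineq4[of "\<alpha> t y" "A m t"] A(2)[of m t] by simp
  have dom: "integrable lborel (\<lambda>t. cmod (h t) * (norm y + C))"
    using assms(2) by (intro integrable_mult_left integrable_norm) auto
  have conv: "(\<lambda>m. cmod (h t) * norm (\<alpha> t y - A m t)) \<longlonglongrightarrow> 0" for t
  proof -
    have "(\<lambda>m. cmod (h t) * norm (\<alpha> t y - A m t)) \<longlonglongrightarrow> cmod (h t) * norm (\<alpha> t y - \<alpha> t y)"
      by (intro tendsto_intros A(3))
    then show ?thesis by simp
  qed
  have "(\<lambda>m. \<integral>t. u m t \<partial>lborel) \<longlonglongrightarrow> integral\<^sup>L lborel (\<lambda>t::real. 0)"
    by (rule integral_dominated_convergence[where w = "\<lambda>t. cmod (h t) * (norm y + C)"])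
      (use dom in \<open>auto simp: conv u_def[abs_def] intro!: AE_I2 mult_left_mono bound\<close>)
  then have lim: "(\<lambda>m. \<integral>t. u m t \<partial>lborel) \<longlonglongrightarrow> 0" by simp
  have "norm (smear \<alpha> h y) \<le> (\<integral>t. u m t \<partial>lborel)" for m
  proof -
    have zero: "((\<lambda>t. h t *\<^sub>C A m t) has_integral 0) UNIV"
      by (rule trig_has_integral_zero[OF A(1) assms(2,3)])
    have int: "((\<lambda>t. h t *\<^sub>C \<alpha> t y - h t *\<^sub>C A m t) has_integral (smear \<alpha> h y - 0)) UNIV"
      using True unfolding smear_def by (intro has_integral_diff zero) auto
    have "integrable lborel (u m)"
      by (rule Bochner_Integration.integrable_bound[OF dom])
        (auto simp: u_def[abs_def] abs_mult intro!: AE_I2 mult_left_mono order.trans[OF bound])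
    then have "(u m has_integral (\<integral>t. u m t \<partial>lborel)) UNIV" by (rule has_integral_integral_lborel)
    then show ?thesis
      using integral_norm_bound_integral[of "\<lambda>t. h t *\<^sub>C \<alpha> t y - h t *\<^sub>C A m t" UNIV "u m"] int
      by (auto simp: u_def norm_scaleC integral_unique has_integral_integrable simp flip: scaleC.diff_right)
  qed
  then have "norm (smear \<alpha> h y) \<le> 0" using lim by (intro LIMSEQ_le_const) auto
  then show ?thesis by simp
qed (simp add: smear_def not_integrable_integral)

text \<open>A negative \<gamma> is tested with the neighborhood (-infinity, 0): transforms supported
  there vanish on [p, infinity).\<close>

lemma analytic_in_spectral_subspace:
  assumes "analytic \<alpha> p y" "p \<ge> 0" shows "y \<in> spectral_subspace \<alpha> {0..}"
proof -
  have "\<gamma> \<ge> 0" if \<gamma>: "\<gamma> \<in> arveson_spectrum \<alpha> y" for \<gamma>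
  proof (rule ccontr)
    assume "\<not> 0 \<le> \<gamma>"
    then have "\<gamma> \<in> interior {..<0}" by (simp add: interior_open)
    then obtain f where f: "integrable lborel f" "closure {\<xi>. fourier f \<xi> \<noteq> 0} \<subseteq> {..<0}" "smear \<alpha> f y \<noteq> 0"
      using \<gamma> unfolding arveson_spectrum_def by blast
    have "fourier f \<xi> = 0" if "p \<le> \<xi>" for \<xi>
      using f(2) closure_subset[of "{\<xi>. fourier f \<xi> \<noteq> 0}"] that assms(2) by force
    then show False using smear_analytic_eq_zero[OF assms(1) f(1)] f(3) by blast
  qed
  then show ?thesis by (auto simp: spectral_subspace_def)
qed

end

section \<open>Frequency pieces\<close>

text \<open>If K bounds the norm of f, each K - f r has norm at most K; integrating gives the
  defining inequality for the integral with constant K (b - a).\<close>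

lemma pos_integral:
  fixes f :: "real \<Rightarrow> 'm::{cstar_algebra, monoid_mult}"
  assumes cont: "continuous_on {a..b} f" and pos: "\<And>r. r \<in> {a..b} \<Longrightarrow> pos (f r)" and "a < b"
  shows "pos (integral {a..b} f)"
proof -
  have "bounded (f ` {a..b})" by (intro compact_imp_bounded compact_continuous_image cont) auto
  then obtain K where K: "K > 0" "\<And>r. r \<in> {a..b} \<Longrightarrow> norm (f r) \<le> K"
    unfolding bounded_pos by auto
  have f_int: "(f has_integral integral {a..b} f) {a..b}"
    using cont by (intro integrable_integral integrable_continuous_interval)
  have int: "((\<lambda>r. K *\<^sub>R 1 - f r) has_integral (b - a) *\<^sub>R (K *\<^sub>R 1) - integral {a..b} f) (cbox a b)"
    using has_integral_diff[OF has_integral_const_real[of "K *\<^sub>R (1::'m)" a b] f_int] \<open>a < b\<close> by simp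
  have bound: "norm (K *\<^sub>R 1 - f r) \<le> K" if "r \<in> cbox a b" for r
  proof (rule norm_scaled_one_minus_mono)
    show "norm (norm (f r) *\<^sub>R 1 - f r) \<le> norm (f r)" "norm (f r) \<le> K"
      using pos[of r] K(2)[of r] that unfolding pos_iff_norm box_real by blast+
  qed
  have "norm ((b - a) *\<^sub>R (K *\<^sub>R 1) - integral {a..b} f) \<le> K * (b - a)"
    using has_integral_bound[OF less_imp_le[OF K(1)] int bound] \<open>a < b\<close> by simp
  moreover have "adj (integral {a..b} f) = integral {a..b} f"
  proof (rule has_integral_unique)
    show "((\<lambda>r. adj (f r)) has_integral adj (integral {a..b} f)) {a..b}"
      using has_integral_linear[OF f_int bounded_linear_adj] by (simp add: o_def)
    show "((\<lambda>r. adj (f r)) has_integral integral {a..b} f) {a..b}"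
      using has_integral_eq[of "{a..b}" f "\<lambda>r. adj (f r)"] f_int pos pos_selfadjoint by metis
  qed
  ultimately show ?thesis using K(1) \<open>a < b\<close>
    by (auto simp: pos_def mult.commute intro!: exI[of _ "K * (b - a)"])
qed

text \<open>An operator-valued Bessel inequality: the square of the remainder H of the Fourier sum
  has a positive integral, in which the exponentials are orthogonal.\<close>

lemma bessel_integral:
  fixes G :: "real \<Rightarrow> 'm::{cstar_algebra, monoid_mult}" and y :: "int \<Rightarrow> 'm"
  assumes cont: "continuous_on {-pi..pi} G" and bound: "\<And>r. r \<in> {-pi..pi} \<Longrightarrow> norm (G r) \<le> L" and "L > 0"
    and F: "finite F" and y: "\<And>n. y n = (1 / (2 * pi)) *\<^sub>R integral {-pi..pi} (\<lambda>r. cis (- (of_int n * r)) *\<^sub>C G r)"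
  shows "pos (L\<^sup>2 *\<^sub>R 1 - (\<Sum>n\<in>F. adj (y n) * y n))"
proof -
  let ?I = "{-pi..pi}"
  have cis_cont: "continuous_on A (\<lambda>r. cis (c * r))" for A c by (intro continuous_intros)
  have Gy: "((\<lambda>r. cis (- (of_int n * r)) *\<^sub>C G r) has_integral (2 * pi) *\<^sub>R y n) ?I" for n
  proof -
    have "continuous_on ?I (\<lambda>r. cis (- (of_int n * r)) *\<^sub>C G r)"
      using cis_cont[of _ "- of_int n"] cont by (intro scaleC.continuous_on) auto
    then show ?thesis unfolding y by (simp add: integrable_integral integrable_continuous_interval)
  qed
  have Gy': "((\<lambda>r. cis (of_int n * r) *\<^sub>C adj (G r)) has_integral (2 * pi) *\<^sub>R adj (y n)) ?I" for n
    using has_integral_linear[OF Gy bounded_linear_adj, of n] by (simp add: o_def adj_simps adj_scaleC cis_cnj)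
  have delta: "((\<lambda>r. cis (of_int n * r) *\<^sub>C z) has_integral (if n = 0 then (2 * pi) *\<^sub>R z else 0)) ?I" for n and z :: 'm
  proof -
    have "(if n = 0 then complex_of_real (2 * pi * 1) else 0) *\<^sub>C z = (if n = 0 then (2 * pi) *\<^sub>R z else 0)"
      by (simp only: if_distrib[of "\<lambda>c. c *\<^sub>C z"] scaleC_of_real mult_1_right scaleC.zero_left)
    then show ?thesis
      using has_integral_linear[OF has_integral_cis_period[of 1 n 0] scaleC.bounded_linear_left[of z]]
      unfolding o_def by simp
  qed
  define H where "H r = G r - (\<Sum>n\<in>F. cis (of_int n * r) *\<^sub>C y n)" for r
  have H_cont: "continuous_on ?I H" unfolding H_def
    using cont cis_cont by (intro continuous_on_diff continuous_on_sum scaleC.continuous_on continuous_on_const) auto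
  have HH: "adj (H r) * H r = adj (G r) * G r - (\<Sum>n\<in>F. adj (y n) * (cis (- (of_int n * r)) *\<^sub>C G r))
      - (\<Sum>n\<in>F. (cis (of_int n * r) *\<^sub>C adj (G r)) * y n)
      + (\<Sum>m\<in>F. \<Sum>n\<in>F. cis (of_int (n - m) * r) *\<^sub>C (adj (y m) * y n))" for r
  proof -
    have "adj (cis (of_int m * r) *\<^sub>C y m) * (cis (of_int n * r) *\<^sub>C y n) = cis (of_int (n - m) * r) *\<^sub>C (adj (y m) * y n)" for m n
    proof -
      have "cis (of_int n * r) * cis (- (of_int m * r)) = cis (of_int (n - m) * r)"
        by (simp add: cis_mult left_diff_distrib)
      then show ?thesis by (simp only: adj_scaleC mult_scaleC_left mult_scaleC_right scaleC_scaleC cis_cnj)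
    qed
    then have "adj (\<Sum>n\<in>F. cis (of_int n * r) *\<^sub>C y n) * (\<Sum>n\<in>F. cis (of_int n * r) *\<^sub>C y n)
        = (\<Sum>m\<in>F. \<Sum>n\<in>F. cis (of_int (n - m) * r) *\<^sub>C (adj (y m) * y n))"
      unfolding adj_sum sum_product by (simp only:)
    moreover have "adj (\<Sum>n\<in>F. cis (of_int n * r) *\<^sub>C y n) * G r = (\<Sum>n\<in>F. adj (y n) * (cis (- (of_int n * r)) *\<^sub>C G r))"
      by (simp add: adj_sum sum_distrib_right adj_scaleC mult_scaleC_left mult_scaleC_right cis_cnj)
    moreover have "adj (G r) * (\<Sum>n\<in>F. cis (of_int n * r) *\<^sub>C y n) = (\<Sum>n\<in>F. (cis (of_int n * r) *\<^sub>C adj (G r)) * y n)"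
      by (simp add: sum_distrib_left mult_scaleC_left mult_scaleC_right)
    ultimately show ?thesis by (simp add: H_def adj_simps left_diff_distrib right_diff_distrib)
  qed
  have GG: "continuous_on ?I (\<lambda>r. adj (G r) * G r)" using cont by (intro continuous_intros)
  then have GG_int: "((\<lambda>r. adj (G r) * G r) has_integral integral ?I (\<lambda>r. adj (G r) * G r)) ?I"
    by (intro integrable_integral integrable_continuous_interval)
  have "((\<lambda>r. adj (H r) * H r) has_integral integral ?I (\<lambda>r. adj (G r) * G r)
      - (\<Sum>n\<in>F. adj (y n) * ((2 * pi) *\<^sub>R y n)) - (\<Sum>n\<in>F. ((2 * pi) *\<^sub>R adj (y n)) * y n)
      + (\<Sum>m\<in>F. \<Sum>n\<in>F. if n - m = 0 then (2 * pi) *\<^sub>R (adj (y m) * y n) else 0)) ?I"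
    unfolding HH by (intro has_integral_add has_integral_diff has_integral_sum F GG_int
        has_integral_mult_right has_integral_mult_left Gy Gy' delta)
  also have "(\<Sum>m\<in>F. \<Sum>n\<in>F. if n - m = 0 then (2 * pi) *\<^sub>R (adj (y m) * y n) else 0) = (\<Sum>m\<in>F. (2 * pi) *\<^sub>R (adj (y m) * y m))"
    using F by (intro sum.cong refl) (simp add: sum.delta)
  finally have "integral ?I (\<lambda>r. adj (H r) * H r) = integral ?I (\<lambda>r. adj (G r) * G r) - (2 * pi) *\<^sub>R (\<Sum>n\<in>F. adj (y n) * y n)"
    by (simp add: integral_unique scaleR_sum_right)
  moreover have "pos (integral ?I (\<lambda>r. adj (H r) * H r))"
    by (rule pos_integral) (use H_cont in \<open>auto intro!: continuous_intros pos_adj_mult\<close>)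
  moreover have "pos (integral ?I (\<lambda>r. L\<^sup>2 *\<^sub>R 1 - adj (G r) * G r))"
    by (rule pos_integral) (use GG bound \<open>L > 0\<close> in \<open>auto intro!: continuous_intros simp: pos_minus_adj_mult_iff\<close>)
  moreover have "integral ?I (\<lambda>r. L\<^sup>2 *\<^sub>R 1 - adj (G r) * G r) = (2 * pi) *\<^sub>R (L\<^sup>2 *\<^sub>R 1) - integral ?I (\<lambda>r. adj (G r) * G r)"
    using GG_int has_integral_const_real[of "L\<^sup>2 *\<^sub>R (1::'m)" "- pi" pi]
    by (intro integral_unique has_integral_diff) auto
  ultimately have "pos ((1 / (2 * pi)) *\<^sub>R ((integral ?I (\<lambda>r. adj (G r) * G r) - (2 * pi) *\<^sub>R (\<Sum>n\<in>F. adj (y n) * y n))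
      + ((2 * pi) *\<^sub>R (L\<^sup>2 *\<^sub>R 1) - integral ?I (\<lambda>r. adj (G r) * G r))))"
    by (intro pos_scaleR pos_add) auto
  then show ?thesis by (simp add: algebra_simps)
qed

text \<open>On an eigenvector with \<alpha> r y = cis (g r) y this is multiplication by max 0 (1 -
  |g - n|), a triangle of half-width 1 around n.\<close>

definition piece :: "(real \<Rightarrow> 'a::cstar_algebra \<Rightarrow> 'a) \<Rightarrow> int \<Rightarrow> 'a \<Rightarrow> 'a" where
  "piece \<alpha> n y = (1 / (2 * pi)) *\<^sub>R integral UNIV (\<lambda>r. (of_real (sinc2 r) * cis (- (of_int n * r))) *\<^sub>C \<alpha> r y)"

text \<open>The Fejer mean, at the point \<open>a\<close>, of the Fourier series whose coefficients
  are the pieces.\<close>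

definition fejer_sum :: "(real \<Rightarrow> 'a::cstar_algebra \<Rightarrow> 'a) \<Rightarrow> nat \<Rightarrow> real \<Rightarrow> 'a \<Rightarrow> 'a" where
  "fejer_sum \<alpha> N a y = (\<Sum>n\<in>{- int N..int N}. (of_real (triangle N n) * cis (of_int n * a)) *\<^sub>C piece \<alpha> n y)"

lemma integrable_sinc2: "sinc2 integrable_on UNIV"
proof (rule integrable_on_all_intervals_integrable_bound)
  show "(\<lambda>r::real. 5 * (1 / (1 + r\<^sup>2))) integrable_on UNIV"
    by (intro integrable_on_mult_right integrable_inverse_one_plus_square)
  show "(\<lambda>r. if r \<in> UNIV then sinc2 r else 0) integrable_on cbox a b" for a b
    by (simp add: integrable_continuous_interval continuous_on_sinc2)
qed (use sinc2_le sinc2_nonneg in auto)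

context cstar_dynamical_system
begin

lemma integrable_smear:
  assumes "continuous_on UNIV f" "g integrable_on UNIV" "\<And>r. cmod (f r) \<le> g r"
  shows "(\<lambda>r. f r *\<^sub>C \<alpha> r y) integrable_on UNIV"
proof (rule integrable_on_all_intervals_integrable_bound)
  show "(\<lambda>r. g r * norm y) integrable_on UNIV" using assms(2) by (rule integrable_on_mult_left)
  show "(\<lambda>r. if r \<in> UNIV then f r *\<^sub>C \<alpha> r y else 0) integrable_on cbox a b" for a b
    using continuous_on_subset[OF assms(1)]
    by (auto intro!: integrable_continuous_interval scaleC.continuous_on continuous_on_flow)
qed (use assms(3) in \<open>auto simp: norm_scaleC intro!: mult_right_mono\<close>)

lemma piece_has_integral:
  "((\<lambda>r. (of_real (sinc2 r) * cis (- (of_int n * r))) *\<^sub>C \<alpha> r y) has_integral (2 * pi) *\<^sub>R piece \<alpha> n y) UNIV"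
proof -
  have "(\<lambda>r. (of_real (sinc2 r) * cis (- (of_int n * r))) *\<^sub>C \<alpha> r y) integrable_on UNIV"
    by (rule integrable_smear[OF _ integrable_sinc2])
      (auto intro!: continuous_intros continuous_on_sinc2 simp: norm_mult sinc2_nonneg)
  then show ?thesis by (simp add: piece_def integrable_integral)
qed

text \<open>In the piece, \<open>sinc2\<close> is replaced by the rescaled Fejer kernel of period 2
  pi (m + 1), integrated over one period. As a function of t this is a finite sum with frequencies n
  - j / (m + 1), |j| \<le> m + 1, hence in [n - 1, n + 1]; the kernel has mass 2 pi, so the sums are
  bounded by norm y. The sums \<open>A m t\<close> and their adjoints serve the lower and the upper
  end of the spectrum.\<close>

lemma piece_approx:
  obtains A :: "nat \<Rightarrow> real \<Rightarrow> 'a" and C where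
    "\<And>m. trig (of_int n - 1) (A m)" "\<And>m. trig (- of_int n - 1) (\<lambda>t. adj (A m t))"
    "\<And>m t. norm (A m t) \<le> C" "\<And>t. (\<lambda>m. A m t) \<longlonglongrightarrow> \<alpha> t (piece \<alpha> n y)"
proof -
  define k where "k m u = complex_of_real (fejer (Suc m) (u / real (Suc m)) / real (Suc m)) * cis (- (of_int n * u))" for m u
  define b where "b m = pi * real (Suc m)" for m
  define A where "A m t = (1 / (2 * pi)) *\<^sub>R integral {- b m..b m} (\<lambda>r. k m (r - t) *\<^sub>C \<alpha> r y)" for m t
  have k_cont: "continuous_on S (k m)" for S m
    unfolding k_def by (intro continuous_intros) (simp_all del: of_nat_Suc)
  have norm_k: "cmod (k m u) = fejer (Suc m) (u / real (Suc m)) / real (Suc m)" for m u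
    by (simp add: k_def norm_mult norm_divide fejer_nonneg del: of_nat_Suc)
  have cont: "continuous_on S (\<lambda>r. k m (r - t) *\<^sub>C \<alpha> r y)" for S m t
    by (intro scaleC.continuous_on continuous_on_compose2[OF k_cont[of UNIV]] continuous_intros) auto
  have int: "(\<lambda>r. k m (r - t) *\<^sub>C \<alpha> r y) integrable_on {c..d}" for m t c d
    by (rule integrable_continuous_interval[OF cont])

  have sum: "\<exists>z. \<forall>t. A m t = (\<Sum>j\<in>{- int (Suc m)..int (Suc m)}. cis ((of_int n - of_int j / real (Suc m)) * t) *\<^sub>C z j)" for m
  proof -
    let ?Q = "real (Suc m)" and ?J = "{- int (Suc m)..int (Suc m)}"
    define f where "f j r = (complex_of_real (triangle (Suc m) j / ?Q) * cis ((of_int j / ?Q - of_int n) * r)) *\<^sub>C \<alpha> r y" for j r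
    have k_eq: "k m (r - t) = (\<Sum>j\<in>?J. cis ((of_int n - of_int j / ?Q) * t) *
        (complex_of_real (triangle (Suc m) j / ?Q) * cis ((of_int j / ?Q - of_int n) * r)))" for r t
    proof -
      have "k m (r - t) = (\<Sum>j\<in>?J. of_real (triangle (Suc m) j) * cis (of_int j * ((r - t) / ?Q))) / of_real ?Q * cis (- (of_int n * (r - t)))"
        unfolding k_def of_real_divide by (subst fejer_eq_sum) auto
      also have "\<dots> = (\<Sum>j\<in>?J. of_real (triangle (Suc m) j / ?Q) * (cis (of_int j * ((r - t) / ?Q)) * cis (- (of_int n * (r - t)))))"
        by (simp add: sum_divide_distrib sum_distrib_right mult.assoc del: of_nat_Suc)
      also have "\<dots> = (\<Sum>j\<in>?J. cis ((of_int n - of_int j / ?Q) * t) *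
        (complex_of_real (triangle (Suc m) j / ?Q) * cis ((of_int j / ?Q - of_int n) * r)))"
      proof (rule sum.cong[OF refl])
        fix j
        have "of_int j * ((r - t) / ?Q) + - (of_int n * (r - t)) = (of_int n - of_int j / ?Q) * t + (of_int j / ?Q - of_int n) * r"
          by (simp add: field_simps del: of_nat_Suc)
        then have "cis (of_int j * ((r - t) / ?Q)) * cis (- (of_int n * (r - t)))
            = cis ((of_int n - of_int j / ?Q) * t) * cis ((of_int j / ?Q - of_int n) * r)"
          by (simp only: cis_mult)
        then show "of_real (triangle (Suc m) j / ?Q) * (cis (of_int j * ((r - t) / ?Q)) * cis (- (of_int n * (r - t))))
          = cis ((of_int n - of_int j / ?Q) * t) * (complex_of_real (triangle (Suc m) j / ?Q) * cis ((of_int j / ?Q - of_int n) * r))"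
          by (simp only: mult_ac)
      qed
      finally show ?thesis .
    qed
    have f_int: "(f j has_integral integral {- b m..b m} (f j)) {- b m..b m}" for j
      unfolding f_def
      by (intro integrable_integral integrable_continuous_interval scaleC.continuous_on continuous_intros)
    have "((\<lambda>r. \<Sum>j\<in>?J. cis ((of_int n - of_int j / ?Q) * t) *\<^sub>C f j r) has_integral
        (\<Sum>j\<in>?J. cis ((of_int n - of_int j / ?Q) * t) *\<^sub>C integral {- b m..b m} (f j))) {- b m..b m}" for t
      using has_integral_linear[OF f_int scaleC.bounded_linear_right]
      by (intro has_integral_sum) (auto simp: o_def)
    moreover have "(\<Sum>j\<in>?J. cis ((of_int n - of_int j / ?Q) * t) *\<^sub>C f j r) = k m (r - t) *\<^sub>C \<alpha> r y" for r t
      unfolding k_eq f_def by (simp add: scaleC.sum_left scaleC_scaleC del: of_nat_Suc)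
    ultimately have "integral {- b m..b m} (\<lambda>r. k m (r - t) *\<^sub>C \<alpha> r y)
        = (\<Sum>j\<in>?J. cis ((of_int n - of_int j / ?Q) * t) *\<^sub>C integral {- b m..b m} (f j))" for t
      by (simp only: integral_unique)
    then have "A m t = (\<Sum>j\<in>?J. cis ((of_int n - of_int j / ?Q) * t) *\<^sub>C ((1 / (2 * pi)) *\<^sub>R integral {- b m..b m} (f j)))" for t
      by (simp only: A_def scaleR_sum_right scaleC.scaleR_right)
    then show ?thesis by (intro exI[of _ "\<lambda>j. (1 / (2 * pi)) *\<^sub>R integral {- b m..b m} (f j)"] allI)
  qed
  then obtain z where z: "\<And>m t. A m t = (\<Sum>j\<in>{- int (Suc m)..int (Suc m)}. cis ((of_int n - of_int j / real (Suc m)) * t) *\<^sub>C z m j)"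
    by metis
  have freq: "\<bar>of_int j / real (Suc m)\<bar> \<le> 1" if "j \<in> {- int (Suc m)..int (Suc m)}" for j :: int and m
  proof -
    have "\<bar>real_of_int j\<bar> \<le> real (Suc m)" using that by auto
    then show ?thesis by (simp add: abs_divide divide_le_eq del: of_nat_Suc)
  qed
  have "trig (of_int n - 1) (A m)" for m
  proof -
    have "trig (of_int n - 1) (\<lambda>t. \<Sum>j\<in>{- int (Suc m)..int (Suc m)}. cis ((of_int n - of_int j / real (Suc m)) * t) *\<^sub>C z m j)"
      using freq by (intro trig_sum trig_single) (smt (verit))
    moreover have "A m = (\<lambda>t. \<Sum>j\<in>{- int (Suc m)..int (Suc m)}. cis ((of_int n - of_int j / real (Suc m)) * t) *\<^sub>C z m j)"
      using z by blast
    ultimately show ?thesis by simp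
  qed
  moreover have "trig (- of_int n - 1) (\<lambda>t. adj (A m t))" for m
  proof -
    have "trig (- of_int n - 1) (\<lambda>t. \<Sum>j\<in>{- int (Suc m)..int (Suc m)}. cis ((- (of_int n - of_int j / real (Suc m))) * t) *\<^sub>C adj (z m j))"
      using freq by (intro trig_sum trig_single) (smt (verit))
    moreover have "(\<lambda>t. adj (A m t)) = (\<lambda>t. \<Sum>j\<in>{- int (Suc m)..int (Suc m)}. cis ((- (of_int n - of_int j / real (Suc m))) * t) *\<^sub>C adj (z m j))"
      unfolding z adj_sum adj_scaleC cis_cnj by (simp only: mult_minus_left)
    ultimately show ?thesis by simp
  qed
  moreover have "norm (A m t) \<le> norm y" for m t
  proof -
    let ?Q = "real (Suc m)"
    have fej: "((\<lambda>r. fejer (Suc m) ((r - t) / ?Q) / ?Q * norm y) has_integral (2 * pi * ?Q) / ?Q * norm y) {- b m..b m}"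
      unfolding b_def by (intro has_integral_mult_left has_integral_divide has_integral_fejer) auto
    have "norm (integral {- b m..b m} (\<lambda>r. k m (r - t) *\<^sub>C \<alpha> r y))
        \<le> integral {- b m..b m} (\<lambda>r. fejer (Suc m) ((r - t) / ?Q) / ?Q * norm y)"
      using fej by (intro integral_norm_bound_integral int) (auto simp: norm_scaleC norm_k)
    also have "\<dots> = 2 * pi * norm y" unfolding integral_unique[OF fej] by (simp del: of_nat_Suc)
    finally show ?thesis by (simp add: A_def field_simps)
  qed
  moreover have "(\<lambda>m. A m t) \<longlonglongrightarrow> \<alpha> t (piece \<alpha> n y)" for t
  proof -
    define I where "I m = {- b m - t..b m - t}" for m
    define w where "w m u = (if u \<in> I m then fejer (Suc m) (u / real (Suc m)) / real (Suc m) else 0)" for m u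
    define e where "e m u = \<bar>w m u - sinc2 u\<bar>" for m u
    have A_eq: "A m t = (1 / (2 * pi)) *\<^sub>R \<alpha> t (integral (I m) (\<lambda>u. k m u *\<^sub>C \<alpha> u y))" for m
    proof -
      have "integral {- b m..b m} (\<lambda>r. k m (r - t) *\<^sub>C \<alpha> r y) = integral (I m) ((\<lambda>r. k m (r - t) *\<^sub>C \<alpha> r y) \<circ> (+) t)"
        using integral_shift_Icc_real[of "- b m - t" "b m - t" "\<lambda>r. k m (r - t) *\<^sub>C \<alpha> r y" t] by (simp add: I_def)
      also have "(\<lambda>r. k m (r - t) *\<^sub>C \<alpha> r y) \<circ> (+) t = \<alpha> t \<circ> (\<lambda>u. k m u *\<^sub>C \<alpha> u y)"
        by (simp add: fun_eq_iff flow_scaleC flow_flow)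
      also have "integral (I m) \<dots> = \<alpha> t (integral (I m) (\<lambda>u. k m u *\<^sub>C \<alpha> u y))"
        using int[of m 0] by (intro integral_linear bounded_linear_flow) (simp add: I_def)
      finally show ?thesis by (simp add: A_def)
    qed
    have e_int: "e m integrable_on UNIV" for m
    proof -
      \<comment> \<open>Outside \<open>I m\<close> the error \<open>e m\<close> equals
        \<open>sinc2\<close>; after subtracting it, a continuous function on a compact interval
        remains.\<close>
      have "(\<lambda>u. \<bar>fejer (Suc m) (u / real (Suc m)) / real (Suc m) - sinc2 u\<bar> - sinc2 u) integrable_on I m"
        unfolding I_def by (intro integrable_continuous_interval continuous_intros continuous_on_sinc2) auto
      then have "(\<lambda>u. if u \<in> I m then \<bar>fejer (Suc m) (u / real (Suc m)) / real (Suc m) - sinc2 u\<bar> - sinc2 u else 0) integrable_on UNIV"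
        by (simp only: integrable_restrict_UNIV)
      then have "(\<lambda>u. (if u \<in> I m then \<bar>fejer (Suc m) (u / real (Suc m)) / real (Suc m) - sinc2 u\<bar> - sinc2 u else 0) + sinc2 u) integrable_on UNIV"
        using integrable_sinc2 by (rule integrable_add)
      moreover have "e m = (\<lambda>u. (if u \<in> I m then \<bar>fejer (Suc m) (u / real (Suc m)) / real (Suc m) - sinc2 u\<bar> - sinc2 u else 0) + sinc2 u)"
        by (auto simp: e_def w_def fun_eq_iff sinc2_nonneg)
      ultimately show ?thesis by simp
    qed
    have diff: "norm (A m t - \<alpha> t (piece \<alpha> n y)) \<le> norm y * integral UNIV (e m)" for m
    proof -
      have 1: "((\<lambda>u. if u \<in> I m then k m u *\<^sub>C \<alpha> u y else 0) has_integral integral (I m) (\<lambda>u. k m u *\<^sub>C \<alpha> u y)) UNIV"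
        unfolding has_integral_restrict_UNIV using int[of m 0] by (simp add: I_def integrable_integral)
      have 2: "((\<lambda>u. (if u \<in> I m then k m u *\<^sub>C \<alpha> u y else 0) - (of_real (sinc2 u) * cis (- (of_int n * u))) *\<^sub>C \<alpha> u y)
          has_integral integral (I m) (\<lambda>u. k m u *\<^sub>C \<alpha> u y) - (2 * pi) *\<^sub>R piece \<alpha> n y) UNIV"
        by (rule has_integral_diff[OF 1 piece_has_integral])
      have eq: "(if u \<in> I m then k m u *\<^sub>C \<alpha> u y else 0) - (of_real (sinc2 u) * cis (- (of_int n * u))) *\<^sub>C \<alpha> u y
          = (complex_of_real (w m u - sinc2 u) * cis (- (of_int n * u))) *\<^sub>C \<alpha> u y" for u
        by (simp add: w_def k_def scaleC.diff_left left_diff_distrib scaleC.minus_left scaleC.zero_left)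
      have "norm (integral (I m) (\<lambda>u. k m u *\<^sub>C \<alpha> u y) - (2 * pi) *\<^sub>R piece \<alpha> n y) \<le> integral UNIV (\<lambda>u. e m u * norm y)"
        using 2 unfolding eq integral_unique[OF 2[unfolded eq], symmetric]
        by (intro integral_norm_bound_integral integrable_on_mult_left e_int)
          (auto simp: norm_scaleC norm_mult e_def has_integral_integrable simp del: of_real_diff)
      also have "\<dots> = norm y * integral UNIV (e m)" by simp
      finally have *: "norm (integral (I m) (\<lambda>u. k m u *\<^sub>C \<alpha> u y) - (2 * pi) *\<^sub>R piece \<alpha> n y) \<le> norm y * integral UNIV (e m)" .
      have "A m t - \<alpha> t (piece \<alpha> n y) = (1 / (2 * pi)) *\<^sub>R \<alpha> t (integral (I m) (\<lambda>u. k m u *\<^sub>C \<alpha> u y) - (2 * pi) *\<^sub>R piece \<alpha> n y)"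
        by (simp add: A_eq linear_diff[OF bounded_linear.linear[OF bounded_linear_flow]]
            linear_cmul[OF bounded_linear.linear[OF bounded_linear_flow]] algebra_simps)
      then have "norm (A m t - \<alpha> t (piece \<alpha> n y)) = norm (integral (I m) (\<lambda>u. k m u *\<^sub>C \<alpha> u y) - (2 * pi) *\<^sub>R piece \<alpha> n y) / (2 * pi)"
        by simp
      also have "\<dots> \<le> norm (integral (I m) (\<lambda>u. k m u *\<^sub>C \<alpha> u y) - (2 * pi) *\<^sub>R piece \<alpha> n y) / 1"
        using pi_ge_two by (intro divide_left_mono) auto
      finally show ?thesis using * by simp
    qed
    have "(\<lambda>m. integral UNIV (e m)) \<longlonglongrightarrow> 0"
    proof -
      have "pi < 4" by (rule pi_less_4)
      \<comment> \<open>From m0 on the shifted period stays within |u| \<le> 4 (m + 1), the range of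
        the majorant for the kernel. This uses pi < 4.\<close>
      then obtain m0 :: nat where m0: "\<bar>t\<bar> / (4 - pi) \<le> real m0" using real_arch_simple by blast
      have wide: "b m + \<bar>t\<bar> \<le> 4 * real (Suc m)" if "m0 \<le> m" for m
      proof -
        have "\<bar>t\<bar> \<le> real m0 * (4 - pi)" using m0 \<open>pi < 4\<close> by (simp add: pos_divide_le_eq)
        also have "\<dots> \<le> real (Suc m) * (4 - pi)" using that \<open>pi < 4\<close> by (intro mult_right_mono) auto
        finally show ?thesis unfolding b_def right_diff_distrib by (simp add: mult.commute)
      qed
      have "(\<lambda>m. integral UNIV (e (m + m0))) \<longlonglongrightarrow> integral UNIV (\<lambda>u::real. 0::real)"
      proof (rule dominated_convergence(2))
        show "e (m + m0) integrable_on UNIV" for m by (rule e_int)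
        show "(\<lambda>u::real. 42 * (1 / (1 + u\<^sup>2))) integrable_on UNIV"
          by (intro integrable_on_mult_right integrable_inverse_one_plus_square)
        show "norm (e (m + m0) u) \<le> 42 * (1 / (1 + u\<^sup>2))" for m u
        proof -
          have "w (m + m0) u \<le> 37 / (1 + u\<^sup>2)"
          proof (cases "u \<in> I (m + m0)")
            case True
            then have "\<bar>u\<bar> \<le> 4 * real (Suc (m + m0))" using wide[of "m + m0"] by (auto simp: I_def)
            then show ?thesis using scaled_fejer_le[of "Suc (m + m0)" u] True by (simp add: w_def del: of_nat_Suc)
          qed (simp add: w_def)
          moreover have "0 \<le> w (m + m0) u" by (simp add: w_def fejer_nonneg)
          moreover have "37 / (1 + u\<^sup>2) + 5 / (1 + u\<^sup>2) = 42 * (1 / (1 + u\<^sup>2))" by (simp flip: add_divide_distrib)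
          moreover have "0 \<le> 37 / (1 + u\<^sup>2)" "0 \<le> 5 / (1 + u\<^sup>2)" by simp_all
          ultimately show ?thesis using sinc2_le[of u] sinc2_nonneg[of u] unfolding e_def real_norm_def by linarith
        qed
        show "(\<lambda>m. e (m + m0) u) \<longlonglongrightarrow> 0" for u
        proof -
          have "(\<lambda>m. w m u) \<longlonglongrightarrow> sinc2 u"
          proof (rule Lim_transform_eventually[OF scaled_fejer_tendsto])
            obtain m1 :: nat where m1: "\<bar>u\<bar> + \<bar>t\<bar> \<le> real m1" using real_arch_simple by blast
            show "\<forall>\<^sub>F m in sequentially. fejer (Suc m) (u / real (Suc m)) / real (Suc m) = w m u"
              unfolding eventually_sequentially
            proof (intro exI[of _ m1] allI impI)
              fix m assume "m1 \<le> m"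
              have "real (Suc m) \<le> b m"
                using pi_ge_two mult_right_mono[of 1 pi "real (Suc m)"] by (simp only: b_def) simp
              moreover have "real m1 \<le> real (Suc m)" using \<open>m1 \<le> m\<close> by simp
              ultimately have "\<bar>u\<bar> + \<bar>t\<bar> \<le> b m" using m1 by linarith
              then have "u \<in> I m" by (auto simp: I_def)
              then show "fejer (Suc m) (u / real (Suc m)) / real (Suc m) = w m u" by (simp add: w_def)
            qed
          qed
          then have "(\<lambda>m. \<bar>w m u - sinc2 u\<bar>) \<longlonglongrightarrow> \<bar>sinc2 u - sinc2 u\<bar>" by (intro tendsto_intros)
          then have "(\<lambda>m. e m u) \<longlonglongrightarrow> 0" by (simp add: e_def)
          then show ?thesis by (rule LIMSEQ_ignore_initial_segment)
        qed
      qed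
      then show ?thesis using LIMSEQ_offset[of "\<lambda>m. integral UNIV (e m)" m0] by simp
    qed
    then have lim: "(\<lambda>m. norm y * integral UNIV (e m)) \<longlonglongrightarrow> 0" by (rule tendsto_mult_right_zero)
    have "(\<lambda>m. A m t - \<alpha> t (piece \<alpha> n y)) \<longlonglongrightarrow> 0"
      by (rule Lim_null_comparison[OF always_eventually[OF allI[OF diff]] lim])
    then show ?thesis by (simp add: LIM_zero_iff)
  qed
  ultimately show ?thesis by (rule that)
qed

lemma analytic_piece: "analytic \<alpha> (of_int n - 1) (piece \<alpha> n y)"
  by (rule piece_approx[of n y]) (rule analyticI)

lemma analytic_adj_piece: "analytic \<alpha> (- of_int n - 1) (adj (piece \<alpha> n y))"
proof (rule piece_approx[of n y])
  fix A :: "nat \<Rightarrow> real \<Rightarrow> 'a" and C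
  assume A: "\<And>m. trig (- of_int n - 1) (\<lambda>t. adj (A m t))" "\<And>m t. norm (A m t) \<le> C"
    "\<And>t. (\<lambda>m. A m t) \<longlonglongrightarrow> \<alpha> t (piece \<alpha> n y)"
  show "analytic \<alpha> (- of_int n - 1) (adj (piece \<alpha> n y))"
    by (rule analyticI[OF A(1), where C = C]) (auto simp: A(2) flow_adj intro!: tendsto_adj A(3))
qed

end

section \<open>Periodized orbits and Fejer means of the pieces\<close>

lemma fejer_minus: "fejer N (- r) = fejer N r"
proof -
  have "(\<Sum>n<N. cis (real n * - r)) = cnj (\<Sum>n<N. cis (real n * r))"
    by (simp add: cis_cnj)
  then show ?thesis unfolding fejer_def by (simp only: complex_mod_cnj)
qed

lemma sin_add_squared_le: "(sin (u + v))\<^sup>2 \<le> 2 * (sin u)\<^sup>2 + 2 * (sin v)\<^sup>2" for u v :: real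
proof -
  have "\<bar>sin (u + v)\<bar> \<le> \<bar>sin u\<bar> * \<bar>cos v\<bar> + \<bar>cos u\<bar> * \<bar>sin v\<bar>"
    unfolding sin_add by (rule order.trans[OF abs_triangle_ineq]) (simp add: abs_mult)
  also have "\<dots> \<le> \<bar>sin u\<bar> * 1 + 1 * \<bar>sin v\<bar>" by (intro add_mono mult_mono) auto
  finally have "\<bar>sin (u + v)\<bar>\<^sup>2 \<le> (\<bar>sin u\<bar> + \<bar>sin v\<bar>)\<^sup>2" by (intro power_mono) auto
  also have "\<dots> \<le> 2 * \<bar>sin u\<bar>\<^sup>2 + 2 * \<bar>sin v\<bar>\<^sup>2"
    using sum_squares_ge_zero[of "\<bar>sin u\<bar> - \<bar>sin v\<bar>" 0] by (simp add: power2_eq_square algebra_simps)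
  finally show ?thesis by simp
qed

text \<open>Periodizing the weighted orbit turns the pieces into honest Fourier coefficients.\<close>

definition periodized :: "(real \<Rightarrow> 'a::cstar_algebra \<Rightarrow> 'a) \<Rightarrow> 'a \<Rightarrow> nat \<Rightarrow> real \<Rightarrow> 'a" where
  "periodized \<alpha> y S r = (\<Sum>l\<in>{- int S..int S}. sinc2 (r + 2 * pi * of_int l) *\<^sub>R \<alpha> (r + 2 * pi * of_int l) y)"

context cstar_dynamical_system
begin

lemma continuous_on_periodized: "continuous_on A (periodized \<alpha> y S)"
  unfolding periodized_def[abs_def]
  by (intro continuous_intros continuous_on_compose2[OF continuous_on_sinc2[of UNIV]]) auto

text \<open>7 = 3 + 4: the missing weight of the central translate plus the weight of the others.
  Both vanish at r = 0, so near time 0 the periodization follows the orbit, uniformly in S.\<close>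

lemma norm_periodized_diff_le:
  assumes "\<bar>r\<bar> \<le> pi"
  shows "norm (periodized \<alpha> y S r - z) \<le> norm (\<alpha> r y - z) + 7 * (sin (r / 2))\<^sup>2 * norm y"
proof -
  let ?J = "{- int S..int S} - {0}"
  have "periodized \<alpha> y S r = sinc2 r *\<^sub>R \<alpha> r y + (\<Sum>l\<in>?J. sinc2 (r + 2 * pi * of_int l) *\<^sub>R \<alpha> (r + 2 * pi * of_int l) y)"
    unfolding periodized_def by (subst sum.remove[of _ 0]) auto
  then have "periodized \<alpha> y S r - z = (\<alpha> r y - z) - (1 - sinc2 r) *\<^sub>R \<alpha> r y
      + (\<Sum>l\<in>?J. sinc2 (r + 2 * pi * of_int l) *\<^sub>R \<alpha> (r + 2 * pi * of_int l) y)"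
    by (simp add: algebra_simps)
  then have "norm (periodized \<alpha> y S r - z) \<le> (norm (\<alpha> r y - z) + norm ((1 - sinc2 r) *\<^sub>R \<alpha> r y))
      + (\<Sum>l\<in>?J. norm (sinc2 (r + 2 * pi * of_int l) *\<^sub>R \<alpha> (r + 2 * pi * of_int l) y))"
    by (simp only:) (intro norm_triangle_le add_mono norm_triangle_ineq4 norm_sum)
  moreover have "(\<Sum>l\<in>?J. norm (sinc2 (r + 2 * pi * of_int l) *\<^sub>R \<alpha> (r + 2 * pi * of_int l) y))
      = (\<Sum>l\<in>?J. sinc2 (r + 2 * pi * of_int l)) * norm y"
    by (simp add: sinc2_nonneg sum_distrib_right)
  moreover have "(\<Sum>l\<in>?J. sinc2 (r + 2 * pi * of_int l)) * norm y \<le> (4 * (sin (r / 2))\<^sup>2) * norm y"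
    by (intro mult_right_mono sum_sinc2_translates_le assms) simp
  moreover have "norm ((1 - sinc2 r) *\<^sub>R \<alpha> r y) \<le> (3 * (sin (r / 2))\<^sup>2) * norm y"
    using one_minus_sinc2_le[of r] sinc2_le_one[of r] assms pi_less_4
    by (simp add: abs_of_nonneg mult_right_mono)
  ultimately show ?thesis by (simp add: algebra_simps)
qed

lemma norm_periodized_le:
  assumes "\<bar>r\<bar> \<le> pi" shows "norm (periodized \<alpha> y S r) \<le> 8 * norm y"
proof -
  have "(sin (r / 2))\<^sup>2 * norm y \<le> 1 * norm y" by (intro mult_right_mono) (auto simp: abs_square_le_1)
  then show ?thesis using norm_periodized_diff_le[OF assms, of y S 0] by simp
qed

text \<open>The exponential has period 2 pi, so the Fourier integral of the truncated periodization
  is the integral defining the piece, restricted to |r| \<le> (2 S + 1) pi.\<close>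

lemma piece_tendsto:
  "(\<lambda>S. (1 / (2 * pi)) *\<^sub>R integral {-pi..pi} (\<lambda>r. cis (- (of_int n * r)) *\<^sub>C periodized \<alpha> y S r)) \<longlonglongrightarrow> piece \<alpha> n y"
proof -
  define K where "K r = (complex_of_real (sinc2 r) * cis (- (of_int n * r))) *\<^sub>C \<alpha> r y" for r
  have K_cont: "continuous_on A K" for A
    unfolding K_def by (intro scaleC.continuous_on continuous_intros continuous_on_sinc2)
  have K_shift: "continuous_on A (\<lambda>r. K (r + c))" for A c
    by (rule continuous_on_compose2[OF K_cont[of UNIV]]) (auto intro!: continuous_intros)
  have K_int: "K integrable_on {a..b}" for a b by (rule integrable_continuous_interval[OF K_cont])
  have shift: "integral {-pi..pi} (\<lambda>r. K (r + 2 * pi * of_int l)) = integral {2 * pi * of_int l - pi..2 * pi * of_int l + pi} K" for l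
    using integral_shift_Icc_real[of "- pi" pi K "2 * pi * of_int l"] by (simp add: o_def add.commute)
  let ?I = "\<lambda>S. {- (2 * pi * real S + pi)..2 * pi * real S + pi}"
  have sum: "(\<Sum>l\<in>{- int S..int S}. integral {2 * pi * of_int l - pi..2 * pi * of_int l + pi} K)
      = integral (?I S) K" for S
  proof (induction S)
    case (Suc S)
    let ?a = "2 * pi * real S + pi"
    have "{- int (Suc S)..int (Suc S)} = insert (- int (Suc S)) (insert (int (Suc S)) {- int S..int S})" by auto
    then have "(\<Sum>l\<in>{- int (Suc S)..int (Suc S)}. integral {2 * pi * of_int l - pi..2 * pi * of_int l + pi} K)
        = integral {2 * pi * of_int (- int (Suc S)) - pi..2 * pi * of_int (- int (Suc S)) + pi} K
          + (integral {2 * pi * of_int (int (Suc S)) - pi..2 * pi * of_int (int (Suc S)) + pi} K + integral {- ?a..?a} K)"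
      by (simp only:) (subst sum.insert, force, force, subst sum.insert, auto simp: Suc)
    also have "\<dots> = integral {- (?a + 2 * pi)..- ?a} K + integral {- ?a..?a} K + integral {?a..?a + 2 * pi} K"
      by (simp add: algebra_simps)
    also have "integral {- (?a + 2 * pi)..- ?a} K + integral {- ?a..?a} K = integral {- (?a + 2 * pi)..?a} K"
      by (rule Henstock_Kurzweil_Integration.integral_combine) (auto intro: K_int simp: add_nonneg_nonneg)
    also have "\<dots> + integral {?a..?a + 2 * pi} K = integral {- (?a + 2 * pi)..?a + 2 * pi} K"
      by (rule Henstock_Kurzweil_Integration.integral_combine) (auto intro: K_int simp: add_nonneg_nonneg)
    finally show ?case by (simp add: algebra_simps)
  qed simp
  have eq: "integral {-pi..pi} (\<lambda>r. cis (- (of_int n * r)) *\<^sub>C periodized \<alpha> y S r)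
      = integral (?I S) K" for S
  proof -
    have "cis (- (of_int n * r)) *\<^sub>C periodized \<alpha> y S r = (\<Sum>l\<in>{- int S..int S}. K (r + 2 * pi * of_int l))" for r
    proof -
      have "cis (- (of_int n * (r + 2 * pi * of_int l))) = cis (- (of_int n * r))" for l :: int
      proof -
        have "- (of_int n * (r + 2 * pi * of_int l)) = - (of_int n * r) + 2 * pi * of_int (- (n * l))"
          by (simp add: algebra_simps)
        then show ?thesis by (simp only: cis_mult[symmetric] cis_multiple_2pi Ints_of_int mult_1_right)
      qed
      then show ?thesis
        by (simp add: periodized_def K_def scaleC.sum_right scaleC.scaleR_right scaleC_scaleC[symmetric] scaleC_of_real)
    qed
    then have "integral {-pi..pi} (\<lambda>r. cis (- (of_int n * r)) *\<^sub>C periodized \<alpha> y S r)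
        = (\<Sum>l\<in>{- int S..int S}. integral {-pi..pi} (\<lambda>r. K (r + 2 * pi * of_int l)))"
      by (simp only:) (intro integral_sum integrable_continuous_interval K_shift finite_atLeastAtMost_int)
    then show ?thesis unfolding shift sum .
  qed
  have "(\<lambda>S. integral (?I S) K) \<longlonglongrightarrow> (2 * pi) *\<^sub>R piece \<alpha> n y"
  proof (rule LIMSEQ_I)
    fix e :: real assume "e > 0"
    have "(K has_integral (2 * pi) *\<^sub>R piece \<alpha> n y) UNIV"
      using piece_has_integral[of n y] by (simp add: K_def[abs_def])
    then obtain R where "R > 0" and R: "\<And>a b. ball 0 R \<subseteq> cbox a b \<Longrightarrow> norm (integral (cbox a b) K - (2 * pi) *\<^sub>R piece \<alpha> n y) < e"
      using \<open>e > 0\<close> unfolding has_integral_alt'[of K] by auto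
    obtain m :: nat where m: "R \<le> real m" using real_arch_simple by blast
    show "\<exists>no. \<forall>S\<ge>no. norm (integral (?I S) K - (2 * pi) *\<^sub>R piece \<alpha> n y) < e"
    proof (intro exI[of _ m] allI impI)
      fix S assume "m \<le> S"
      have "1 * real S \<le> (2 * pi) * real S" using pi_ge_two by (intro mult_right_mono) auto
      then have "R \<le> 2 * pi * real S + pi" using m \<open>m \<le> S\<close> pi_ge_zero by (smt (verit) mult_1 of_nat_mono)
      then have "ball 0 R \<subseteq> cbox (- (2 * pi * real S + pi)) (2 * pi * real S + pi)" by (auto simp: dist_norm)
      from R[OF this] show "norm (integral (?I S) K - (2 * pi) *\<^sub>R piece \<alpha> n y) < e"
        by simp
    qed
  qed
  then have "(\<lambda>S. (1 / (2 * pi)) *\<^sub>R integral (?I S) K) \<longlonglongrightarrow> (1 / (2 * pi)) *\<^sub>R ((2 * pi) *\<^sub>R piece \<alpha> n y)"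
    by (intro tendsto_intros)
  then show ?thesis unfolding eq by simp
qed

lemma piece_bessel:
  assumes "finite F" and "8 * norm y \<le> L" "L > 0"
  shows "pos (L\<^sup>2 *\<^sub>R 1 - (\<Sum>n\<in>F. adj (left_mult (piece \<alpha> n y)) * left_mult (piece \<alpha> n y)))" (is ?thesis1)
    and "pos (L\<^sup>2 *\<^sub>R 1 - (\<Sum>n\<in>F. left_mult (piece \<alpha> n y) * adj (left_mult (piece \<alpha> n y))))" (is ?thesis2)
proof -
  define c where "c S n = (1 / (2 * pi)) *\<^sub>R integral {-pi..pi} (\<lambda>r. cis (- (of_int n * r)) *\<^sub>C left_mult (periodized \<alpha> y S r))" for S n
  have cont: "continuous_on {-pi..pi} (\<lambda>r. left_mult (periodized \<alpha> y S r))" for S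
    by (rule bounded_linear.continuous_on[OF bounded_linear_left_mult continuous_on_periodized])
  have bound: "norm (left_mult (periodized \<alpha> y S r)) \<le> L" if "r \<in> {-pi..pi}" for S r
    using norm_periodized_le[of r y S] that assms(2) by (simp add: abs_le_iff minus_le_iff)
  have c_eq: "c S n = left_mult ((1 / (2 * pi)) *\<^sub>R integral {-pi..pi} (\<lambda>r. cis (- (of_int n * r)) *\<^sub>C periodized \<alpha> y S r))" for S n
  proof -
    have "(\<lambda>r. cis (- (of_int n * r)) *\<^sub>C periodized \<alpha> y S r) integrable_on {-pi..pi}"
      by (intro integrable_continuous_interval scaleC.continuous_on continuous_on_periodized continuous_intros)
    from integral_linear[OF this bounded_linear_left_mult] show ?thesis
      by (simp add: c_def left_mult_simps o_def)
  qed
  have lim: "(\<lambda>S. c S n) \<longlonglongrightarrow> left_mult (piece \<alpha> n y)" for n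
    unfolding c_eq by (rule bounded_linear.tendsto[OF bounded_linear_left_mult piece_tendsto])
  have 1: "pos (L\<^sup>2 *\<^sub>R 1 - (\<Sum>n\<in>F. adj (c S n) * c S n))" for S
    by (rule bessel_integral[OF cont bound assms(3,1)]) (simp_all add: c_def)
  have 2: "pos (L\<^sup>2 *\<^sub>R 1 - (\<Sum>n\<in>F. c S n * adj (c S n)))" for S
  proof -
    \<comment> \<open>The adjoint function has the n-th Fourier coefficient
      \<open>adj (c S (- n))\<close>, so Bessel's inequality for it has the factors in the other
      order.\<close>
    have "pos (L\<^sup>2 *\<^sub>R 1 - (\<Sum>n\<in>uminus ` F. adj (adj (c S (- n))) * adj (c S (- n))))"
    proof (rule bessel_integral[where G = "\<lambda>r. adj (left_mult (periodized \<alpha> y S r))"])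
      show "adj (c S (- n)) = (1 / (2 * pi)) *\<^sub>R integral {-pi..pi} (\<lambda>r. cis (- (of_int n * r)) *\<^sub>C adj (left_mult (periodized \<alpha> y S r)))" for n
      proof -
        have "(\<lambda>r. cis (- (of_int (- n) * r)) *\<^sub>C left_mult (periodized \<alpha> y S r)) integrable_on {-pi..pi}"
          by (intro integrable_continuous_interval scaleC.continuous_on cont continuous_intros)
        from integral_linear[OF this bounded_linear_adj] show ?thesis
          by (simp add: c_def adj_simps o_def adj_scaleC cis_cnj)
      qed
    qed (use cont bound assms in \<open>auto intro: continuous_intros\<close>)
    then show ?thesis by (simp add: sum.reindex)
  qed
  have "(\<lambda>S. L\<^sup>2 *\<^sub>R 1 - (\<Sum>n\<in>F. adj (c S n) * c S n)) \<longlonglongrightarrow>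
      L\<^sup>2 *\<^sub>R 1 - (\<Sum>n\<in>F. adj (left_mult (piece \<alpha> n y)) * left_mult (piece \<alpha> n y))"
    by (intro tendsto_intros lim)
  then show ?thesis1 using closed_sequentially[OF closed_pos] 1 by fastforce
  have "(\<lambda>S. L\<^sup>2 *\<^sub>R 1 - (\<Sum>n\<in>F. c S n * adj (c S n))) \<longlonglongrightarrow>
      L\<^sup>2 *\<^sub>R 1 - (\<Sum>n\<in>F. left_mult (piece \<alpha> n y) * adj (left_mult (piece \<alpha> n y)))"
    by (intro tendsto_intros lim)
  then show ?thesis2 using closed_sequentially[OF closed_pos] 2 by fastforce
qed

text \<open>Near \<open>a\<close> the continuity of the orbit gives \<epsilon>; away from it the
  kernel is at most 36 / (N (r - a)^2). The periodization error 7 sin^2 (r / 2) is split into 14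
  sin^2 ((r - a) / 2), which the kernel turns into 14 / N, and 14 sin^2 (a / 2) \<le> 4 a^2. The
  last term does not decrease with N; later it is small because a = t / J.\<close>

lemma fejer_sum_approx:
  assumes N: "N > 0" and d: "d > 0" and a: "\<bar>a\<bar> \<le> 4 - pi"
    and near: "\<And>r. \<bar>r - a\<bar> \<le> d \<Longrightarrow> norm (\<alpha> r y - \<alpha> a y) \<le> \<epsilon>"
  shows "norm (fejer_sum \<alpha> N a y - \<alpha> a y) \<le> \<epsilon> + norm y * (14 / real N + 4 * a\<^sup>2 + 72 / (real N * d))"
proof -
  define T where "T S = (1 / (2 * pi)) *\<^sub>R integral {-pi..pi} (\<lambda>r. fejer N (r - a) *\<^sub>R periodized \<alpha> y S r)" for S
  let ?J = "{- int N..int N}"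
  have cont: "continuous_on {-pi..pi} (\<lambda>r. fejer N (r - a) *\<^sub>R periodized \<alpha> y S r)" for S
    by (intro continuous_intros continuous_on_periodized)
  have "\<epsilon> \<ge> 0" using near[of a] d by simp
  have T_eq: "T S = (\<Sum>n\<in>?J. (of_real (triangle N n) * cis (of_int n * a)) *\<^sub>C
      ((1 / (2 * pi)) *\<^sub>R integral {-pi..pi} (\<lambda>r. cis (- (of_int n * r)) *\<^sub>C periodized \<alpha> y S r)))" for S
  proof -
    have "fejer N (r - a) *\<^sub>R periodized \<alpha> y S r = (\<Sum>n\<in>?J. (of_real (triangle N n) * cis (of_int n * a)) *\<^sub>C
        (cis (- (of_int n * r)) *\<^sub>C periodized \<alpha> y S r))" for r
    proof -
      have "complex_of_real (fejer N (r - a)) = (\<Sum>n\<in>?J. of_real (triangle N n) * cis (of_int n * (a - r)))"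
        using fejer_eq_sum[OF N, of "a - r"] fejer_minus[of N "r - a"] by simp
      also have "\<dots> = (\<Sum>n\<in>?J. (of_real (triangle N n) * cis (of_int n * a)) * cis (- (of_int n * r)))"
        by (simp add: mult.assoc cis_mult right_diff_distrib)
      finally have "complex_of_real (fejer N (r - a)) *\<^sub>C periodized \<alpha> y S r
          = (\<Sum>n\<in>?J. (of_real (triangle N n) * cis (of_int n * a)) * cis (- (of_int n * r))) *\<^sub>C periodized \<alpha> y S r"
        by (simp only:)
      then show ?thesis by (simp only: scaleC_of_real scaleC.sum_left scaleC_scaleC)
    qed
    moreover have "((\<lambda>r. \<Sum>n\<in>?J. (of_real (triangle N n) * cis (of_int n * a)) *\<^sub>C (cis (- (of_int n * r)) *\<^sub>C periodized \<alpha> y S r)) has_integral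
        (\<Sum>n\<in>?J. (of_real (triangle N n) * cis (of_int n * a)) *\<^sub>C integral {-pi..pi} (\<lambda>r. cis (- (of_int n * r)) *\<^sub>C periodized \<alpha> y S r))) {-pi..pi}"
    proof (rule has_integral_sum)
      fix n :: int
      have "((\<lambda>r. cis (- (of_int n * r)) *\<^sub>C periodized \<alpha> y S r) has_integral
          integral {-pi..pi} (\<lambda>r. cis (- (of_int n * r)) *\<^sub>C periodized \<alpha> y S r)) {-pi..pi}"
        by (intro integrable_integral integrable_continuous_interval scaleC.continuous_on continuous_on_periodized continuous_intros)
      from has_integral_linear[OF this scaleC.bounded_linear_right]
      show "((\<lambda>r. (of_real (triangle N n) * cis (of_int n * a)) *\<^sub>C (cis (- (of_int n * r)) *\<^sub>C periodized \<alpha> y S r)) has_integral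
        (of_real (triangle N n) * cis (of_int n * a)) *\<^sub>C integral {-pi..pi} (\<lambda>r. cis (- (of_int n * r)) *\<^sub>C periodized \<alpha> y S r)) {-pi..pi}"
        by (simp only: o_def)
    qed simp
    ultimately show ?thesis unfolding T_def
      by (simp only: integral_unique scaleR_sum_right scaleC.scaleR_right)
  qed
  have lim: "T \<longlonglongrightarrow> fejer_sum \<alpha> N a y"
    unfolding T_eq[abs_def] fejer_sum_def
    by (intro tendsto_sum scaleC.tendsto tendsto_const piece_tendsto)
  define Y where "Y = norm y"
  define \<epsilon>' where "\<epsilon>' = \<epsilon> + 14 * Y * (sin (a / 2))\<^sup>2"
  have fej: "((\<lambda>r. fejer N (r - a)) has_integral 2 * pi) {-pi..pi}"
    using has_integral_fejer[OF N, of 1 a] by simp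
  \<comment> \<open>Majorant of the kernel for |r - a| > d, made regular at \<open>a\<close> by
    adding d^2 and doubling 36; its integral is at most 72 pi / (N d).\<close>
  have tail: "((\<lambda>r. 72 / real N * (1 / (d\<^sup>2 + (r - a)\<^sup>2))) has_integral
      72 / real N * ((1 / d) * arctan ((pi - a) / d) - (1 / d) * arctan ((- pi - a) / d))) {-pi..pi}"
  proof (intro has_integral_mult_right fundamental_theorem_of_calculus)
    fix r :: real
    have "d\<^sup>2 + (r - a)\<^sup>2 > 0" using d by (simp add: add_pos_nonneg)
    then have "((\<lambda>r. (1 / d) * arctan ((r - a) / d)) has_real_derivative 1 / (d\<^sup>2 + (r - a)\<^sup>2)) (at r within {-pi..pi})"
    proof -
      have "((\<lambda>r. (1 / d) * arctan ((r - a) / d)) has_real_derivative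
          (1 / d) * (inverse (1 + ((r - a) / d)\<^sup>2) * ((1 - 0) / d))) (at r within {-pi..pi})"
        using d by (auto intro!: derivative_eq_intros)
      moreover have "1 + ((r - a) / d)\<^sup>2 = (d\<^sup>2 + (r - a)\<^sup>2) / d\<^sup>2"
        using d by (simp add: power_divide add_divide_distrib)
      ultimately show ?thesis using d by (simp add: power2_eq_square)
    qed
    then show "((\<lambda>r. (1 / d) * arctan ((r - a) / d)) has_vector_derivative 1 / (d\<^sup>2 + (r - a)\<^sup>2)) (at r within {-pi..pi})"
      by (simp add: has_real_derivative_iff_has_vector_derivative)
  qed simp
  have bound: "norm (T S - \<alpha> a y) \<le> \<epsilon> + Y * (14 / real N + 4 * a\<^sup>2 + 72 / (real N * d))" for S
  proof -
    let ?g = "\<lambda>r. fejer N (r - a) * \<epsilon>' + 14 * Y / real N + 2 * Y * (72 / real N * (1 / (d\<^sup>2 + (r - a)\<^sup>2)))"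
    have pw: "norm (fejer N (r - a) *\<^sub>R (periodized \<alpha> y S r - \<alpha> a y)) \<le> ?g r" if r: "r \<in> {-pi..pi}" for r
    proof -
      let ?F = "fejer N (r - a)"
      have F: "?F \<ge> 0" by (rule fejer_nonneg)
      have "norm (periodized \<alpha> y S r - \<alpha> a y) \<le> norm (\<alpha> r y - \<alpha> a y) + 7 * (sin (r / 2))\<^sup>2 * Y"
        using norm_periodized_diff_le[of r y S "\<alpha> a y"] r by (auto simp: Y_def)
      then have 0: "?F * norm (periodized \<alpha> y S r - \<alpha> a y) \<le> ?F * norm (\<alpha> r y - \<alpha> a y) + ?F * (7 * (sin (r / 2))\<^sup>2 * Y)"
        using F by (metis distrib_left mult_left_mono)
      have 1: "?F * (7 * (sin (r / 2))\<^sup>2 * Y) \<le> 14 * Y / real N + ?F * (14 * Y * (sin (a / 2))\<^sup>2)"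
      proof -
        have "(sin (r / 2))\<^sup>2 \<le> 2 * (sin ((r - a) / 2))\<^sup>2 + 2 * (sin (a / 2))\<^sup>2"
          using sin_add_squared_le[of "(r - a) / 2" "a / 2"] by (simp flip: add_divide_distrib)
        then have "?F * (sin (r / 2))\<^sup>2 \<le> ?F * (2 * (sin ((r - a) / 2))\<^sup>2 + 2 * (sin (a / 2))\<^sup>2)"
          using F by (rule mult_left_mono)
        also have "\<dots> = 2 * ((sin (real N * (r - a) / 2))\<^sup>2 / real N) + 2 * ?F * (sin (a / 2))\<^sup>2"
          using fejer_mult_sin[of N "r - a"] by (simp add: algebra_simps)
        also have "(sin (real N * (r - a) / 2))\<^sup>2 / real N \<le> 1 / real N"
          by (intro divide_right_mono) (auto simp: abs_square_le_1)
        finally have "?F * (sin (r / 2))\<^sup>2 \<le> 2 * (1 / real N) + 2 * ?F * (sin (a / 2))\<^sup>2" by simp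
        then have "(7 * Y) * (?F * (sin (r / 2))\<^sup>2) \<le> (7 * Y) * (2 * (1 / real N) + 2 * ?F * (sin (a / 2))\<^sup>2)"
          by (rule mult_left_mono) (simp add: Y_def)
        then show ?thesis by (simp add: algebra_simps)
      qed
      have 2: "?F * norm (\<alpha> r y - \<alpha> a y) \<le> ?F * \<epsilon> + 2 * Y * (72 / real N * (1 / (d\<^sup>2 + (r - a)\<^sup>2)))"
      proof (cases "\<bar>r - a\<bar> \<le> d")
        case True
        have "?F * norm (\<alpha> r y - \<alpha> a y) \<le> ?F * \<epsilon>" using near[OF True] F by (rule mult_left_mono)
        moreover have "0 \<le> 2 * Y * (72 / real N * (1 / (d\<^sup>2 + (r - a)\<^sup>2)))" by (simp add: Y_def)
        ultimately show ?thesis by linarith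
      next
        case False
        have "\<bar>(r - a) / 2\<bar> \<le> 2" using r a by auto
        then have "((r - a) / 2)\<^sup>2 / 9 \<le> (sin ((r - a) / 2))\<^sup>2" by (rule sin_squared_ge)
        then have "?F * (((r - a) / 2)\<^sup>2 / 9) \<le> ?F * (sin ((r - a) / 2))\<^sup>2" using F by (rule mult_left_mono)
        also have "\<dots> = (sin (real N * (r - a) / 2))\<^sup>2 / real N" by (rule fejer_mult_sin)
        also have "\<dots> \<le> 1 / real N" by (intro divide_right_mono) (auto simp: abs_square_le_1)
        finally have F1: "?F * (r - a)\<^sup>2 \<le> 36 / real N" by (simp add: power_divide)
        have "d\<^sup>2 \<le> \<bar>r - a\<bar>\<^sup>2" using False d by (intro power_mono) auto
        then have "d\<^sup>2 + (r - a)\<^sup>2 \<le> 2 * (r - a)\<^sup>2" by simp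
        then have "?F * (d\<^sup>2 + (r - a)\<^sup>2) \<le> ?F * (2 * (r - a)\<^sup>2)" using F by (rule mult_left_mono)
        also have "\<dots> \<le> 72 / real N" using F1 by simp
        finally have *: "?F * (d\<^sup>2 + (r - a)\<^sup>2) \<le> 72 / real N" .
        have "d\<^sup>2 + (r - a)\<^sup>2 > 0" using d by (simp add: add_pos_nonneg)
        then have "?F \<le> 72 / real N / (d\<^sup>2 + (r - a)\<^sup>2)" using * by (subst pos_le_divide_eq)
        then have "?F \<le> 72 / real N * (1 / (d\<^sup>2 + (r - a)\<^sup>2))" by simp
        moreover have "norm (\<alpha> r y - \<alpha> a y) \<le> 2 * Y"
          using norm_triangle_ineq4[of "\<alpha> r y" "\<alpha> a y"] by (simp add: Y_def)
        ultimately have "?F * norm (\<alpha> r y - \<alpha> a y) \<le> (72 / real N * (1 / (d\<^sup>2 + (r - a)\<^sup>2))) * (2 * Y)"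
          using F by (intro mult_mono) auto
        moreover have "?F * \<epsilon> \<ge> 0" using F \<open>\<epsilon> \<ge> 0\<close> by simp
        ultimately show ?thesis by (simp add: mult.commute)
      qed
      show ?thesis using 0 1 2 F by (simp add: \<epsilon>'_def distrib_left)
    qed
    have "((\<lambda>r. fejer N (r - a) *\<^sub>R periodized \<alpha> y S r - fejer N (r - a) *\<^sub>R \<alpha> a y) has_integral
        (2 * pi) *\<^sub>R T S - (2 * pi) *\<^sub>R \<alpha> a y) {-pi..pi}"
      using cont[of S] fej unfolding T_def
      by (intro has_integral_diff has_integral_scaleR_left) (simp_all add: integrable_integral integrable_continuous_interval)
    then have int: "((\<lambda>r. fejer N (r - a) *\<^sub>R (periodized \<alpha> y S r - \<alpha> a y)) has_integral
        (2 * pi) *\<^sub>R (T S - \<alpha> a y)) {-pi..pi}"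
      by (simp add: scaleR_diff_right)
    have g_int: "(?g has_integral 2 * pi * \<epsilon>' + (2 * pi) * (14 * Y / real N)
        + 2 * Y * (72 / real N * ((1 / d) * arctan ((pi - a) / d) - (1 / d) * arctan ((- pi - a) / d)))) {-pi..pi}"
      using has_integral_const_real[of "14 * Y / real N" "- pi" pi]
      by (intro has_integral_add has_integral_mult_left has_integral_mult_right fej tail) simp
    have "norm ((2 * pi) *\<^sub>R (T S - \<alpha> a y)) \<le> integral {-pi..pi} ?g"
      unfolding integral_unique[OF int, symmetric]
      by (intro integral_norm_bound_integral pw) (use int g_int in blast)+
    also have "\<dots> = 2 * pi * \<epsilon>' + (2 * pi) * (14 * Y / real N)
        + 2 * Y * (72 / real N * ((1 / d) * (arctan ((pi - a) / d) - arctan ((- pi - a) / d))))"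
      unfolding integral_unique[OF g_int] by (simp add: right_diff_distrib)
    also have "\<dots> \<le> 2 * pi * \<epsilon>' + (2 * pi) * (14 * Y / real N) + 2 * Y * (72 / real N * ((1 / d) * pi))"
      using arctan_ubound[of "(pi - a) / d"] arctan_lbound[of "(- pi - a) / d"] d
      by (intro add_mono mult_left_mono) (auto simp: Y_def)
    also have "\<dots> = (2 * pi) * (\<epsilon>' + 14 * Y / real N + 72 * Y / (real N * d))" using d N by (simp add: field_simps)
    finally have "norm (T S - \<alpha> a y) \<le> \<epsilon>' + 14 * Y / real N + 72 * Y / (real N * d)" by simp
    moreover have "14 * Y * (sin (a / 2))\<^sup>2 \<le> 4 * a\<^sup>2 * Y"
    proof -
      have "\<bar>sin (a / 2)\<bar>\<^sup>2 \<le> \<bar>a / 2\<bar>\<^sup>2" by (intro power_mono abs_sin_x_le_abs_x) auto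
      then have "14 * (sin (a / 2))\<^sup>2 \<le> 14 * (a\<^sup>2 / 4)" by (simp add: power_divide)
      also have "\<dots> \<le> 4 * a\<^sup>2" by simp
      finally have "14 * (sin (a / 2))\<^sup>2 * Y \<le> 4 * a\<^sup>2 * Y" by (rule mult_right_mono) (simp add: Y_def)
      then show ?thesis by (simp add: mult_ac)
    qed
    ultimately show ?thesis by (simp add: \<epsilon>'_def algebra_simps)
  qed
  have "(\<lambda>S. norm (T S - \<alpha> a y)) \<longlonglongrightarrow> norm (fejer_sum \<alpha> N a y - \<alpha> a y)"
    by (intro tendsto_intros lim)
  then show ?thesis using bound by (intro LIMSEQ_le_const2) (auto simp: Y_def)
qed

end

section \<open>Invariance of algebras containing the analytic elements\<close>

lemma triangle_lipschitz:
  assumes "N > 0" shows "\<bar>triangle N m - triangle N n\<bar> \<le> 1 / real N * \<bar>real_of_int (m - n)\<bar>"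
proof -
  have "\<bar>triangle N m - triangle N n\<bar> \<le> \<bar>\<bar>of_int m\<bar> / real N - \<bar>of_int n\<bar> / real N\<bar>"
    unfolding triangle_def by linarith
  also have "\<dots> = \<bar>\<bar>of_int m\<bar> - \<bar>of_int n\<bar>\<bar> / real N" by (simp flip: diff_divide_distrib)
  also have "\<dots> \<le> \<bar>real_of_int m - of_int n\<bar> / real N" by (intro divide_right_mono) auto
  finally show ?thesis by simp
qed

lemma triangle_bounds: "0 \<le> triangle N n" "triangle N n \<le> 1"
  by (auto simp: triangle_def)

lemma triangle_eq_0: "int N \<le> \<bar>n\<bar> \<Longrightarrow> N > 0 \<Longrightarrow> triangle N n = 0"
proof -
  assume "int N \<le> \<bar>n\<bar>" "N > 0"
  then have "real N \<le> \<bar>real_of_int n\<bar>" by linarith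
  then show ?thesis using \<open>N > 0\<close> by (simp add: triangle_def le_divide_eq)
qed

lemma triangle_eq: "\<bar>n\<bar> \<le> int N \<Longrightarrow> N > 0 \<Longrightarrow> triangle N n = 1 - \<bar>of_int n\<bar> / real N"
proof -
  assume "\<bar>n\<bar> \<le> int N" "N > 0"
  then have "\<bar>real_of_int n\<bar> \<le> real N" by linarith
  then show ?thesis using \<open>N > 0\<close> by (simp add: triangle_def divide_le_eq)
qed

text \<open>The coefficients of the de la Vallee Poussin kernel.\<close>

definition trapezoid :: "nat \<Rightarrow> int \<Rightarrow> real" where
  "trapezoid N n = 2 * triangle (2 * N) n - triangle N n"

lemma trapezoid_eq_1: assumes "\<bar>n\<bar> \<le> int N" "N > 0" shows "trapezoid N n = 1"
  using assms by (simp add: trapezoid_def triangle_eq)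

lemma trapezoid_eq_0: assumes "2 * int N \<le> \<bar>n\<bar>" "N > 0" shows "trapezoid N n = 0"
  using assms by (simp add: trapezoid_def triangle_eq_0)

lemma abs_trapezoid_le: assumes "N > 0" shows "\<bar>trapezoid N n\<bar> \<le> 1"
proof (cases "\<bar>n\<bar> \<le> int N")
  case False
  then have "trapezoid N n = 2 * triangle (2 * N) n" using assms by (simp add: trapezoid_def triangle_eq_0)
  moreover have "triangle (2 * N) n \<le> 1 / 2"
  proof -
    have "real N \<le> \<bar>real_of_int n\<bar>" using False by linarith
    then have "1 / 2 \<le> \<bar>real_of_int n\<bar> / real (2 * N)" using assms by (simp add: field_simps)
    then show ?thesis unfolding triangle_def by linarith
  qed
  ultimately show ?thesis using triangle_bounds[of "2 * N" n] by simp
qed (simp add: trapezoid_eq_1 assms)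

lemma trapezoid_lipschitz:
  assumes "N > 0" shows "\<bar>trapezoid N m - trapezoid N n\<bar> \<le> 2 / real N * \<bar>real_of_int (m - n)\<bar>"
proof -
  have "\<bar>trapezoid N m - trapezoid N n\<bar> \<le> 2 * \<bar>triangle (2 * N) m - triangle (2 * N) n\<bar> + \<bar>triangle N m - triangle N n\<bar>"
  proof -
    have "trapezoid N m - trapezoid N n = 2 * (triangle (2 * N) m - triangle (2 * N) n) - (triangle N m - triangle N n)"
      by (simp add: trapezoid_def)
    then show ?thesis
      using abs_triangle_ineq4[of "2 * (triangle (2 * N) m - triangle (2 * N) n)" "triangle N m - triangle N n"]
      by (simp only: abs_mult abs_numeral)
  qed
  also have "\<dots> \<le> 2 * (1 / real (2 * N) * \<bar>real_of_int (m - n)\<bar>) + 1 / real N * \<bar>real_of_int (m - n)\<bar>"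
    using assms by (intro add_mono mult_left_mono triangle_lipschitz) auto
  finally show ?thesis by simp
qed

lemma norm_minus_double_le:
  fixes x :: "'b::real_normed_vector"
  shows "norm (x - (2 *\<^sub>R b - a)) \<le> norm (a - x) + 2 * norm (b - x)"
proof -
  have "x - (2 *\<^sub>R b - a) = (a - x) - 2 *\<^sub>R (b - x)" by (simp add: scaleR_2)
  then show ?thesis using norm_triangle_ineq4[of "a - x" "2 *\<^sub>R (b - x)"] by (simp only: norm_scaleR abs_numeral)
qed

lemma sum_trapezoid_piece:
  assumes "N > 0"
  shows "(\<Sum>n\<in>{- int (2 * N)..int (2 * N)}. trapezoid N n *\<^sub>R piece \<alpha> n x)
    = 2 *\<^sub>R fejer_sum \<alpha> (2 * N) 0 x - fejer_sum \<alpha> N 0 x"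
proof -
  have "fejer_sum \<alpha> N 0 x = (\<Sum>n\<in>{- int (2 * N)..int (2 * N)}. triangle N n *\<^sub>R piece \<alpha> n x)"
    unfolding fejer_sum_def
    using assms by (intro sum.mono_neutral_cong_left) (auto simp: scaleC_of_real triangle_eq_0)
  then show ?thesis
    by (simp add: fejer_sum_def scaleC_of_real trapezoid_def scaleR_left_diff_distrib sum_subtractf scaleR_sum_right)
qed

context cstar_dynamical_system
begin

lemma rescaled_system: "cstar_dynamical_system (\<lambda>r. \<alpha> (c * r))"
proof
  show "\<alpha> (c * 0) = id" by (simp add: group_zero)
  show "\<alpha> (c * (s + t)) = \<alpha> (c * s) \<circ> \<alpha> (c * t)" for s t by (simp add: distrib_left group_add)
  show "continuous_on UNIV (\<lambda>t. \<alpha> (c * t) x)" for x by (intro continuous_intros)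
qed (rule star_automorphism)

lemma flow_id [simp]: "\<alpha> 0 y = y"
  by (simp add: group_zero)

text \<open>Speeding up the flow shrinks a modulus of continuity d to d / J, hence the term 72 J /
  (N d). With N a multiple J M it becomes independent of J, and d depends only on t, x and
  \<epsilon>.\<close>

lemma rescaled_fejer_sum_approx:
  assumes "\<epsilon> > 0"
  obtains d where "d > 0" "\<And>J N. J > 0 \<Longrightarrow> N > 0 \<Longrightarrow> \<bar>t / real J\<bar> \<le> 4 - pi \<Longrightarrow>
    norm (fejer_sum (\<lambda>r. \<alpha> (real J * r)) N (t / real J) x - \<alpha> t x)
      \<le> \<epsilon> + norm x * (14 / real N + 4 * (t / real J)\<^sup>2 + 72 * real J / (real N * d))"
proof -
  have "isCont (\<lambda>r. \<alpha> r x) t" using norm_continuous[of x] by (simp add: continuous_on_eq_continuous_at)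
  then have "\<exists>d>0. \<forall>r. norm (r - t) < d \<longrightarrow> norm (\<alpha> r x - \<alpha> t x) < \<epsilon>"
    using assms by (simp only: continuous_at_eps_delta dist_norm)
  then obtain d where d: "d > 0" "\<And>r. \<bar>r - t\<bar> < d \<Longrightarrow> norm (\<alpha> r x - \<alpha> t x) < \<epsilon>"
    unfolding real_norm_def by blast
  show ?thesis
  proof (rule that[of "d / 2"])
    fix J N :: nat assume J: "J > 0" and N: "N > 0" and t: "\<bar>t / real J\<bar> \<le> 4 - pi"
    interpret rescaled: cstar_dynamical_system "\<lambda>r. \<alpha> (real J * r)" by (rule rescaled_system)
    have "norm (\<alpha> (real J * r) x - \<alpha> (real J * (t / real J)) x) \<le> \<epsilon>" if "\<bar>r - t / real J\<bar> \<le> d / 2 / real J" for r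
    proof -
      have "real J * \<bar>r - t / real J\<bar> \<le> real J * (d / 2 / real J)" using that by (rule mult_left_mono) simp
      moreover have "real J * \<bar>r - t / real J\<bar> = \<bar>real J * r - t\<bar>"
        using J by (simp add: abs_mult[symmetric, of "real J", simplified] right_diff_distrib)
      ultimately have "\<bar>real J * r - t\<bar> < d" using J d(1) by simp
      then show ?thesis using d(2)[of "real J * r"] J by simp
    qed
    from rescaled.fejer_sum_approx[OF N _ t this, of "d / 2 / real J"] J d(1)
    show "norm (fejer_sum (\<lambda>r. \<alpha> (real J * r)) N (t / real J) x - \<alpha> t x)
      \<le> \<epsilon> + norm x * (14 / real N + 4 * (t / real J)\<^sup>2 + 72 * real J / (real N * (d / 2)))"
      by simp
  qed (use d in simp)
qed

lemma fejer_sum_tendsto: "(\<lambda>N. fejer_sum \<alpha> N 0 x) \<longlonglongrightarrow> x"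
proof (rule LIMSEQ_I)
  fix e :: real assume "e > 0"
  then have "e / 2 > 0" by simp
  then obtain d where d: "d > 0" "\<And>J N. J > 0 \<Longrightarrow> N > 0 \<Longrightarrow> \<bar>0 / real J\<bar> \<le> 4 - pi \<Longrightarrow>
    norm (fejer_sum (\<lambda>r. \<alpha> (real J * r)) N (0 / real J) x - \<alpha> 0 x)
      \<le> e / 2 + norm x * (14 / real N + 4 * (0 / real J)\<^sup>2 + 72 * real J / (real N * d))"
    by (rule rescaled_fejer_sum_approx[of "e / 2" 0 x]) (rule that)
  have est: "norm (fejer_sum \<alpha> N 0 x - x) \<le> e / 2 + norm x * (14 * (1 / real N) + 72 / d * (1 / real N))" if "N > 0" for N
    using d(2)[of 1 N] that pi_less_4 by (simp add: mult.commute)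
  have "(\<lambda>N. norm x * (14 * (1 / real N) + 72 / d * (1 / real N))) \<longlonglongrightarrow> norm x * (14 * 0 + 72 / d * 0)"
    by (intro tendsto_intros lim_1_over_n)
  then have "\<forall>\<^sub>F N in sequentially. norm x * (14 * (1 / real N) + 72 / d * (1 / real N)) < e / 2"
    using \<open>e > 0\<close> by (intro order_tendstoD) auto
  then have "\<forall>\<^sub>F N in sequentially. norm (fejer_sum \<alpha> N 0 x - x) < e"
    using eventually_gt_at_top[of 0]
  proof eventually_elim
    case (elim N)
    then show ?case using est[of N] by linarith
  qed
  then show "\<exists>no. \<forall>n\<ge>no. norm (fejer_sum \<alpha> n 0 x - x) < e" by (simp add: eventually_sequentially)
qed

text \<open>The constant is the bound 8 for the periodized orbit, with 1 added for strict
  positivity. Lower spectral bounds p \<ge> 0 for the fast flow become p / J \<ge> 0 for the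
  original one, which places \<open>D p\<close> in \<open>B\<close>.\<close>

lemma graded_pieces_rescaled:
  assumes B: "subalgebra B" "closed B" "spectral_subspace \<alpha> {0..} \<subseteq> B" and x: "x \<in> B" and J: "J > (0::nat)"
  defines "\<beta> \<equiv> \<lambda>r. \<alpha> (real J * r)"
  shows "graded_pieces (left_mult ` B) (\<lambda>p. left_mult ` {y. analytic \<beta> (of_int p) y})
    (\<lambda>n. left_mult (piece \<beta> n x)) (left_mult x) (8 * norm x + 1)"
proof -
  interpret rescaled: cstar_dynamical_system \<beta> unfolding \<beta>_def by (rule rescaled_system)
  have sub: "0 \<in> B" "\<And>a b. a \<in> B \<Longrightarrow> b \<in> B \<Longrightarrow> a + b \<in> B" "\<And>c a. a \<in> B \<Longrightarrow> c *\<^sub>C a \<in> B"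
    "\<And>a b. a \<in> B \<Longrightarrow> b \<in> B \<Longrightarrow> a * b \<in> B"
    using B(1) unfolding subalgebra_def by blast+
  have L0: "left_mult (0::'a) = 0" using left_mult_simps(2)[of "0::'a" 0] by simp
  have scaleR: "r *\<^sub>R a = of_real r *\<^sub>C a" for r and a :: 'a by (simp add: scaleC_of_real)
  let ?D = "\<lambda>p::int. left_mult ` {y. analytic \<beta> (of_int p) y}"
  show ?thesis
  proof
    show "closed (left_mult ` B)" by (rule closed_left_mult_image[OF B(2)])
    show "0 \<in> left_mult ` B" using sub(1) L0 by (metis imageI)
    show "a + b \<in> left_mult ` B" "a * b \<in> left_mult ` B" if "a \<in> left_mult ` B" "b \<in> left_mult ` B" for a b
      using that sub by (auto simp flip: left_mult_simps)
    show "r *\<^sub>R a \<in> left_mult ` B" if "a \<in> left_mult ` B" for a r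
      using that sub by (auto simp: scaleR simp flip: left_mult_simps(5))
    show "0 \<in> ?D p" for p :: int
      using rescaled.analytic_zero L0 by (metis imageI mem_Collect_eq)
    show "a + b \<in> ?D p"
      if "a \<in> ?D p" "b \<in> ?D p" for a b and p :: int
      using that rescaled.analytic_add by (auto simp flip: left_mult_simps)
    show "r *\<^sub>R a \<in> ?D p"
      if "a \<in> ?D p" for a r and p :: int
      using that rescaled.analytic_scaleC by (auto simp: scaleR simp flip: left_mult_simps(5))
    show "a * b \<in> ?D (p + q)"
      if "a \<in> ?D p" "b \<in> ?D q" for a b and p q :: int
      using that rescaled.analytic_mult[of "of_int p" _ "of_int q"] by (auto simp flip: left_mult_simps)
    show "?D q \<subseteq> ?D p"
      if "p \<le> q" for p q :: int
      using that analytic_antimono[of \<beta> "of_int q" _ "of_int p"] by auto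
    show "?D p \<subseteq> left_mult ` B" if "0 \<le> p" for p :: int
    proof (intro image_mono subsetI)
      fix y assume "y \<in> {y. analytic \<beta> (of_int p) y}"
      then have "analytic \<alpha> (of_int p / real J) y"
        using analytic_rescale[of \<alpha> "real J" "of_int p" y] J by (simp add: \<beta>_def)
      then show "y \<in> B" using analytic_in_spectral_subspace that B(3) by (metis divide_nonneg_nonneg of_int_0_le_iff of_nat_0_le_iff subsetD)
    qed
    show "left_mult (piece \<beta> n x) \<in> ?D (n - 1)" for n
      using rescaled.analytic_piece[of n x] by simp
    show "adj (left_mult (piece \<beta> n x)) \<in> ?D (- n - 1)" for n
      using rescaled.analytic_adj_piece[of n x] by (simp flip: left_mult_adj)
    show L: "0 < 8 * norm x + 1" by (simp add: add_nonneg_pos)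
    show "pos ((8 * norm x + 1)\<^sup>2 *\<^sub>R 1 - (\<Sum>n\<in>F. adj (left_mult (piece \<beta> n x)) * left_mult (piece \<beta> n x)))"
      "pos ((8 * norm x + 1)\<^sup>2 *\<^sub>R 1 - (\<Sum>n\<in>F. left_mult (piece \<beta> n x) * adj (left_mult (piece \<beta> n x))))"
      if "finite F" for F
      using rescaled.piece_bessel[OF that _ L, of x] by simp_all
    show "left_mult x \<in> left_mult ` B" using x by simp
    show "\<exists>F c. finite F \<and> {- N..N} \<subseteq> F \<and> (\<forall>n\<in>{- N..N}. c n = 1) \<and>
        norm (left_mult x - (\<Sum>n\<in>F. c n *\<^sub>R left_mult (piece \<beta> n x))) < \<epsilon>" if "\<epsilon> > 0" for \<epsilon> N
    proof -
      have "\<forall>\<^sub>F M in sequentially. norm (fejer_sum \<beta> M 0 x - x) < \<epsilon> / 3"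
        using tendstoD[OF rescaled.fejer_sum_tendsto, of "\<epsilon> / 3"] that by (simp add: dist_norm)
      then obtain M0 where M0: "\<And>M. M0 \<le> M \<Longrightarrow> norm (fejer_sum \<beta> M 0 x - x) < \<epsilon> / 3"
        unfolding eventually_sequentially by blast
      define M where "M = max M0 (max 1 (nat N))"
      have M: "M > 0" "M0 \<le> M" "N \<le> int M" by (auto simp: M_def)
      have "norm (x - (2 *\<^sub>R fejer_sum \<beta> (2 * M) 0 x - fejer_sum \<beta> M 0 x))
          \<le> norm (fejer_sum \<beta> M 0 x - x) + 2 * norm (fejer_sum \<beta> (2 * M) 0 x - x)"
        by (rule norm_minus_double_le)
      then have "norm (x - (\<Sum>n\<in>{- int (2 * M)..int (2 * M)}. trapezoid M n *\<^sub>R piece \<beta> n x)) < \<epsilon>"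
        using M0[of M] M0[of "2 * M"] M unfolding sum_trapezoid_piece[OF M(1)] by linarith
      then have "norm (left_mult x - (\<Sum>n\<in>{- int (2 * M)..int (2 * M)}. trapezoid M n *\<^sub>R left_mult (piece \<beta> n x))) < \<epsilon>"
        by (simp flip: left_mult_simps left_mult_sum)
      then show ?thesis
        using M by (intro exI[of _ "{- int (2 * M)..int (2 * M)}"] exI[of _ "trapezoid M"]) (auto simp: trapezoid_eq_1)
    qed
  qed
qed

text \<open>The multiplier is \<open>\<phi>\<close> at n t / J times a triangle of width J M0, the
  cut-off \<kappa> a trapezoid of width J M1. The order of choices matters: M0 makes the Fejer means
  near time t accurate; this fixes the factor in front of the error of the cut-off and thereby the
  finer tolerance e2 and M1; J comes last and kills the error of the descent.\<close>

lemma trigonometric_translate_in_subalgebra: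
  assumes B: "subalgebra B" "closed B" "spectral_subspace \<alpha> {0..} \<subseteq> B" and x: "x \<in> B"
    and \<phi>: "\<And>u. \<bar>\<phi> u\<bar> \<le> 1" "\<And>u v. \<bar>\<phi> u - \<phi> v\<bar> \<le> \<bar>u - v\<bar>"
      "\<And>u. complex_of_real (\<phi> u) = w * cis u + cnj w * cis (- u)" and w: "cmod w \<le> 1"
  shows "w *\<^sub>C \<alpha> t x + cnj w *\<^sub>C \<alpha> (- t) x \<in> B"
proof -
  have "\<exists>b\<in>B. dist b (w *\<^sub>C \<alpha> t x + cnj w *\<^sub>C \<alpha> (- t) x) < e" if "e > 0" for e :: real
  proof -
    define L where "L = 8 * norm x + 1"
    \<comment> \<open>The final distance is 8 e1 = e / 2: twice 3 e1 for the Fejer means at t and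
      -t, and 2 e1 for the distance of the multiplier sum to \<open>B\<close>.\<close>
    define e1 where "e1 = e / 16"
    have e1: "e1 > 0" using that by (simp add: e1_def)
    note approx = rescaled_fejer_sum_approx
    obtain d1 where d1: "d1 > 0" "\<And>J N. J > 0 \<Longrightarrow> N > 0 \<Longrightarrow> \<bar>t / real J\<bar> \<le> 4 - pi \<Longrightarrow>
      norm (fejer_sum (\<lambda>r. \<alpha> (real J * r)) N (t / real J) x - \<alpha> t x)
        \<le> e1 + norm x * (14 / real N + 4 * (t / real J)\<^sup>2 + 72 * real J / (real N * d1))"
      by (rule approx[OF e1, of t x]) (rule that)
    obtain d2 where d2: "d2 > 0" "\<And>J N. J > 0 \<Longrightarrow> N > 0 \<Longrightarrow> \<bar>- t / real J\<bar> \<le> 4 - pi \<Longrightarrow>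
      norm (fejer_sum (\<lambda>r. \<alpha> (real J * r)) N (- t / real J) x - \<alpha> (- t) x)
        \<le> e1 + norm x * (14 / real N + 4 * (- t / real J)\<^sup>2 + 72 * real J / (real N * d2))"
      by (rule approx[OF e1, of "- t" x]) (rule that)
    obtain m0 :: nat where "norm x * 72 / (e1 * d1) + norm x * 72 / (e1 * d2) \<le> real m0"
      using real_arch_simple by blast
    moreover have "0 \<le> norm x * 72 / (e1 * d1)" "0 \<le> norm x * 72 / (e1 * d2)"
      using e1 d1(1) d2(1) by simp_all
    ultimately have m0: "norm x * 72 / (e1 * d1) \<le> real (Suc m0)" "norm x * 72 / (e1 * d2) \<le> real (Suc m0)"
      by auto
    define M0 where "M0 = Suc m0"
    have M0: "M0 > 0" "norm x * (72 / (real M0 * d1)) \<le> e1" "norm x * (72 / (real M0 * d2)) \<le> e1"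
      using m0 e1 d1(1) d2(1) by (simp_all add: M0_def field_simps del: of_nat_Suc)
    \<comment> \<open>Anticipates 2 + N0 \<delta>, whose value is the same for every J. With the 9
      e2 of the trapezoid estimate, 3 e2 and twice 3 e2, the cut-off error becomes exactly
      e1.\<close>
    define R where "R = 2 + real M0 * (2 + \<bar>t\<bar>)"
    have R: "R > 0" by (simp add: R_def add_pos_nonneg)
    define e2 where "e2 = e / (16 * 9 * R)"
    have e2: "e2 > 0" using that R by (simp add: e2_def)
    obtain d0 where d0: "d0 > 0" "\<And>J N. J > 0 \<Longrightarrow> N > 0 \<Longrightarrow> \<bar>0 / real J\<bar> \<le> 4 - pi \<Longrightarrow>
      norm (fejer_sum (\<lambda>r. \<alpha> (real J * r)) N (0 / real J) x - \<alpha> 0 x)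
        \<le> e2 + norm x * (14 / real N + 4 * (0 / real J)\<^sup>2 + 72 * real J / (real N * d0))"
      by (rule approx[OF e2, of 0 x]) (rule that)
    obtain m1 :: nat where m1: "norm x * 72 / (e2 * d0) \<le> real m1"
      using real_arch_simple by blast
    define M1 where "M1 = max M0 m1"
    have "norm x * 72 / (e2 * d0) \<le> real M1" using m1 by (simp add: M1_def)
    moreover have "M1 > 0" "M0 \<le> M1" using M0(1) by (auto simp: M1_def)
    ultimately have M1: "M1 > 0" "M0 \<le> M1" "norm x * (72 / (real M1 * d0)) \<le> e2"
      using e2 d0(1) by (simp_all add: field_simps)
    have "\<forall>\<^sub>F J in sequentially. \<bar>t\<bar> * (1 / real J) < 4 - pi"
    proof (rule order_tendstoD)
      show "(\<lambda>J. \<bar>t\<bar> * (1 / real J)) \<longlonglongrightarrow> \<bar>t\<bar> * 0" by (intro tendsto_intros lim_1_over_n)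
    qed (use pi_less_4 in simp)
    moreover have "\<forall>\<^sub>F J in sequentially. norm x * (14 * (1 / real J) + 4 * t\<^sup>2 * (1 / real J)\<^sup>2) < min e1 e2"
    proof (rule order_tendstoD)
      show "(\<lambda>J. norm x * (14 * (1 / real J) + 4 * t\<^sup>2 * (1 / real J)\<^sup>2)) \<longlonglongrightarrow> norm x * (14 * 0 + 4 * t\<^sup>2 * 0\<^sup>2)"
        by (intro tendsto_intros lim_1_over_n)
    qed (use e1 e2 in simp)
    moreover have "\<forall>\<^sub>F J in sequentially. 11 * (2 + \<bar>t\<bar>) * L * sqrt (real M0 * (1 / real J)) < e1"
    proof (rule order_tendstoD)
      show "(\<lambda>J. 11 * (2 + \<bar>t\<bar>) * L * sqrt (real M0 * (1 / real J))) \<longlonglongrightarrow> 11 * (2 + \<bar>t\<bar>) * L * sqrt (real M0 * 0)"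
        by (intro tendsto_intros lim_1_over_n)
    qed (use e1 in simp)
    ultimately have "\<forall>\<^sub>F J in sequentially. J > 0 \<and> \<bar>t\<bar> * (1 / real J) < 4 - pi \<and>
        norm x * (14 * (1 / real J) + 4 * t\<^sup>2 * (1 / real J)\<^sup>2) < min e1 e2 \<and>
        11 * (2 + \<bar>t\<bar>) * L * sqrt (real M0 * (1 / real J)) < e1"
      using eventually_gt_at_top[of 0] by eventually_elim blast
    then obtain J :: nat where J: "J > 0" and Jt: "\<bar>t\<bar> * (1 / real J) < 4 - pi"
      and J2: "norm x * (14 * (1 / real J) + 4 * t\<^sup>2 * (1 / real J)\<^sup>2) < min e1 e2"
      and J3: "11 * (2 + \<bar>t\<bar>) * L * sqrt (real M0 * (1 / real J)) < e1"
      by (metis (mono_tags, lifting) eventually_sequentially order_refl)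
    define \<beta> where "\<beta> r = \<alpha> (real J * r)" for r
    define N0 where "N0 = J * M0"
    define N1 where "N1 = J * M1"
    \<comment> \<open>One Lipschitz constant for both sequences: \<theta> needs |t| / J + 1 / N0,
      the trapezoid 2 / N1.\<close>
    define \<delta> where "\<delta> = (2 + \<bar>t\<bar>) / real J"
    have N: "N0 > 0" "N1 > 0" "N0 \<le> N1" using J M0(1) M1(1,2) by (simp_all add: N0_def N1_def)
    have N_ge: "1 / real N0 \<le> 1 / real J" "1 / real N1 \<le> 1 / real J"
      using J M0(1) M1(1) by (auto simp: N0_def N1_def intro!: divide_left_mono)
    have fejer1: "norm (fejer_sum \<beta> N0 s x - \<alpha> u x) \<le> 3 * e1"
      if "norm (fejer_sum \<beta> N0 s x - \<alpha> u x) \<le> e1 + norm x * (14 / real N0 + 4 * (t / real J)\<^sup>2 + 72 * real J / (real N0 * d))"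
        "norm x * (72 / (real M0 * d)) \<le> e1" for s u d
    proof -
      have "72 * real J / (real N0 * d) = 72 / (real M0 * d)" using J by (simp add: N0_def)
      moreover have "norm x * (14 / real N0 + 4 * (t / real J)\<^sup>2) \<le> norm x * (14 * (1 / real J) + 4 * t\<^sup>2 * (1 / real J)\<^sup>2)"
        using N_ge(1) by (intro mult_left_mono add_mono) (simp_all add: power_divide)
      ultimately show ?thesis using that J2 by (simp add: distrib_left)
    qed
    have near_t: "norm (fejer_sum \<beta> N0 (t / real J) x - \<alpha> t x) \<le> 3 * e1"
      using d1(2)[OF J N(1)] Jt M0(2) by (intro fejer1[of _ _ d1]) (auto simp: \<beta>_def[abs_def] abs_divide)
    have near_minus_t: "norm (fejer_sum \<beta> N0 (- (t / real J)) x - \<alpha> (- t) x) \<le> 3 * e1"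
      using d2(2)[OF J N(1)] Jt M0(3) by (intro fejer1[of _ _ d2]) (auto simp: \<beta>_def[abs_def] abs_divide)
    have near_0: "norm (fejer_sum \<beta> N 0 x - x) \<le> 3 * e2" if "N1 \<le> N" for N
    proof -
      have "N > 0" using that N(2) by simp
      have NJ: "1 / real N \<le> 1 / real N1" using that N(2) by (intro divide_left_mono) auto
      have "norm (fejer_sum \<beta> N 0 x - x) \<le> e2 + norm x * (14 / real N + 72 * real J / (real N * d0))"
        using d0(2)[OF J \<open>N > 0\<close>] pi_less_4 by (simp add: \<beta>_def[abs_def])
      also have "72 * real J / (real N * d0) \<le> 72 / (real M1 * d0)"
      proof -
        have "72 * real J / (real N * d0) = (72 * real J / d0) * (1 / real N)" by simp
        also have "\<dots> \<le> (72 * real J / d0) * (1 / real N1)" using NJ d0(1) by (intro mult_left_mono) auto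
        also have "\<dots> = 72 / (real M1 * d0)" using J by (simp add: N1_def)
        finally show ?thesis .
      qed
      also have "14 / real N \<le> 14 * (1 / real J)" using NJ N_ge(2) by simp
      finally have "norm (fejer_sum \<beta> N 0 x - x) \<le> e2 + (norm x * (14 * (1 / real J)) + norm x * (72 / (real M1 * d0)))"
        by (simp add: distrib_left mult_left_mono)
      moreover have "norm x * (14 * (1 / real J)) \<le> norm x * (14 * (1 / real J) + 4 * t\<^sup>2 * (1 / real J)\<^sup>2)"
        by (intro mult_left_mono) auto
      ultimately show ?thesis using M1(3) J2 by simp
    qed
    interpret graded_pieces "left_mult ` B" "\<lambda>p. left_mult ` {y. analytic \<beta> (of_int p) y}"
      "\<lambda>n. left_mult (piece \<beta> n x)" "left_mult x" L
      unfolding \<beta>_def[abs_def] L_def by (rule graded_pieces_rescaled[OF B x J])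
    define \<theta> where "\<theta> n = triangle N0 n * \<phi> (of_int n * (t / real J))" for n
    let ?I = "{- int (2 * N1)..int (2 * N1)}"
    have far: "norm (left_mult x - (\<Sum>n\<in>?I. trapezoid N1 n *\<^sub>R left_mult (piece \<beta> n x))) \<le> 9 * e2"
    proof -
      have "norm (x - (2 *\<^sub>R fejer_sum \<beta> (2 * N1) 0 x - fejer_sum \<beta> N1 0 x))
          \<le> norm (fejer_sum \<beta> N1 0 x - x) + 2 * norm (fejer_sum \<beta> (2 * N1) 0 x - x)"
        by (rule norm_minus_double_le)
      then have "norm (x - (\<Sum>n\<in>?I. trapezoid N1 n *\<^sub>R piece \<beta> n x)) \<le> 9 * e2"
        using near_0[of N1] near_0[of "2 * N1"] unfolding sum_trapezoid_piece[OF N(2)] by simp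
      then show ?thesis by (simp flip: left_mult_simps left_mult_sum)
    qed
    have "\<exists>y\<in>left_mult ` B. norm ((\<Sum>n\<in>?I. \<theta> n *\<^sub>R left_mult (piece \<beta> n x)) - y)
        \<le> (9 * e2) * (2 + real N0 * \<delta>) + 11 * \<delta> * L * sqrt (real N0)"
    proof (rule dist_multiplier_sum_le[OF _ _ _ _ _ _ _ _ far])
      show "trapezoid N1 n \<noteq> 0 \<Longrightarrow> n \<in> ?I" for n
        using trapezoid_eq_0[of N1 n] N(2) by (cases "2 * int N1 \<le> \<bar>n\<bar>") auto
      show "trapezoid N1 n * \<theta> n = \<theta> n" for n
      proof (cases "\<bar>n\<bar> \<le> int N1")
        case False
        then have "triangle N0 n = 0" using N by (intro triangle_eq_0) auto
        then show ?thesis by (simp add: \<theta>_def)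
      qed (simp add: trapezoid_eq_1 N)
      show "n \<le> - int N0 \<Longrightarrow> \<theta> n = 0" for n using N by (simp add: \<theta>_def triangle_eq_0)
      show "\<bar>trapezoid N1 n\<bar> \<le> 1" for n by (rule abs_trapezoid_le[OF N(2)])
      show "\<bar>\<theta> n\<bar> \<le> 1" for n
        using mult_mono[OF triangle_bounds(2)[of N0 n] \<phi>(1)[of "of_int n * (t / real J)"]] triangle_bounds(1)[of N0 n]
        by (simp add: \<theta>_def abs_mult)
      show "\<bar>trapezoid N1 m - trapezoid N1 n\<bar> \<le> \<delta> * \<bar>real_of_int (m - n)\<bar>" for m n
      proof -
        have "2 / real N1 = 2 * (1 / real N1)" by simp
        also have "\<dots> \<le> 2 * (1 / real J)" using N_ge(2) by (rule mult_left_mono) simp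
        also have "\<dots> \<le> \<delta>" by (simp add: \<delta>_def divide_right_mono)
        finally have "2 / real N1 \<le> \<delta>" .
        then show ?thesis by (intro order.trans[OF trapezoid_lipschitz[OF N(2)]] mult_right_mono) auto
      qed
      show "\<bar>\<theta> m - \<theta> n\<bar> \<le> \<delta> * \<bar>real_of_int (m - n)\<bar>" for m n
      proof -
        let ?\<phi> = "\<lambda>n. \<phi> (of_int n * (t / real J))"
        have "\<theta> m - \<theta> n = triangle N0 m * (?\<phi> m - ?\<phi> n) + ?\<phi> n * (triangle N0 m - triangle N0 n)"
          by (simp add: \<theta>_def algebra_simps)
        also have "\<bar>\<dots>\<bar> \<le> \<bar>triangle N0 m\<bar> * \<bar>?\<phi> m - ?\<phi> n\<bar> + \<bar>?\<phi> n\<bar> * \<bar>triangle N0 m - triangle N0 n\<bar>"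
          by (metis abs_mult abs_triangle_ineq)
        also have "\<dots> \<le> 1 * \<bar>of_int m * (t / real J) - of_int n * (t / real J)\<bar> + 1 * (1 / real N0 * \<bar>real_of_int (m - n)\<bar>)"
          using triangle_bounds[of N0 m] \<phi> by (intro add_mono mult_mono triangle_lipschitz N) auto
        also have "\<bar>of_int m * (t / real J) - of_int n * (t / real J)\<bar> = \<bar>t\<bar> / real J * \<bar>real_of_int (m - n)\<bar>"
        proof -
          have "of_int m * (t / real J) - of_int n * (t / real J) = t / real J * real_of_int (m - n)"
            by (simp add: algebra_simps diff_divide_distrib)
          then show ?thesis by (simp only: abs_mult abs_divide abs_of_nat)
        qed
        also have "1 * (\<bar>t\<bar> / real J * \<bar>real_of_int (m - n)\<bar>) + 1 * (1 / real N0 * \<bar>real_of_int (m - n)\<bar>)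
            = (\<bar>t\<bar> / real J + 1 / real N0) * \<bar>real_of_int (m - n)\<bar>" by (simp add: distrib_right)
        also have "\<dots> \<le> \<delta> * \<bar>real_of_int (m - n)\<bar>"
        proof (intro mult_right_mono)
          have "\<delta> = 2 * (1 / real J) + \<bar>t\<bar> / real J" by (simp add: \<delta>_def add_divide_distrib)
          moreover have "0 \<le> 1 / real J" by simp
          ultimately show "\<bar>t\<bar> / real J + 1 / real N0 \<le> \<delta>" using N_ge(1) by linarith
        qed simp
        finally show ?thesis .
      qed
      show "\<delta> > 0" using J by (simp add: \<delta>_def add_pos_nonneg)
    qed
    then obtain b where "b \<in> B" and b: "norm ((\<Sum>n\<in>?I. \<theta> n *\<^sub>R left_mult (piece \<beta> n x)) - left_mult b)
        \<le> (9 * e2) * (2 + real N0 * \<delta>) + 11 * \<delta> * L * sqrt (real N0)" by blast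
    have sum_\<theta>: "(\<Sum>n\<in>?I. \<theta> n *\<^sub>R piece \<beta> n x)
        = w *\<^sub>C fejer_sum \<beta> N0 (t / real J) x + cnj w *\<^sub>C fejer_sum \<beta> N0 (- (t / real J)) x"
    proof -
      have "(\<Sum>n\<in>?I. \<theta> n *\<^sub>R piece \<beta> n x) = (\<Sum>n\<in>{- int N0..int N0}. \<theta> n *\<^sub>R piece \<beta> n x)"
        using N by (intro sum.mono_neutral_right) (auto simp: \<theta>_def triangle_eq_0)
      also have "\<dots> = (\<Sum>n\<in>{- int N0..int N0}. w *\<^sub>C ((of_real (triangle N0 n) * cis (of_int n * (t / real J))) *\<^sub>C piece \<beta> n x)
          + cnj w *\<^sub>C ((of_real (triangle N0 n) * cis (of_int n * - (t / real J))) *\<^sub>C piece \<beta> n x))"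
      proof (rule sum.cong[OF refl])
        fix n
        have "complex_of_real (\<theta> n) = w * (of_real (triangle N0 n) * cis (of_int n * (t / real J)))
            + cnj w * (of_real (triangle N0 n) * cis (of_int n * - (t / real J)))"
          unfolding \<theta>_def of_real_mult \<phi>(3) by (simp add: algebra_simps)
        then show "\<theta> n *\<^sub>R piece \<beta> n x = w *\<^sub>C ((of_real (triangle N0 n) * cis (of_int n * (t / real J))) *\<^sub>C piece \<beta> n x)
          + cnj w *\<^sub>C ((of_real (triangle N0 n) * cis (of_int n * - (t / real J))) *\<^sub>C piece \<beta> n x)"
          by (simp only: scaleC_of_real[symmetric] scaleC_add_left scaleC_scaleC)
      qed
      finally show ?thesis by (simp only: sum.distrib fejer_sum_def scaleC.sum_right)
    qed
    have "norm ((\<Sum>n\<in>?I. \<theta> n *\<^sub>R piece \<beta> n x) - b) \<le> 2 * e1"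
    proof -
      have "real N0 * \<delta> = real M0 * (2 + \<bar>t\<bar>)" using J by (simp add: N0_def \<delta>_def)
      then have "(9 * e2) * (2 + real N0 * \<delta>) = e1" using R by (simp add: R_def[symmetric] e2_def e1_def)
      moreover have "11 * \<delta> * L * sqrt (real N0) = 11 * (2 + \<bar>t\<bar>) * L * sqrt (real M0 * (1 / real J))"
      proof -
        have "sqrt (real N0) / real J = sqrt (real M0 * (1 / real J))"
          using J by (simp add: N0_def real_sqrt_mult real_sqrt_divide real_div_sqrt field_simps)
        moreover have "11 * \<delta> * L * sqrt (real N0) = 11 * (2 + \<bar>t\<bar>) * L * (sqrt (real N0) / real J)"
          by (simp add: \<delta>_def)
        ultimately show ?thesis by (simp only:)
      qed
      moreover have "norm ((\<Sum>n\<in>?I. \<theta> n *\<^sub>R piece \<beta> n x) - b)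
          \<le> (9 * e2) * (2 + real N0 * \<delta>) + 11 * \<delta> * L * sqrt (real N0)"
        using b by (simp flip: left_mult_simps left_mult_sum)
      ultimately show ?thesis using J3 by linarith
    qed
    then have b': "norm ((w *\<^sub>C fejer_sum \<beta> N0 (t / real J) x + cnj w *\<^sub>C fejer_sum \<beta> N0 (- (t / real J)) x) - b) \<le> 2 * e1"
      unfolding sum_\<theta> .
    have "norm ((w *\<^sub>C fejer_sum \<beta> N0 (t / real J) x + cnj w *\<^sub>C fejer_sum \<beta> N0 (- (t / real J)) x)
        - (w *\<^sub>C \<alpha> t x + cnj w *\<^sub>C \<alpha> (- t) x)) \<le> 6 * e1"
    proof -
      have "(w *\<^sub>C fejer_sum \<beta> N0 (t / real J) x + cnj w *\<^sub>C fejer_sum \<beta> N0 (- (t / real J)) x)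
        - (w *\<^sub>C \<alpha> t x + cnj w *\<^sub>C \<alpha> (- t) x) = w *\<^sub>C (fejer_sum \<beta> N0 (t / real J) x - \<alpha> t x)
        + cnj w *\<^sub>C (fejer_sum \<beta> N0 (- (t / real J)) x - \<alpha> (- t) x)"
        by (simp add: scaleC.diff_right)
      also have "norm \<dots> \<le> 1 * (3 * e1) + 1 * (3 * e1)"
        unfolding norm_scaleC[symmetric]
        using mult_mono[OF w near_t] mult_mono[OF w near_minus_t]
        by (intro norm_triangle_le add_mono) (simp_all add: norm_scaleC)
      finally show ?thesis by simp
    qed
    then have "dist b (w *\<^sub>C \<alpha> t x + cnj w *\<^sub>C \<alpha> (- t) x) \<le> 8 * e1"
      using b' dist_triangle3[of b "w *\<^sub>C \<alpha> t x + cnj w *\<^sub>C \<alpha> (- t) x"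
          "w *\<^sub>C fejer_sum \<beta> N0 (t / real J) x + cnj w *\<^sub>C fejer_sum \<beta> N0 (- (t / real J)) x"]
      unfolding dist_norm by linarith
    then show ?thesis using \<open>b \<in> B\<close> that by (intro bexI[of _ b]) (auto simp: e1_def)
  qed
  then show ?thesis using closure_approachable[of _ B] closure_closed[OF B(2)] by blast
qed

end

theorem corollary6:
  fixes \<alpha> :: "real \<Rightarrow> 'a::cstar_algebra \<Rightarrow> 'a"
    and B :: "'a set"
  assumes "cstar_dynamical_system \<alpha>"
    and "subalgebra B"
    and "closed B"
    and "spectral_subspace \<alpha> {0..} \<subseteq> B"
  shows "\<forall>t. \<alpha> t ` B \<subseteq> B"
proof (intro allI image_subsetI)
  fix t x assume "x \<in> B"
  interpret cstar_dynamical_system \<alpha> by (rule assms(1))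
  have mem: "w *\<^sub>C \<alpha> t x + cnj w *\<^sub>C \<alpha> (- t) x \<in> B"
    if "\<And>u. \<bar>\<phi> u\<bar> \<le> 1" "\<And>u v. \<bar>\<phi> u - \<phi> v\<bar> \<le> \<bar>u - v\<bar>"
      "\<And>u. complex_of_real (\<phi> u) = w * cis u + cnj w * cis (- u)" "cmod w \<le> 1" for \<phi> w
    by (rule trigonometric_translate_in_subalgebra[OF assms(2-4) \<open>x \<in> B\<close> that])
  \<comment> \<open>The choice w = 1/2 gives the cosine and w = -i/2 the sine; the translate is then
    recovered from cis u = cos u + i sin u.\<close>
  have "(1/2) *\<^sub>C \<alpha> t x + cnj (1/2) *\<^sub>C \<alpha> (- t) x \<in> B"
  proof (rule mem)
    show "\<bar>cos u - cos v\<bar> \<le> \<bar>u - v\<bar>" for u v :: real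
      using field_differentiable_bound[of UNIV cos "\<lambda>x. - sin x" 1 u v]
      by (auto intro!: derivative_eq_intros)
    show "complex_of_real (cos u) = 1 / 2 * cis u + cnj (1 / 2) * cis (- u)" for u
      by (simp add: complex_eq_iff)
  qed (simp_all add: norm_divide)
  moreover have "(- (\<i> / 2)) *\<^sub>C \<alpha> t x + cnj (- (\<i> / 2)) *\<^sub>C \<alpha> (- t) x \<in> B"
  proof (rule mem)
    show "\<bar>sin u - sin v\<bar> \<le> \<bar>u - v\<bar>" for u v :: real
      using field_differentiable_bound[of UNIV sin cos 1 u v]
      by (auto intro!: derivative_eq_intros)
    show "complex_of_real (sin u) = - (\<i> / 2) * cis u + cnj (- (\<i> / 2)) * cis (- u)" for u
      by (simp add: complex_eq_iff)
  qed (simp_all add: norm_divide)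
  ultimately have "((1/2) *\<^sub>C \<alpha> t x + cnj (1/2) *\<^sub>C \<alpha> (- t) x)
      + \<i> *\<^sub>C ((- (\<i> / 2)) *\<^sub>C \<alpha> t x + cnj (- (\<i> / 2)) *\<^sub>C \<alpha> (- t) x) \<in> B"
    using assms(2) unfolding subalgebra_def by blast
  also have "((1/2) *\<^sub>C \<alpha> t x + cnj (1/2) *\<^sub>C \<alpha> (- t) x)
      + \<i> *\<^sub>C ((- (\<i> / 2)) *\<^sub>C \<alpha> t x + cnj (- (\<i> / 2)) *\<^sub>C \<alpha> (- t) x) = \<alpha> t x"
  proof -
    have "(a *\<^sub>C y + b *\<^sub>C z) + \<i> *\<^sub>C (c *\<^sub>C y + d *\<^sub>C z) = (a + \<i> * c) *\<^sub>C y + (b + \<i> * d) *\<^sub>C z" 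
      for a b c d and y z :: 'a
      by (simp add: scaleC_add_left scaleC_add_right scaleC_scaleC)
    moreover have "1 / 2 + \<i> * - (\<i> / 2) = 1" "cnj (1 / 2) + \<i> * cnj (- (\<i> / 2)) = 0"
      by (simp_all add: complex_eq_iff)
    ultimately show ?thesis by (simp only: scaleC_one scaleC.zero_left add_0_right)
  qed
  finally show "\<alpha> t x \<in> B" .
qed

end
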